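(* Any $(S_3,4)$-colorable link is also $(S_3,5)$-colorable. Precisely, if a link $L$ in $S^3$ has a diagram which admits an $S_3$-coloring with exactly 4 colors, then $L$ also has a (possibly different) diagram which admits an $S_3$-coloring with exactly 5 colors.
   Context: $S_3$ is the symmetric group of degree 3, with identity $e$. Links are oriented links in $S^3$ (knots are one-component links), and $D$ denotes an oriented link diagram. An $S_3$-coloring on $D$ is a map $\Gamma$ from the set of arcs of $D$ to $S_3\setminus\{e\}$ such that at each crossing, with over arc $x$, under arc $y$ before passing through the crossing and under arc $z$ after passing through it, one has $\Gamma(x)\Gamma(y)=\Gamma(z)\Gamma(x)$ if the crossing is positive, and $\Gamma(x)\Gamma(z)=\Gamma(y)\Gamma(x)$ if the crossing is negative. The value $\Gamma(a)$ is the color of the arc $a$. For $n\in\{1,2,3,4,5\}$, an $(S_3,n)$-coloring is an $S_3$-coloring whose image has exactly $n$ elements (it uses $n$ colors). A link is $(S_3,n)$-colorable if it has some diagram admitting an $(S_3,n)$-coloring. *)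

theory Defs
  imports "HOL-Analysis.Analysis" "HOL-Algebra.Sym_Groups"
begin

section \<open>Oriented links and ambient isotopy\<close>

text \<open>
  An oriented link is a finite nonempty family of pairwise disjoint simple closed curves.
  Each component carries a parametrization; only its image and its direction matter, see
  \<open>same_oriented_loop\<close> and \<open>ambient_isotopic\<close>.
\<close>

definition link_space :: "(real \<Rightarrow> 'a::topological_space) set \<Rightarrow> 'a set" where
  "link_space L = (\<Union>g\<in>L. path_image g)"

definition oriented_link_in :: "'a::topological_space set \<Rightarrow> (real \<Rightarrow> 'a) set \<Rightarrow> bool" where
  "oriented_link_in X L \<longleftrightarrow>
     finite L \<and> L \<noteq> {} \<and>
     (\<forall>g\<in>L. simple_path g \<and> pathfinish g = pathstart g \<and> path_image g \<subseteq> X) \<and>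
     pairwise (\<lambda>g h. disjnt (path_image g) (path_image h)) L"

text \<open>Equality of closed curves up to the base point and orientation-preserving
  reparametrization.\<close>

definition same_oriented_loop :: "(real \<Rightarrow> 'a::topological_space) \<Rightarrow> (real \<Rightarrow> 'a) \<Rightarrow> bool" where
  "same_oriented_loop g g' \<longleftrightarrow>
     (\<exists>a\<in>{0..1}. \<exists>\<phi>::real \<Rightarrow> real.
        strict_mono_on {0..1} \<phi> \<and> \<phi> ` {0..1} = {0..1} \<and>
        (\<forall>t\<in>{0..1}. g t = shiftpath a g' (\<phi> t)))"

text \<open>
  The homotopy starts at the identity and runs through homeomorphisms of \<open>X\<close>. Since the
  components of a link are pairwise disjoint, the last two conditions force a bijection between
  the components of \<open>L\<close> and those of \<open>L'\<close>.
\<close>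

definition ambient_isotopic ::
  "'a::topological_space set \<Rightarrow> (real \<Rightarrow> 'a) set \<Rightarrow> (real \<Rightarrow> 'a) set \<Rightarrow> bool" where
  "ambient_isotopic X L L' \<longleftrightarrow>
     (\<exists>h. homotopic_with_canon (\<lambda>f. \<exists>f'. homeomorphism X X f f') X X id h \<and>
          h ` link_space L = link_space L' \<and>
          (\<forall>g\<in>L. \<exists>g'\<in>L'. same_oriented_loop (h \<circ> g) g'))"

text \<open>
  The 3-sphere is the unit sphere of the Euclidean space \<open>real^3 \<times> real\<close> (the product
  norm is the Euclidean one), and \<open>\<real>\<^sup>3\<close> is placed in it by inverse
  stereographic projection from the pole \<open>(0, 1)\<close>.
\<close>

definition S3 :: "((real^3) \<times> real) set" where
  "S3 = sphere 0 1"

definition inv_stereo :: "real^3 \<Rightarrow> (real^3) \<times> real" where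
  "inv_stereo p = ((2 / (p \<bullet> p + 1)) *\<^sub>R p, (p \<bullet> p - 1) / (p \<bullet> p + 1))"


section \<open>Diagrams\<close>

text \<open>
  A diagram is presented by a polygonal link in \<open>\<real>\<^sup>3\<close> in regular position: the plane
  picture is its projection to the first two coordinates, and the third coordinate tells over
  from under (the viewer looks down the third axis). Everything below that is read off from a
  diagram uses only the projection and the over/under information.
\<close>

definition plane_proj :: "real^3 \<Rightarrow> real \<times> real" where
  "plane_proj p = (p $ 1, p $ 2)"

definition polygonal :: "(real \<Rightarrow> 'a::real_normed_vector) \<Rightarrow> bool" where
  "polygonal g \<longleftrightarrow>
     (\<exists>B. finite B \<and>
        (\<forall>a b. 0 \<le> a \<and> a < b \<and> b \<le> 1 \<and> {a<..<b} \<inter> B = {} \<longrightarrow>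
           (\<forall>u\<in>{0..1}. g (linepath a b u) = linepath (g a) (g b) u)))"

text \<open>\<open>crossing D g s h t\<close>: at parameter \<open>s\<close> the component \<open>g\<close> passes over
  the component \<open>h\<close> at parameter \<open>t\<close> (\<open>g = h\<close> is allowed).\<close>

definition crossing ::
  "(real \<Rightarrow> real^3) set \<Rightarrow> (real \<Rightarrow> real^3) \<Rightarrow> real \<Rightarrow> (real \<Rightarrow> real^3) \<Rightarrow> real \<Rightarrow> bool" where
  "crossing D g s h t \<longleftrightarrow>
     g \<in> D \<and> h \<in> D \<and> s \<in> {0..1} \<and> t \<in> {0..1} \<and>
     plane_proj (g s) = plane_proj (h t) \<and> g s $ 3 > h t $ 3"

text \<open>The determinant of the plane directions of the over and the under strand. It is positive
  iff the over strand has to be turned counterclockwise (by less than a straight angle) to point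
  along the under strand, that is, iff the crossing is positive.\<close>

definition crossing_det :: "(real \<Rightarrow> real^3) \<Rightarrow> real \<Rightarrow> (real \<Rightarrow> real^3) \<Rightarrow> real \<Rightarrow> real" where
  "crossing_det g s h t =
     (let v = vector_derivative g (at s); w = vector_derivative h (at t)
      in v $ 1 * w $ 2 - v $ 2 * w $ 1)"

text \<open>
  Regular position: finitely many crossings, no triple points, and all crossings are transversal
  and away from the vertices (the base point of a component counts as a vertex).
\<close>

definition link_diagram :: "(real \<Rightarrow> real^3) set \<Rightarrow> bool" where
  "link_diagram D \<longleftrightarrow>
     oriented_link_in UNIV D \<and> (\<forall>g\<in>D. polygonal g) \<and>
     finite {(g, s, h, t). crossing D g s h t} \<and>
     (\<forall>p\<in>link_space D. \<forall>q\<in>link_space D. \<forall>r\<in>link_space D.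
        plane_proj p = plane_proj q \<and> plane_proj q = plane_proj r \<longrightarrow>
        p = q \<or> q = r \<or> p = r) \<and>
     (\<forall>g s h t. crossing D g s h t \<longrightarrow>
        s \<in> {0<..<1} \<and> t \<in> {0<..<1} \<and>
        g differentiable at s \<and> h differentiable at t \<and> crossing_det g s h t \<noteq> 0)"

definition diagram_of :: "(real \<Rightarrow> real^3) set \<Rightarrow> (real \<Rightarrow> (real^3) \<times> real) set \<Rightarrow> bool" where
  "diagram_of D L \<longleftrightarrow>
     link_diagram D \<and> ambient_isotopic S3 ((\<lambda>g. inv_stereo \<circ> g) ` D) L"

text \<open>The arcs are the pieces into which the link is cut at the undercrossings. The projection
  is injective on the complement of the undercrossing points, so these pieces correspond to the
  arcs in the plane picture. A component without undercrossings is a single (closed) arc.\<close>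

definition under_points :: "(real \<Rightarrow> real^3) set \<Rightarrow> (real^3) set" where
  "under_points D = {h t |g s h t. crossing D g s h t}"

definition diagram_arcs :: "(real \<Rightarrow> real^3) set \<Rightarrow> (real^3) set set" where
  "diagram_arcs D = components (link_space D - under_points D)"


section \<open>Colorings\<close>

text \<open>The arc \<open>x\<close> passes over the crossing; \<open>y\<close> and \<open>z\<close> are the under arcs just
  before and just after it, with respect to the orientation of the under strand.\<close>

definition crossing_arcs ::
  "(real \<Rightarrow> real^3) set \<Rightarrow> (real \<Rightarrow> real^3) \<Rightarrow> real \<Rightarrow> (real \<Rightarrow> real^3) \<Rightarrow> real \<Rightarrow>
   (real^3) set \<Rightarrow> (real^3) set \<Rightarrow> (real^3) set \<Rightarrow> bool" where
  "crossing_arcs D g s h t x y z \<longleftrightarrow>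
     crossing D g s h t \<and>
     x \<in> diagram_arcs D \<and> y \<in> diagram_arcs D \<and> z \<in> diagram_arcs D \<and>
     g s \<in> x \<and> (\<forall>\<^sub>F \<tau> in at_left t. h \<tau> \<in> y) \<and> (\<forall>\<^sub>F \<tau> in at_right t. h \<tau> \<in> z)"

definition S3_coloring ::
  "(real \<Rightarrow> real^3) set \<Rightarrow> ((real^3) set \<Rightarrow> (nat \<Rightarrow> nat)) \<Rightarrow> bool" where
  "S3_coloring D \<Gamma> \<longleftrightarrow>
     (\<forall>a\<in>diagram_arcs D. \<Gamma> a \<in> carrier (sym_group 3) - {\<one>\<^bsub>sym_group 3\<^esub>}) \<and>
     (\<forall>g s h t x y z. crossing_arcs D g s h t x y z \<longrightarrow>
        (crossing_det g s h t > 0 \<longrightarrow>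
           \<Gamma> x \<otimes>\<^bsub>sym_group 3\<^esub> \<Gamma> y = \<Gamma> z \<otimes>\<^bsub>sym_group 3\<^esub> \<Gamma> x) \<and>
        (crossing_det g s h t < 0 \<longrightarrow>
           \<Gamma> x \<otimes>\<^bsub>sym_group 3\<^esub> \<Gamma> z = \<Gamma> y \<otimes>\<^bsub>sym_group 3\<^esub> \<Gamma> x))"

definition S3_n_coloring ::
  "nat \<Rightarrow> (real \<Rightarrow> real^3) set \<Rightarrow> ((real^3) set \<Rightarrow> (nat \<Rightarrow> nat)) \<Rightarrow> bool" where
  "S3_n_coloring n D \<Gamma> \<longleftrightarrow> S3_coloring D \<Gamma> \<and> card (\<Gamma> ` diagram_arcs D) = n"

definition S3_n_colorable :: "nat \<Rightarrow> (real \<Rightarrow> (real^3) \<times> real) set \<Rightarrow> bool" where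
  "S3_n_colorable n L \<longleftrightarrow> (\<exists>D \<Gamma>. diagram_of D L \<and> S3_n_coloring n D \<Gamma>)"

end

theory Submission
  imports Defs
begin

text \<open>
  The nontrivial elements of \<open>S\<^sub>3\<close> are three transpositions and two three-cycles. So a coloring with
  four colors uses transpositions as well as three-cycles, and exactly one element \<open>w\<close> is missing.

  The only change of diagrams that is needed is the second Reidemeister move: a strand of color \<open>q\<close>
  is pushed, as a thin finger, under a neighboring strand of color \<open>p\<close>. All old colors survive, and
  the tip of the finger gets the conjugate of \<open>q\<close> by \<open>p\<close> or by its inverse, depending on the side
  from which it comes. Somewhere a strand with a three-cycle \<open>r\<close> has a strand with a
  transposition \<open>a\<close> as its neighbor: a segment in general position from a
  strand of the one kind to a strand of the other kind meets finitely many strands, and two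
  consecutive ones are of different kinds (\<open>clean_mixed_segment\<close>). Pushing the first strand under the second one gives the color \<open>a r a\<close>,
  the inverse of \<open>r\<close>. If this is \<open>w\<close>, there are five colors now. Otherwise \<open>w\<close> is a transposition
  different from \<open>a\<close>, hence the conjugate of \<open>a\<close> by \<open>r\<close> or by its inverse. At the crossing just created,
  the strand of color \<open>a\<close> extends to both sides of the under strand of color \<open>r\<close>, and a second push, of
  the former under the latter from the right side, gives \<open>w\<close> (\<open>finger_move_at_crossing\<close>).

  The push is an explicit piecewise linear homeomorphism of space with compact support. It moves
  points along a fixed direction by a hat function that falls with slope less than 1, so it is isotopic
  to the identity, and the isotopy extends to the 3-sphere (\<open>push_diagram_of\<close>). If the finger is thin
  and descends steeply, it creates exactly two crossings (\<open>crossing_D'_iff\<close>). Colorings of arcs are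
  handled as locally constant functions on the points of the link that are no undercrossings
  (\<open>S3_n_colorable_iff_point_coloring\<close>).
\<close>

section \<open>Isotopies of the 3-sphere\<close>

abbreviation north :: "(real^3) \<times> real" where "north \<equiv> (0, 1)"

definition stereo :: "(real^3) \<times> real \<Rightarrow> real^3" where
  "stereo x = (1 / (1 - snd x)) *\<^sub>R fst x"

lemma S3_iff: "x \<in> S3 \<longleftrightarrow> fst x \<bullet> fst x + (snd x)\<^sup>2 = 1"
proof -
  have "x \<in> S3 \<longleftrightarrow> norm x = 1" by (simp add: S3_def)
  also have "\<dots> \<longleftrightarrow> x \<bullet> x = 1" by (simp add: norm_eq_1)
  also have "x \<bullet> x = fst x \<bullet> fst x + (snd x)\<^sup>2"
    by (simp add: inner_prod_def power2_eq_square)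
  finally show ?thesis .
qed

lemma inv_stereo_in: "inv_stereo p \<in> S3"
proof -
  have pos: "p \<bullet> p + 1 > 0" by (simp add: add_nonneg_pos)
  have "(2 / (p \<bullet> p + 1))\<^sup>2 * (p \<bullet> p) + ((p \<bullet> p - 1) / (p \<bullet> p + 1))\<^sup>2 = 1"
    using pos by (simp add: divide_simps) (simp add: power2_eq_square algebra_simps)
  then show ?thesis
    unfolding S3_iff inv_stereo_def by (simp add: power2_eq_square mult.assoc)
qed

lemma inv_stereo_ne: "inv_stereo p \<noteq> north"
proof -
  have "p \<bullet> p + 1 > 0" by (simp add: add_nonneg_pos)
  then show ?thesis by (auto simp: inv_stereo_def divide_simps)
qed

lemma stereo_inv_stereo: "stereo (inv_stereo p) = p"
proof -
  have pos: "p \<bullet> p + 1 > 0" by (simp add: add_nonneg_pos)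
  have "1 - (p \<bullet> p - 1) / (p \<bullet> p + 1) = 2 / (p \<bullet> p + 1)"
    using pos by (simp add: divide_simps)
  moreover have "(p \<bullet> p + 1) / 2 * (2 / (p \<bullet> p + 1)) = 1" using pos by simp
  ultimately show ?thesis
    by (simp only: stereo_def inv_stereo_def fst_conv snd_conv scaleR_scaleR divide_divide_eq_right mult_1 scaleR_one)
qed

lemma snd_less_one:
  assumes "x \<in> S3" "x \<noteq> north" shows "snd x < 1"
proof -
  have eq: "fst x \<bullet> fst x + (snd x)\<^sup>2 = 1" using assms(1) by (simp add: S3_iff)
  then have "(snd x)\<^sup>2 \<le> 1" using inner_ge_zero[of "fst x"] by linarith
  then have le: "snd x \<le> 1" using abs_square_le_1[of "snd x"] by linarith
  have "snd x \<noteq> 1"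
  proof
    assume s1: "snd x = 1"
    then have "fst x = 0" using eq by simp
    then show False using s1 assms(2) by (metis prod.collapse)
  qed
  with le show ?thesis by simp
qed

lemma inv_stereo_stereo:
  assumes "x \<in> S3" "x \<noteq> north" shows "inv_stereo (stereo x) = x"
proof -
  obtain y z where x: "x = (y, z)" by fastforce
  have z: "z < 1" using snd_less_one[OF assms] x by simp
  have yy: "y \<bullet> y = 1 - z\<^sup>2" using assms(1) by (simp add: S3_iff x)
  have ss: "stereo x \<bullet> stereo x = (1 + z) / (1 - z)"
    using z by (simp add: stereo_def x yy divide_simps power2_eq_square) (simp add: algebra_simps)
  have s1: "stereo x \<bullet> stereo x + 1 = 2 / (1 - z)" and s2: "stereo x \<bullet> stereo x - 1 = 2 * z / (1 - z)"
    unfolding ss using z by (simp_all add: divide_simps)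
  show ?thesis
    unfolding inv_stereo_def s1 s2 using z by (simp add: stereo_def x)
qed

lemma inj_inv_stereo: "inj inv_stereo"
  by (metis injI stereo_inv_stereo)

lemma continuous_on_inv_stereo: "continuous_on A inv_stereo"
proof -
  have "p \<bullet> p + 1 > 0" for p :: "real^3" by (simp add: add_nonneg_pos)
  then have "p \<bullet> p + 1 \<noteq> 0" for p :: "real^3" by (metis less_irrefl)
  then show ?thesis unfolding inv_stereo_def by (intro continuous_intros) auto
qed

lemma continuous_on_stereo: "continuous_on (S3 - {north}) stereo"
  unfolding stereo_def using snd_less_one by (intro continuous_intros) fastforce

definition sphere_extension :: "(real^3 \<Rightarrow> real^3) \<Rightarrow> (real^3) \<times> real \<Rightarrow> (real^3) \<times> real" where
  "sphere_extension f x = (if x = north then north else inv_stereo (f (stereo x)))"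

lemma sphere_extension_inv_stereo: "sphere_extension f (inv_stereo p) = inv_stereo (f p)"
  by (simp add: sphere_extension_def inv_stereo_ne stereo_inv_stereo)

lemma north_in: "north \<in> S3"
  by (simp add: S3_iff)

lemma S3_eq: "S3 = insert north (range inv_stereo)"
proof
  show "S3 \<subseteq> insert north (range inv_stereo)"
  proof
    fix x assume x: "x \<in> S3"
    show "x \<in> insert north (range inv_stereo)"
    proof (cases "x = north")
      case False
      then have "x = inv_stereo (stereo x)" by (simp add: inv_stereo_stereo x)
      then show ?thesis by blast
    qed simp
  qed
qed (use inv_stereo_in north_in in auto)

lemma homeomorphism_cong_on:
  assumes "\<And>x. x \<in> topspace (top_of_set X) \<Longrightarrow> h x = k x"
  shows "(\<exists>f'. homeomorphism X Y h f') \<longleftrightarrow> (\<exists>f'. homeomorphism X Y k f')"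
proof -
  have "homeomorphism X Y h f' = homeomorphism X Y k f'" for f'
    using assms homeomorphism_cong[of X Y h f' X Y k f'] homeomorphism_cong[of X Y k f' X Y h f'] by auto
  then show ?thesis by simp
qed

text \<open>An isotopy of space with compact support extends over the point at infinity, because the
  extension is the identity near that point.\<close>

lemma sphere_extension_isotopy:
  fixes P :: "real \<Rightarrow> real^3 \<Rightarrow> real^3"
  assumes cont: "continuous_on ({0..1} \<times> UNIV) (\<lambda>(r, x). P r x)"
    and bij: "\<And>r. r \<in> {0..1} \<Longrightarrow> bij (P r)"
    and supp: "\<And>r x. norm x \<ge> R \<Longrightarrow> P r x = x"
    and P0: "\<And>x. P 0 x = x"
  shows "homotopic_with_canon (\<lambda>f. \<exists>f'. homeomorphism S3 S3 f f') S3 S3 id (sphere_extension (P 1))"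
proof -
  define F where "F = (\<lambda>(r, x). sphere_extension (P r) x)"
  define K where "K = inv_stereo ` cball 0 R"
  have cK: "compact K" unfolding K_def
    by (intro compact_continuous_image continuous_on_inv_stereo compact_cball)
  have KS: "K \<subseteq> S3" "north \<notin> K" unfolding K_def using inv_stereo_in inv_stereo_ne by auto (metis inv_stereo_ne)
  have Fid: "F (r, x) = x" if "x \<in> S3 - K" for r x
  proof (cases "x = north")
    case False
    then have x: "inv_stereo (stereo x) = x" using that inv_stereo_stereo by auto
    then have "stereo x \<notin> cball 0 R" using that unfolding K_def by (metis DiffD2 image_eqI)
    then have "P r (stereo x) = stereo x" by (intro supp) simp
    then show ?thesis using x False by (simp add: F_def sphere_extension_def)
  qed (simp add: F_def sphere_extension_def)
  have c1: "continuous_on ({0..1} \<times> (S3 - K)) F"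
  proof (rule continuous_on_eq[of _ snd])
    show "continuous_on ({0..1} \<times> (S3 - K)) snd" by (intro continuous_intros)
  qed (use Fid in auto)
  have c2: "continuous_on ({0..1} \<times> (S3 - {north})) F"
  proof (rule continuous_on_eq)
    show "continuous_on ({0..1} \<times> (S3 - {north})) (\<lambda>q. inv_stereo ((\<lambda>(r, x). P r x) (fst q, stereo (snd q))))"
      apply (rule continuous_on_compose2[OF continuous_on_inv_stereo[of UNIV]])
       apply (rule continuous_on_compose2[OF cont])
        apply (rule continuous_on_Pair)
         apply (intro continuous_intros)
        apply (rule continuous_on_compose2[OF continuous_on_stereo])
         apply (intro continuous_intros)
        apply auto
      done
    show "inv_stereo ((\<lambda>(r, x). P r x) (fst q, stereo (snd q))) = F q" if "q \<in> {0..1} \<times> (S3 - {north})" for q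
      using that by (cases q) (auto simp: F_def sphere_extension_def)
  qed
  have un: "({0..1::real} \<times> (S3 - K)) \<union> ({0..1} \<times> (S3 - {north})) = {0..1} \<times> S3"
    using KS by blast
  have "open (- K)" using cK compact_imp_closed by blast
  then have o1: "openin (top_of_set ({0..1} \<times> S3)) ({0..1::real} \<times> (S3 - K))"
    by (auto simp: openin_open intro!: exI[of _ "UNIV \<times> (- K)"] open_Times)
  have o2: "openin (top_of_set ({0..1} \<times> S3)) ({0..1::real} \<times> (S3 - {north}))"
    by (auto simp: openin_open intro!: exI[of _ "UNIV \<times> (- {north})"] open_Times)
  have cF: "continuous_on ({0..1} \<times> S3) F"
    using continuous_on_cases_local_open[of "{0..1} \<times> (S3 - K)" "{0..1} \<times> (S3 - {north})" F F "\<lambda>_. True"]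
      c1 c2 o1 o2 unfolding un by simp
  have img: "sphere_extension (P r) ` S3 = S3" and inj: "inj_on (sphere_extension (P r)) S3" if "r \<in> {0..1}" for r
  proof -
    have b: "bij (P r)" by (rule bij[OF that])
    have "sphere_extension (P r) ` S3 = insert north (range (\<lambda>p. inv_stereo (P r p)))"
      unfolding S3_eq by (auto simp: sphere_extension_inv_stereo image_iff) (auto simp: sphere_extension_def)
    also have "range (\<lambda>p. inv_stereo (P r p)) = range inv_stereo"
      using b unfolding image_image[symmetric, of inv_stereo "P r"] by (simp add: bij_is_surj)
    finally show "sphere_extension (P r) ` S3 = S3" using S3_eq by simp
    show "inj_on (sphere_extension (P r)) S3"
    proof (rule inj_onI)
      fix x y assume xy: "x \<in> S3" "y \<in> S3" "sphere_extension (P r) x = sphere_extension (P r) y"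
      show "x = y"
      proof (cases "x = north \<or> y = north")
        case True then show ?thesis using xy(3) inv_stereo_ne
          by (metis sphere_extension_def)
      next
        case False
        then have "P r (stereo x) = P r (stereo y)" using xy(3) inj_inv_stereo
          by (simp add: sphere_extension_def inj_eq)
        then have "stereo x = stereo y" using b by (simp add: bij_is_inj inj_eq)
        then show ?thesis using False xy inv_stereo_stereo by metis
      qed
    qed
  qed
  have cS3: "compact S3" by (simp add: S3_def)
  have hom: "\<exists>f'. homeomorphism S3 S3 (sphere_extension (P r)) f'" if "r \<in> {0..1}" for r
  proof (rule homeomorphism_compact[OF cS3 _ img[OF that] inj[OF that]])
    have "continuous_on S3 (\<lambda>x. F (r, x))"
      by (rule continuous_on_compose2[OF cF]) (use that in \<open>auto intro!: continuous_intros\<close>)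
    then show "continuous_on S3 (sphere_extension (P r))" by (simp add: F_def)
  qed
  have "continuous_map (prod_topology (top_of_set {0..1}) (top_of_set S3)) (top_of_set S3) F"
  proof -
    have "F ` ({0..1} \<times> S3) \<subseteq> S3" using img by (fastforce simp: F_def)
    then show ?thesis using cF by (auto simp: continuous_map_in_subtopology)
  qed
  moreover have "F (0, x) = id x" if "x \<in> topspace (top_of_set S3)" for x
    using that by (auto simp: F_def sphere_extension_def P0 inv_stereo_stereo)
  moreover have "F (1, x) = sphere_extension (P 1) x" for x by (simp add: F_def)
  moreover have "\<exists>f'. homeomorphism S3 S3 (\<lambda>x. F (r, x)) f'" if "r \<in> {0..1}" for r
    using hom[OF that] by (simp add: F_def)
  ultimately show ?thesis
    by (intro iffD2[OF homotopic_with[OF homeomorphism_cong_on]] exI[of _ F]) auto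
qed

text \<open>If \<open>h2\<close> carries \<open>L0\<close> to \<open>L\<close>, then \<open>h2\<close> after the inverse of \<open>h\<close> carries the image of \<open>L0\<close>
  under \<open>h\<close> to \<open>L\<close>. It is joined to the identity by the isotopy of \<open>h\<close> run backwards, followed by the
  isotopy of \<open>h2\<close>, both precomposed with the inverse of \<open>h\<close>.\<close>

lemma ambient_isotopic_precompose:
  assumes hom: "homotopic_with_canon (\<lambda>f. \<exists>f'. homeomorphism X X f f') X X id h"
    and iso: "ambient_isotopic X L0 L"
    and sub: "\<And>g. g \<in> L0 \<Longrightarrow> path_image g \<subseteq> X"
  shows "ambient_isotopic X ((\<circ>) h ` L0) L"
proof -
  obtain h' where h': "homeomorphism X X h h'"
    using homotopic_with_imp_property[OF hom] by blast
  then have h'h: "\<And>x. x \<in> X \<Longrightarrow> h' (h x) = x" and hh': "\<And>x. x \<in> X \<Longrightarrow> h (h' x) = x"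
    and ch': "continuous_on X h'" and h'X: "h' ` X = X"
    by (auto simp: homeomorphism_def)
  obtain h2 where h2: "homotopic_with_canon (\<lambda>f. \<exists>f'. homeomorphism X X f f') X X id h2"
    and im: "h2 ` link_space L0 = link_space L"
    and so: "\<And>g. g \<in> L0 \<Longrightarrow> \<exists>g'\<in>L. same_oriented_loop (h2 \<circ> g) g'"
    using iso unfolding ambient_isotopic_def by blast
  have q: "\<exists>f'. homeomorphism X X (j \<circ> h') f'" if "\<exists>f'. homeomorphism X X j f'" for j
    proof -
    from that obtain f' where "homeomorphism X X j f'" by blast
    then have "homeomorphism X X (j \<circ> h') (h \<circ> f')"
      by (rule homeomorphism_compose[OF homeomorphism_symD[OF h']])
    then show ?thesis by blast
  qed
  have cm: "continuous_map (top_of_set X) (top_of_set X) h'"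
    using ch' h'X by (auto simp: continuous_map_in_subtopology)
  have 1: "homotopic_with_canon (\<lambda>f. \<exists>f'. homeomorphism X X f f') X X (id \<circ> h') (h \<circ> h')"
    by (rule homotopic_with_compose_continuous_map_right[OF hom cm]) (use q in blast)
  have 2: "homotopic_with_canon (\<lambda>f. \<exists>f'. homeomorphism X X f f') X X (id \<circ> h') (h2 \<circ> h')"
    by (rule homotopic_with_compose_continuous_map_right[OF h2 cm]) (use q in blast)
  have "homotopic_with_canon (\<lambda>f. \<exists>f'. homeomorphism X X f f') X X (h \<circ> h') (h2 \<circ> h')"
    using homotopic_with_trans[OF homotopic_with_symD[OF 1] 2] .
  then have 3: "homotopic_with_canon (\<lambda>f. \<exists>f'. homeomorphism X X f f') X X id (h2 \<circ> h')"
  proof (rule homotopic_with_eq)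
    show "id x = (h \<circ> h') x" if "x \<in> topspace (top_of_set X)" for x
      using that hh' by simp
  qed (rule refl, rule homeomorphism_cong_on)
  have inX: "g t \<in> X" if "g \<in> L0" "t \<in> {0..1}" for g t
    using sub[OF that(1)] that(2) by (auto simp: path_image_def)
  have ls: "link_space ((\<circ>) h ` L0) = h ` link_space L0"
    by (auto simp: link_space_def path_image_compose)
  have im2: "(h2 \<circ> h') ` link_space ((\<circ>) h ` L0) = link_space L"
  proof -
    have "h' ` h ` link_space L0 = link_space L0"
    proof -
      have "x \<in> X" if "x \<in> link_space L0" for x using that sub by (auto simp: link_space_def)
      then show ?thesis using h'h by (simp add: image_image)
    qed
    then show ?thesis by (simp only: ls im image_comp[symmetric])
  qed
  have so2: "\<exists>g'\<in>L. same_oriented_loop (h2 \<circ> h' \<circ> (h \<circ> g)) g'" if "g \<in> L0" for g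
  proof -
    obtain g' where g': "g' \<in> L" "same_oriented_loop (h2 \<circ> g) g'" using so[OF \<open>g \<in> L0\<close>] by blast
    have "(h2 \<circ> h' \<circ> (h \<circ> g)) t = (h2 \<circ> g) t" if "t \<in> {0..1}" for t
      using inX[OF \<open>g \<in> L0\<close> that] h'h by simp
    then have "same_oriented_loop (h2 \<circ> h' \<circ> (h \<circ> g)) g'"
      using g'(2) unfolding same_oriented_loop_def by simp
    then show ?thesis using g'(1) by blast
  qed
  show ?thesis
    unfolding ambient_isotopic_def
    by (intro exI[of _ "h2 \<circ> h'"] conjI 3 im2) (use so2 in auto)
qed

text \<open>On each line parallel to \<open>E\<close> the push is a strictly increasing function, which is the identity
  far out; therefore it is a bijection of the line.\<close>

lemma bij_push:
  fixes \<phi> :: "'a::real_normed_vector \<Rightarrow> real" and E :: 'a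
  assumes cont: "continuous_on UNIV \<phi>"
    and supp: "\<And>x. norm x \<ge> R \<Longrightarrow> \<phi> x = 0"
    and mono: "\<And>x a. a > 0 \<Longrightarrow> \<phi> (x + a *\<^sub>R E) > \<phi> x - a"
    and r: "0 \<le> r" "r \<le> 1" and E: "E \<noteq> 0"
  shows "bij (\<lambda>x. x + (r * \<phi> x) *\<^sub>R E)"
proof (rule bijI)
  have *: False if "a > 0" "x + (r * \<phi> x) *\<^sub>R E = (x + a *\<^sub>R E) + (r * \<phi> (x + a *\<^sub>R E)) *\<^sub>R E" for x a
  proof -
    have "(r * \<phi> x) *\<^sub>R E = (a + r * \<phi> (x + a *\<^sub>R E)) *\<^sub>R E"
      using that(2) by (simp add: scaleR_left_distrib add.assoc)
    then have "r * \<phi> x = a + r * \<phi> (x + a *\<^sub>R E)" using E by simp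
    then have eq: "r * (\<phi> x - \<phi> (x + a *\<^sub>R E)) = a" by (simp add: algebra_simps)
    have lt: "\<phi> x - \<phi> (x + a *\<^sub>R E) < a" using mono[OF that(1), of x] by linarith
    have pos: "\<phi> x - \<phi> (x + a *\<^sub>R E) > 0" using eq that(1) r(1)
      by (metis less_eq_real_def mult_nonneg_nonpos not_less)
    have "r * (\<phi> x - \<phi> (x + a *\<^sub>R E)) \<le> \<phi> x - \<phi> (x + a *\<^sub>R E)"
      using pos r by (intro mult_left_le_one_le) auto
    then show False unfolding eq using lt by simp
  qed
  show "inj (\<lambda>x. x + (r * \<phi> x) *\<^sub>R E)"
  proof (rule injI)
    fix x y assume eq: "x + (r * \<phi> x) *\<^sub>R E = y + (r * \<phi> y) *\<^sub>R E"
    define a where "a = r * \<phi> x - r * \<phi> y"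
    have y: "y = x + a *\<^sub>R E" using eq by (simp add: a_def algebra_simps)
    then have x: "x = y + (- a) *\<^sub>R E" by simp
    show "x = y"
    proof (rule ccontr)
      assume "x \<noteq> y"
      then have "a \<noteq> 0" using y by auto
      then consider "a > 0" | "- a > 0" by linarith
      then show False
      proof cases
        case 1 show False using *[OF 1, of x] eq unfolding y[symmetric] by simp
      next
        case 2 show False using *[OF 2, of y] eq unfolding x[symmetric] by simp
      qed
    qed
  qed
  show "surj (\<lambda>x. x + (r * \<phi> x) *\<^sub>R E)"
  proof (rule surjI)
    fix y :: 'a
    define T where "T = (\<bar>R\<bar> + norm y) / norm E"
    have nE: "norm E > 0" using E by simp
    have T0: "T \<ge> 0" by (simp add: T_def)
    have far: "\<phi> (y + s *\<^sub>R E) = 0" if "\<bar>s\<bar> = T" for s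
    proof (rule supp)
      have "norm (s *\<^sub>R E) = \<bar>R\<bar> + norm y" using that nE by (simp add: T_def)
      then show "R \<le> norm (y + s *\<^sub>R E)"
        using norm_diff_ineq[of "s *\<^sub>R E" y] by (simp add: add.commute)
    qed
    define G where "G s = s + r * \<phi> (y + s *\<^sub>R E)" for s
    have "continuous_on {-T..T} G" unfolding G_def
      by (intro continuous_intros continuous_on_compose2[OF cont]) auto
    moreover have "G (-T) \<le> 0" "0 \<le> G T" using far[of T] far[of "-T"] T0 by (auto simp: G_def)
    ultimately obtain s where "G s = 0" using IVT'[of G "-T" 0 T] T0 by auto
    have "y + s *\<^sub>R E + (r * \<phi> (y + s *\<^sub>R E)) *\<^sub>R E = y + G s *\<^sub>R E"
      by (simp add: G_def scaleR_left_distrib)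
    then have "y + s *\<^sub>R E + (r * \<phi> (y + s *\<^sub>R E)) *\<^sub>R E = y" using \<open>G s = 0\<close> by simp
    then show "(SOME x. x + (r * \<phi> x) *\<^sub>R E = y) + (r * \<phi> (SOME x. x + (r * \<phi> x) *\<^sub>R E = y)) *\<^sub>R E = y"
      by (rule someI[of "\<lambda>x. x + (r * \<phi> x) *\<^sub>R E = y"])
  qed
qed

text \<open>The isotopy scales the displacement \<open>\<phi> x *\<^sub>R E\<close> by a factor that grows from 0 to 1.\<close>

lemma push_diagram_of:
  fixes \<phi> :: "real^3 \<Rightarrow> real" and E :: "real^3"
  assumes cont: "continuous_on UNIV \<phi>"
    and supp: "\<And>x. norm x \<ge> R \<Longrightarrow> \<phi> x = 0"
    and mono: "\<And>x a. a > 0 \<Longrightarrow> \<phi> (x + a *\<^sub>R E) > \<phi> x - a"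
    and E: "E \<noteq> 0"
    and D: "diagram_of D L"
    and D': "link_diagram ((\<lambda>g. (\<lambda>x. x + \<phi> x *\<^sub>R E) \<circ> g) ` D)"
  shows "diagram_of ((\<lambda>g. (\<lambda>x. x + \<phi> x *\<^sub>R E) \<circ> g) ` D) L"
proof -
  define P where "P r x = x + (r * \<phi> x) *\<^sub>R E" for r x
  have hom: "homotopic_with_canon (\<lambda>f. \<exists>f'. homeomorphism S3 S3 f f') S3 S3 id (sphere_extension (P 1))"
  proof (rule sphere_extension_isotopy)
    show "continuous_on ({0..1} \<times> UNIV) (\<lambda>(r, x). P r x)"
      unfolding P_def case_prod_beta'
      by (intro continuous_intros continuous_on_compose2[OF cont]) auto
    show "bij (P r)" if "r \<in> {0..1}" for r
      unfolding P_def using bij_push[OF cont supp mono _ _ E] that by simp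
    show "P r x = x" if "R \<le> norm x" for r x
      using supp[OF that] by (simp add: P_def)
  qed (simp add: P_def)
  have iso: "ambient_isotopic S3 ((\<lambda>g. inv_stereo \<circ> g) ` D) L"
    using D by (simp add: diagram_of_def)
  have "ambient_isotopic S3 ((\<circ>) (sphere_extension (P 1)) ` ((\<lambda>g. inv_stereo \<circ> g) ` D)) L"
    by (rule ambient_isotopic_precompose[OF hom iso]) (auto simp: path_image_def inv_stereo_in)
  moreover have "(\<circ>) (sphere_extension (P 1)) ` ((\<lambda>g. inv_stereo \<circ> g) ` D)
      = (\<lambda>g. inv_stereo \<circ> g) ` ((\<lambda>g. (\<lambda>x. x + \<phi> x *\<^sub>R E) \<circ> g) ` D)"
    by (simp add: image_image o_def sphere_extension_inv_stereo P_def)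
  ultimately show ?thesis using D' by (simp add: diagram_of_def)
qed

section \<open>Colorings as locally constant functions\<close>

definition arc_points :: "(real \<Rightarrow> real^3) set \<Rightarrow> (real^3) set" where
  "arc_points D = link_space D - under_points D"

abbreviation S3_mult :: "(nat \<Rightarrow> nat) \<Rightarrow> (nat \<Rightarrow> nat) \<Rightarrow> nat \<Rightarrow> nat" (infixl "\<star>" 70) where
  "x \<star> y \<equiv> x \<otimes>\<^bsub>sym_group 3\<^esub> y"

abbreviation S3_colors :: "(nat \<Rightarrow> nat) set" where
  "S3_colors \<equiv> carrier (sym_group 3) - {\<one>\<^bsub>sym_group 3\<^esub>}"

text \<open>The rule at a crossing of sign \<open>sgn d\<close> with over color \<open>x\<close>, where the color of the under
  strand changes from \<open>y\<close> to \<open>z\<close>.\<close>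

abbreviation wirtinger :: "real \<Rightarrow> (nat \<Rightarrow> nat) \<Rightarrow> (nat \<Rightarrow> nat) \<Rightarrow> (nat \<Rightarrow> nat) \<Rightarrow> bool" where
  "wirtinger d x y z \<equiv> (d > 0 \<longrightarrow> x \<star> y = z \<star> x) \<and> (d < 0 \<longrightarrow> x \<star> z = y \<star> x)"

text \<open>Colors are attached to points instead of arcs: a local change of the diagram alters the arcs that it
  touches as a whole, but it leaves all points outside a small region alone.\<close>

definition point_coloring :: "(real \<Rightarrow> real^3) set \<Rightarrow> (real^3 \<Rightarrow> nat \<Rightarrow> nat) \<Rightarrow> bool" where
  "point_coloring D c \<longleftrightarrow>
     (\<forall>p\<in>arc_points D. c p \<in> S3_colors) \<and>
     (\<forall>p\<in>arc_points D. \<forall>\<^sub>F q in at p within arc_points D. c q = c p) \<and>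
     (\<forall>g s h t y z. crossing D g s h t \<longrightarrow>
        (\<forall>\<^sub>F \<tau> in at_left t. c (h \<tau>) = y) \<longrightarrow> (\<forall>\<^sub>F \<tau> in at_right t. c (h \<tau>) = z) \<longrightarrow>
        wirtinger (crossing_det g s h t) (c (g s)) y z)"

lemma point_coloringD:
  assumes "point_coloring D c"
  shows "\<And>p. p \<in> arc_points D \<Longrightarrow> c p \<in> S3_colors"
    and "\<And>p. p \<in> arc_points D \<Longrightarrow> \<forall>\<^sub>F q in at p within arc_points D. c q = c p"
    and "\<And>g s h t y z. crossing D g s h t \<Longrightarrow>
        \<forall>\<^sub>F \<tau> in at_left t. c (h \<tau>) = y \<Longrightarrow> \<forall>\<^sub>F \<tau> in at_right t. c (h \<tau>) = z \<Longrightarrow>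
        wirtinger (crossing_det g s h t) (c (g s)) y z"
  using assms unfolding point_coloring_def by blast+

lemma link_diagramD:
  assumes "link_diagram D"
  shows "finite D" "D \<noteq> {}"
    and "\<And>g. g \<in> D \<Longrightarrow> simple_path g" "\<And>g. g \<in> D \<Longrightarrow> pathfinish g = pathstart g"
    and "\<And>g h. g \<in> D \<Longrightarrow> h \<in> D \<Longrightarrow> g \<noteq> h \<Longrightarrow> path_image g \<inter> path_image h = {}"
    and "\<And>g. g \<in> D \<Longrightarrow> polygonal g"
    and "finite {(g, s, h, t). crossing D g s h t}"
    and "\<And>p q r. p \<in> link_space D \<Longrightarrow> q \<in> link_space D \<Longrightarrow> r \<in> link_space D \<Longrightarrow>
        plane_proj p = plane_proj q \<Longrightarrow> plane_proj q = plane_proj r \<Longrightarrow> p = q \<or> q = r \<or> p = r"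
    and "\<And>g s h t. crossing D g s h t \<Longrightarrow>
        s \<in> {0<..<1} \<and> t \<in> {0<..<1} \<and>
        g differentiable at s \<and> h differentiable at t \<and> crossing_det g s h t \<noteq> 0"
  using assms unfolding link_diagram_def oriented_link_in_def pairwise_def disjnt_def by blast+

lemma link_diagram_continuous: "link_diagram D \<Longrightarrow> g \<in> D \<Longrightarrow> continuous_on {0..1} g"
  using link_diagramD(3) by (auto simp: simple_path_def path_def)

text \<open>Only the base point of a component has two parameters, 0 and 1.\<close>

lemma link_diagram_param_unique:
  assumes D: "link_diagram D" and g: "g \<in> D" "s \<in> {0..1}" and h: "h \<in> D" "t \<in> {0<..<1}"
    and eq: "g s = h t"
  shows "g = h \<and> s = t"
proof -
  have t: "t \<in> {0..1}" using h(2) by auto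
  then have "path_image g \<inter> path_image h \<noteq> {}" using g h eq by (force simp: path_image_def)
  then have gh: "g = h" using link_diagramD(5)[OF D g(1) h(1)] by blast
  have "loop_free h" using link_diagramD(3)[OF D h(1)] by (simp add: simple_path_def)
  then have "s = t \<or> s = 0 \<and> t = 1 \<or> s = 1 \<and> t = 0"
    using eq g(2) t unfolding gh loop_free_def by blast
  then show ?thesis using gh h(2) by auto
qed

lemma link_space_eq: "link_space D = {g t |g t. g \<in> D \<and> t \<in> {0..1}}"
  unfolding link_space_def path_image_def by blast

lemma in_link_space: "g \<in> D \<Longrightarrow> t \<in> {0..1} \<Longrightarrow> g t \<in> link_space D"
  by (auto simp: link_space_eq)

lemma crossingD:
  assumes "crossing D g s h t"
  shows "g \<in> D" "h \<in> D" "s \<in> {0..1}" "t \<in> {0..1}"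
    "plane_proj (g s) = plane_proj (h t)" "g s $ 3 > h t $ 3"
  using assms unfolding crossing_def by auto

lemma finite_under_points:
  assumes "link_diagram D" shows "finite (under_points D)"
proof -
  have "under_points D = (\<lambda>(g, s, h, t). h t) ` {(g, s, h, t). crossing D g s h t}"
    by (force simp: under_points_def)
  then show ?thesis using link_diagramD(7)[OF assms] by simp
qed

text \<open>An over point that is also an under point would give three points of the link above one
  point of the plane.\<close>

lemma over_point_in_arc_points:
  assumes D: "link_diagram D" and c: "crossing D g s h t"
  shows "g s \<in> arc_points D"
proof -
  have False if "crossing D g' s' h' t'" and eq: "h' t' = g s" for g' s' h' t'
  proof -
    have "h t = g s \<or> g s = g' s' \<or> h t = g' s'"
      using crossingD[OF c] crossingD[OF that(1)] eq
      by (intro link_diagramD(8)[OF D] in_link_space) (auto simp: eq)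
    then show False using crossingD(6)[OF c] crossingD(6)[OF that(1)] eq by auto
  qed
  then have "g s \<notin> under_points D" unfolding under_points_def by fastforce
  then show ?thesis using in_link_space[OF crossingD(1,3)[OF c]] by (simp add: arc_points_def)
qed

lemma under_params_finite:
  assumes D: "link_diagram D" and h: "h \<in> D"
  shows "finite {\<tau>\<in>{0<..<1}. h \<tau> \<in> under_points D}"
proof -
  have "inj_on h {0<..<1}"
    by (rule inj_onI) (use link_diagram_param_unique[OF D h _ h] in auto)
  from finite_vimage_IntI[OF finite_under_points[OF D] this] show ?thesis
    by (rule finite_subset[rotated]) auto
qed

lemma no_under_points_near:
  assumes D: "link_diagram D" and h: "h \<in> D" and t: "t \<in> {0<..<1}"
  obtains e where "e > 0" "{t-e<..<t+e} \<subseteq> {0<..<1}"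
    "\<And>\<tau>. \<tau> \<in> {t-e<..<t+e} \<Longrightarrow> \<tau> \<noteq> t \<Longrightarrow> h \<tau> \<in> arc_points D"
proof -
  define A where "A = {\<tau>\<in>{0<..<1}. h \<tau> \<in> under_points D} - {t}"
  have "finite A" using under_params_finite[OF D h] by (simp add: A_def)
  then have "open ({0<..<1} - A)" by (intro open_Diff finite_imp_closed) auto
  moreover have "t \<in> {0<..<1} - A" using t by (simp add: A_def)
  ultimately obtain e where e: "e > 0" "ball t e \<subseteq> {0<..<1} - A" by (meson openE)
  have b: "{t-e<..<t+e} = ball t e" by (auto simp: dist_real_def)
  show ?thesis
  proof (rule that[OF e(1)])
    show "{t-e<..<t+e} \<subseteq> {0<..<1}" using e b by auto
    show "h \<tau> \<in> arc_points D" if "\<tau> \<in> {t-e<..<t+e}" "\<tau> \<noteq> t" for \<tau>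
    proof -
      have "\<tau> \<in> {0<..<1} - A" using that e b by auto
      then show ?thesis using that(2) in_link_space[OF h, of \<tau>]
        by (auto simp: A_def arc_points_def)
    qed
  qed
qed

lemma arc_before_after:
  assumes D: "link_diagram D" and h: "h \<in> D" and t: "t \<in> {0<..<1}"
  shows "\<exists>y\<in>diagram_arcs D. \<forall>\<^sub>F \<tau> in at_left t. h \<tau> \<in> y"
    and "\<exists>z\<in>diagram_arcs D. \<forall>\<^sub>F \<tau> in at_right t. h \<tau> \<in> z"
proof -
  obtain e where e: "e > 0" "{t-e<..<t+e} \<subseteq> {0<..<1}"
    "\<And>\<tau>. \<tau> \<in> {t-e<..<t+e} \<Longrightarrow> \<tau> \<noteq> t \<Longrightarrow> h \<tau> \<in> arc_points D"
    using no_under_points_near[OF assms] by blast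
  have *: "\<exists>y\<in>diagram_arcs D. h ` {a<..<b} \<subseteq> y"
    if "{a<..<b} \<subseteq> {t-e<..<t+e} - {t}" "a < b" for a b
  proof -
    have "continuous_on {a<..<b} h"
      using link_diagram_continuous[OF D h] by (rule continuous_on_subset) (use that e in force)
    then have con: "connected (h ` {a<..<b})" by (intro connected_continuous_image) auto
    have sub: "h ` {a<..<b} \<subseteq> arc_points D" using that e(3) by blast
    define m where "m = h ((a + b) / 2)"
    have m: "m \<in> h ` {a<..<b}" using that(2) by (auto simp: m_def)
    show ?thesis
    proof
      show "connected_component_set (arc_points D) m \<in> diagram_arcs D"
        using m sub unfolding diagram_arcs_def arc_points_def[symmetric] by (intro componentsI) auto
      show "h ` {a<..<b} \<subseteq> connected_component_set (arc_points D) m"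
        using connected_component_maximal[OF m con sub] .
    qed
  qed
  have "{t-e<..<t} \<subseteq> {t-e<..<t+e} - {t}" "{t<..<t+e} \<subseteq> {t-e<..<t+e} - {t}" using e(1) by auto
  then have both: "\<exists>y\<in>diagram_arcs D. h ` {t-e<..<t} \<subseteq> y" "\<exists>y\<in>diagram_arcs D. h ` {t<..<t+e} \<subseteq> y"
    using *[of "t-e" t] *[of t "t+e"] e(1) by auto
  obtain y where y: "y \<in> diagram_arcs D" "h ` {t-e<..<t} \<subseteq> y" using both(1) by blast
  then have "\<forall>\<^sub>F \<tau> in at_left t. h \<tau> \<in> y"
    using e(1) by (auto simp: eventually_at_left_field intro!: exI[of _ "t-e"])
  then show "\<exists>y\<in>diagram_arcs D. \<forall>\<^sub>F \<tau> in at_left t. h \<tau> \<in> y" using y(1) by blast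
  obtain z where z: "z \<in> diagram_arcs D" "h ` {t<..<t+e} \<subseteq> z" using both(2) by blast
  then have "\<forall>\<^sub>F \<tau> in at_right t. h \<tau> \<in> z"
    using e(1) by (auto simp: eventually_at_right_field intro!: exI[of _ "t+e"])
  then show "\<exists>z\<in>diagram_arcs D. \<forall>\<^sub>F \<tau> in at_right t. h \<tau> \<in> z" using z(1) by blast
qed

lemma locally_connected_path_image:
  fixes g :: "real \<Rightarrow> 'a::metric_space"
  assumes "path g" shows "locally connected (path_image g)"
  unfolding path_image_def
proof (rule locally_connected_quotient_image)
  show "locally connected {0..1::real}"
    by (simp add: convex_imp_locally_connected)
  have q: "quotient_map (top_of_set {0..1}) (top_of_set (g ` {0..1})) g"
    using assms by (intro continuous_imp_quotient_map)
      (auto simp: path_def compact_space_subtopology Hausdorff_space_subtopology Hausdorff_space_euclidean)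
  show "openin (top_of_set {0..1}) ({0..1} \<inter> g -` T) = openin (top_of_set (g ` {0..1})) T"
    if "T \<subseteq> g ` {0..1}" for T
    using q that unfolding quotient_map_def by (simp add: vimage_def Int_def)
qed

text \<open>A component of the link is locally connected, being a quotient of the interval, and it has a
  positive distance from the other components. Hence the arcs are open in the set of arc points.\<close>

lemma component_neighbourhood:
  assumes D: "link_diagram D" and p: "p \<in> arc_points D"
  shows "\<forall>\<^sub>F q in at p within arc_points D. q \<in> connected_component_set (arc_points D) p"
proof -
  obtain g where g: "g \<in> D" "p \<in> path_image g"
    using p by (auto simp: arc_points_def link_space_def)
  define A where "A = path_image g - under_points D"
  define O' where "O' = \<Union> (path_image ` (D - {g}))"
  have path: "path f" if "f \<in> D" for f
    using link_diagramD(3)[OF D that] by (simp add: simple_path_def)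
  have "closed O'" unfolding O'_def using link_diagramD(1)[OF D] path
    by (intro closed_UN) (auto intro: closed_path_image)
  moreover have "A = arc_points D \<inter> - O'"
    using link_diagramD(5)[OF D] g(1) unfolding A_def O'_def arc_points_def link_space_def by fast
  ultimately have A1: "openin (top_of_set (arc_points D)) A"
    by (auto simp: openin_open)
  have "openin (top_of_set (path_image g)) A"
    unfolding A_def openin_open
    by (rule exI[of _ "- under_points D"]) (use finite_under_points[OF D] finite_imp_closed in auto)
  then have "locally connected A"
    using locally_open_subset locally_connected_path_image[OF path[OF g(1)]] by blast
  moreover have pA: "p \<in> A" using g p by (simp add: A_def arc_points_def)
  ultimately have "openin (top_of_set A) (connected_component_set A p)"
    by (intro openin_components_locally_connected componentsI)
  then have "openin (top_of_set (arc_points D)) (connected_component_set A p)"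
    using A1 by (rule openin_trans)
  then obtain T where T: "open T" "connected_component_set A p = arc_points D \<inter> T"
    unfolding openin_open by blast
  have "p \<in> connected_component_set A p" using pA by simp
  then have "p \<in> T" using T(2) by blast
  have sub: "arc_points D \<inter> T \<subseteq> connected_component_set (arc_points D) p"
    unfolding T(2)[symmetric] using A1 by (intro connected_component_mono openin_imp_subset)
  show ?thesis unfolding eventually_at_topological
    using T(1) \<open>p \<in> T\<close> sub by blast
qed

lemma eventually_const_unique:
  assumes "\<forall>\<^sub>F x in F. f x = a" "\<forall>\<^sub>F x in F. f x = b" "F \<noteq> bot" shows "a = b"
proof -
  have "\<forall>\<^sub>F x in F. a = b" using assms(1,2) by eventually_elim simp
  then show ?thesis using assms(3) by simp
qed

lemma point_coloring_of_S3_coloring: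
  assumes D: "link_diagram D" and col: "S3_coloring D \<Gamma>"
  shows "\<exists>c. point_coloring D c \<and> c ` arc_points D = \<Gamma> ` diagram_arcs D"
proof (intro exI conjI)
  let ?S = "arc_points D"
  define c where "c p = \<Gamma> (connected_component_set ?S p)" for p
  have arcs: "diagram_arcs D = (\<lambda>p. connected_component_set ?S p) ` ?S"
    by (auto simp: diagram_arcs_def components_def arc_points_def)
  show "c ` ?S = \<Gamma> ` diagram_arcs D" by (simp add: arcs c_def image_image)
  have in_arc: "c p = \<Gamma> a" if "a \<in> diagram_arcs D" "p \<in> a" for p a
  proof -
    obtain q where "q \<in> ?S" "a = connected_component_set ?S q" using \<open>a \<in> diagram_arcs D\<close> arcs by auto
    then have "connected_component_set ?S p = a" using \<open>p \<in> a\<close> connected_component_eq[of p ?S q] by simp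
    then show ?thesis by (simp add: c_def)
  qed
  show "point_coloring D c" unfolding point_coloring_def
  proof (intro conjI ballI allI impI)
    fix p assume p: "p \<in> ?S"
    then have "connected_component_set ?S p \<in> diagram_arcs D" by (auto simp: arcs)
    then show "c p \<in> S3_colors"
      using col unfolding S3_coloring_def c_def by blast
    show "\<forall>\<^sub>F q in at p within ?S. c q = c p"
      using component_neighbourhood[OF D p]
      by eventually_elim (metis c_def connected_component_eq)
  next
    fix g s h t y z
    assume cr: "crossing D g s h t" and y: "\<forall>\<^sub>F \<tau> in at_left t. c (h \<tau>) = y"
      and z: "\<forall>\<^sub>F \<tau> in at_right t. c (h \<tau>) = z"
    have t: "t \<in> {0<..<1}" using link_diagramD(9)[OF D cr] by blast
    obtain Y where Y: "Y \<in> diagram_arcs D" "\<forall>\<^sub>F \<tau> in at_left t. h \<tau> \<in> Y"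
      using arc_before_after(1)[OF D crossingD(2)[OF cr] t] by blast
    obtain Z where Z: "Z \<in> diagram_arcs D" "\<forall>\<^sub>F \<tau> in at_right t. h \<tau> \<in> Z"
      using arc_before_after(2)[OF D crossingD(2)[OF cr] t] by blast
    define X where "X = connected_component_set ?S (g s)"
    have gs: "g s \<in> ?S" by (rule over_point_in_arc_points[OF D cr])
    have X: "X \<in> diagram_arcs D" "g s \<in> X" using gs by (auto simp: X_def arcs)
    have "\<forall>\<^sub>F \<tau> in at_left t. c (h \<tau>) = \<Gamma> Y"
      using Y(2) by eventually_elim (rule in_arc[OF Y(1)])
    then have yY: "y = \<Gamma> Y" using eventually_const_unique[OF y] by simp
    have "\<forall>\<^sub>F \<tau> in at_right t. c (h \<tau>) = \<Gamma> Z"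
      using Z(2) by eventually_elim (rule in_arc[OF Z(1)])
    then have zZ: "z = \<Gamma> Z" using eventually_const_unique[OF z] by simp
    have xX: "c (g s) = \<Gamma> X" by (simp add: c_def X_def)
    have "crossing_arcs D g s h t X Y Z"
      unfolding crossing_arcs_def using cr X Y Z by blast
    then have *: "wirtinger (crossing_det g s h t) (\<Gamma> X) (\<Gamma> Y) (\<Gamma> Z)"
      using col unfolding S3_coloring_def by blast
    show "c (g s) \<star> y = z \<star> c (g s)" if "crossing_det g s h t > 0"
      using * that unfolding xX yY zZ by blast
    show "c (g s) \<star> z = y \<star> c (g s)" if "crossing_det g s h t < 0"
      using * that unfolding xX yY zZ by blast
  qed
qed

text \<open>A locally constant function is constant on every arc, so any point of an arc tells its color.\<close>

lemma S3_coloring_of_point_coloring: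
  assumes col: "point_coloring D c"
  shows "\<exists>\<Gamma>. S3_coloring D \<Gamma> \<and> \<Gamma> ` diagram_arcs D = c ` arc_points D"
proof (intro exI conjI)
  let ?S = "arc_points D"
  define \<Gamma> where "\<Gamma> a = c (SOME p. p \<in> a)" for a :: "(real^3) set"
  have const: "\<Gamma> a = c p" if a: "a \<in> diagram_arcs D" and p: "p \<in> a" for a p
  proof -
    have a': "a \<in> components ?S" using a by (simp add: diagram_arcs_def arc_points_def)
    have some: "(SOME p. p \<in> a) \<in> a" using p by (rule someI)
    have "\<forall>x\<in>a. \<forall>\<^sub>F q in at x within a. c x = c q"
    proof
      fix x assume "x \<in> a"
      then have "\<forall>\<^sub>F q in at x within ?S. c q = c x"
        using col in_components_subset[OF a'] unfolding point_coloring_def by blast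
      then have "\<forall>\<^sub>F q in at x within a. c q = c x"
        using in_components_subset[OF a'] at_le filter_leD by metis
      then show "\<forall>\<^sub>F q in at x within a. c x = c q" by eventually_elim simp
    qed
    then show ?thesis
      using connected_local_const[OF in_components_connected[OF a'] some p] by (simp add: \<Gamma>_def)
  qed
  have arcs: "diagram_arcs D = (\<lambda>p. connected_component_set ?S p) ` ?S"
    by (auto simp: diagram_arcs_def components_def arc_points_def)
  have "\<Gamma> (connected_component_set ?S p) = c p" if "p \<in> ?S" for p
    using that by (intro const) (auto simp: arcs)
  then show "\<Gamma> ` diagram_arcs D = c ` ?S" by (simp add: arcs image_image)
  have sub: "p \<in> ?S" if "a \<in> diagram_arcs D" "p \<in> a" for a p
    using that in_components_subset unfolding diagram_arcs_def arc_points_def[symmetric] by blast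
  show "S3_coloring D \<Gamma>" unfolding S3_coloring_def
  proof (intro conjI ballI allI impI)
    fix a assume a: "a \<in> diagram_arcs D"
    then obtain p where "p \<in> ?S" "a = connected_component_set ?S p" unfolding arcs by blast
    then have "p \<in> a" "p \<in> ?S" by simp_all
    then show "\<Gamma> a \<in> S3_colors"
      using const[OF a] col unfolding point_coloring_def by metis
  next
    fix g s h t x y z
    assume ca: "crossing_arcs D g s h t x y z"
    then have cr: "crossing D g s h t" and arcs3: "x \<in> diagram_arcs D" "y \<in> diagram_arcs D" "z \<in> diagram_arcs D"
      and x: "g s \<in> x" and y: "\<forall>\<^sub>F \<tau> in at_left t. h \<tau> \<in> y" and z: "\<forall>\<^sub>F \<tau> in at_right t. h \<tau> \<in> z"
      unfolding crossing_arcs_def by auto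
    have y': "\<forall>\<^sub>F \<tau> in at_left t. c (h \<tau>) = \<Gamma> y"
      using y by eventually_elim (simp add: const[OF arcs3(2)])
    have z': "\<forall>\<^sub>F \<tau> in at_right t. c (h \<tau>) = \<Gamma> z"
      using z by eventually_elim (simp add: const[OF arcs3(3)])
    have x': "c (g s) = \<Gamma> x" using const[OF arcs3(1) x] by simp
    have *: "wirtinger (crossing_det g s h t) (\<Gamma> x) (\<Gamma> y) (\<Gamma> z)"
      using col cr y' z' unfolding point_coloring_def x'[symmetric] by blast
    show "\<Gamma> x \<star> \<Gamma> y = \<Gamma> z \<star> \<Gamma> x" if "crossing_det g s h t > 0"
      using * that by blast
    show "\<Gamma> x \<star> \<Gamma> z = \<Gamma> y \<star> \<Gamma> x" if "crossing_det g s h t < 0"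
      using * that by blast
  qed
qed

lemma S3_n_colorable_iff_point_coloring:
  "S3_n_colorable n L \<longleftrightarrow>
     (\<exists>D c. diagram_of D L \<and> point_coloring D c \<and> card (c ` arc_points D) = n)"
proof
  assume "S3_n_colorable n L"
  then obtain D \<Gamma> where D: "diagram_of D L" "S3_coloring D \<Gamma>" "card (\<Gamma> ` diagram_arcs D) = n"
    by (auto simp: S3_n_colorable_def S3_n_coloring_def)
  have "link_diagram D" using D(1) by (simp add: diagram_of_def)
  from point_coloring_of_S3_coloring[OF this D(2)]
  show "\<exists>D c. diagram_of D L \<and> point_coloring D c \<and> card (c ` arc_points D) = n"
    using D by metis
next
  assume "\<exists>D c. diagram_of D L \<and> point_coloring D c \<and> card (c ` arc_points D) = n"
  then show "S3_n_colorable n L"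
    unfolding S3_n_colorable_def S3_n_coloring_def using S3_coloring_of_point_coloring by metis
qed

section \<open>Pushing a finger under a strand\<close>

definition plane_det :: "real^3 \<Rightarrow> real^3 \<Rightarrow> real" where
  "plane_det v w = v $ 1 * w $ 2 - v $ 2 * w $ 1"

lemma plane_det_simps [simp]:
  "plane_det (u + v) w = plane_det u w + plane_det v w"
  "plane_det w (u + v) = plane_det w u + plane_det w v"
  "plane_det (u - v) w = plane_det u w - plane_det v w"
  "plane_det w (u - v) = plane_det w u - plane_det w v"
  "plane_det (r *\<^sub>R v) w = r * plane_det v w"
  "plane_det w (r *\<^sub>R v) = r * plane_det w v"
  "plane_det (- v) w = - plane_det v w"
  "plane_det v (- w) = - plane_det v w"
  "plane_det v v = 0"
  by (simp_all add: plane_det_def algebra_simps)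

lemma plane_det_swap: "plane_det v w = - plane_det w v"
  by (simp add: plane_det_def)

lemma crossing_det_eq:
  "crossing_det g s h t = plane_det (vector_derivative g (at s)) (vector_derivative h (at t))"
  by (simp add: crossing_det_def plane_det_def Let_def)

lemma plane_proj_eq_iff: "plane_proj p = plane_proj q \<longleftrightarrow> p $ 1 = q $ 1 \<and> p $ 2 = q $ 2"
  by (simp add: plane_proj_def)

lemma vec3_eq_iff: "(x::real^3) = y \<longleftrightarrow> x $ 1 = y $ 1 \<and> x $ 2 = y $ 2 \<and> x $ 3 = y $ 3"
  by (simp add: vec_eq_iff forall_3)

lemma polygonal_union:
  assumes "finite B"
    and "\<And>a b u. 0 \<le> a \<Longrightarrow> a < b \<Longrightarrow> b \<le> 1 \<Longrightarrow> {a<..<b} \<inter> B = {} \<Longrightarrow> u \<in> {0..1} \<Longrightarrow>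
      g (linepath a b u) = linepath (g a) (g b) u"
  shows "polygonal g"
  unfolding polygonal_def using assms by blast

lemma open_positive:
  fixes h :: "real^3 \<Rightarrow> real"
  assumes "continuous_on UNIV h" "h x > 0" shows "\<forall>\<^sub>F y in nhds x. h y > 0"
proof -
  have "open {y. h y > 0}" using open_Collect_less[of "\<lambda>_. 0" h] assms(1) by simp
  then show ?thesis using assms(2) eventually_nhds_in_open[of "{y. h y > 0}" x] by simp
qed

text \<open>A finger grows out of the edge of \<open>g0\<close> through \<open>g0 t0\<close>, in the direction \<open>E\<close>, until its tip has
  passed below the edge of \<open>k0\<close> through \<open>k0 s0\<close>. The vectors \<open>f\<close> and \<open>kd\<close> are the velocities on these
  two edges, \<open>w\<close> is half the width of the finger, measured by the parameter of \<open>g0\<close>, and \<open>\<delta>\<close> is the part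
  of \<open>E\<close> by which the tip overshoots the target. The hypothesis of
  \<open>isolated\<close> describes a thin quadrilateral around the projection of the finger: above it the link
  consists of the base of the finger and of a piece of the target strand, and that piece lies more
  than 1 above the plane of the finger.\<close>

locale finger =
  fixes D :: "(real \<Rightarrow> real^3) set" and g0 k0 :: "real \<Rightarrow> real^3"
    and t0 s0 w \<delta> \<epsilon> :: real and f kd E :: "real^3"
  assumes diagram: "link_diagram D" and g0: "g0 \<in> D" and k0: "k0 \<in> D"
    and w: "w > 0" "0 < t0 - w" "t0 + w < 1"
    and \<epsilon>: "0 < s0 - \<epsilon>" "s0 + \<epsilon> < 1" and \<delta>: "\<delta> > 0"
    and lin_g0: "\<And>t. \<bar>t - t0\<bar> \<le> w \<Longrightarrow> g0 t = g0 t0 + (t - t0) *\<^sub>R f"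
    and lin_k0: "\<And>\<tau>. \<bar>\<tau> - s0\<bar> \<le> \<epsilon> \<Longrightarrow> k0 \<tau> = k0 s0 + (\<tau> - s0) *\<^sub>R kd"
    and transversal_f: "plane_det f E \<noteq> 0" and transversal_k: "plane_det kd E \<noteq> 0"
    and target: "plane_proj (k0 s0) = plane_proj (g0 t0 + E)"
    and thin: "w * \<bar>plane_det f kd\<bar> < \<bar>plane_det kd E\<bar>"
    and reach: "w * \<bar>plane_det f E\<bar> < \<epsilon> * \<bar>plane_det kd E\<bar>"
    and isolated: "\<And>g t. g \<in> D \<Longrightarrow> t \<in> {0..1} \<Longrightarrow>
      max (plane_det f (g t - g0 t0) / plane_det f E / (1 + 2 * \<delta>))
          (- (plane_det f (g t - g0 t0) / plane_det f E) / \<delta>)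
        + \<bar>plane_det (g t - g0 t0) E / plane_det f E\<bar> / w \<le> 1 \<Longrightarrow>
      g = g0 \<and> \<bar>t - t0\<bar> \<le> w \<or>
      g = k0 \<and> \<bar>t - s0\<bar> \<le> \<epsilon> \<and>
        (g t - g0 t0) $ 3 - plane_det (g t - g0 t0) E / plane_det f E * f $ 3
          - plane_det f (g t - g0 t0) / plane_det f E * E $ 3 > 1"
begin

text \<open>Affine coordinates with origin \<open>g0 t0\<close> and axes \<open>f\<close>, \<open>E\<close> and the vertical direction. The finger
  will lie in the plane \<open>V = 0\<close>.\<close>

definition U :: "real^3 \<Rightarrow> real" where "U x = plane_det (x - g0 t0) E / plane_det f E"
definition S :: "real^3 \<Rightarrow> real" where "S x = plane_det f (x - g0 t0) / plane_det f E"
definition V :: "real^3 \<Rightarrow> real" where "V x = (x - g0 t0) $ 3 - U x * f $ 3 - S x * E $ 3"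

text \<open>The gauge of the interval from \<open>-\<delta>\<close> to \<open>1 + 2 * \<delta>\<close>, so that \<open>bump\<close> is a piecewise linear hat over
  an octahedron, with height 1 at \<open>g0 t0\<close>. It is affine on each half of the base of the finger,
  which therefore stays polygonal.\<close>

definition tent :: "real \<Rightarrow> real" where "tent s = max (s / (1 + 2 * \<delta>)) (- s / \<delta>)"

definition bump :: "real^3 \<Rightarrow> real" where
  "bump x = max 0 (1 - tent (S x) - \<bar>U x\<bar> / w - \<bar>V x\<bar>)"

definition push :: "real^3 \<Rightarrow> real^3" where
  "push x = x + ((1 + \<delta>) * bump x) *\<^sub>R E"

text \<open>In these coordinates the target strand is the line \<open>S = 1 + slope * U\<close>, and \<open>b\<close> is the
  rate at which \<open>U\<close> grows along it.\<close>

definition slope :: real where "slope = plane_det f kd / plane_det kd E"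
definition b :: real where "b = plane_det kd E / plane_det f E"

lemma plane_coordinates:
  "x $ 1 = g0 t0 $ 1 + U x * f $ 1 + S x * E $ 1"
  "x $ 2 = g0 t0 $ 2 + U x * f $ 2 + S x * E $ 2"
proof -
  have *: "U x * f $ i + S x * E $ i
      = (plane_det (x - g0 t0) E * f $ i + plane_det f (x - g0 t0) * E $ i) / plane_det f E" for i
    by (simp add: U_def S_def add_divide_distrib)
  have "U x * f $ 1 + S x * E $ 1 = ((x $ 1 - g0 t0 $ 1) * plane_det f E) / plane_det f E"
    unfolding * by (rule arg_cong[of _ _ "\<lambda>z. z / plane_det f E"])
      (simp add: plane_det_def algebra_simps)
  then show "x $ 1 = g0 t0 $ 1 + U x * f $ 1 + S x * E $ 1" using transversal_f by simp
  have "U x * f $ 2 + S x * E $ 2 = ((x $ 2 - g0 t0 $ 2) * plane_det f E) / plane_det f E"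
    unfolding * by (rule arg_cong[of _ _ "\<lambda>z. z / plane_det f E"])
      (simp add: plane_det_def algebra_simps)
  then show "x $ 2 = g0 t0 $ 2 + U x * f $ 2 + S x * E $ 2" using transversal_f by simp
qed

lemma US_cong:
  assumes "plane_proj x = plane_proj y" shows "U x = U y" "S x = S y"
  using assms by (simp_all add: U_def S_def plane_det_def plane_proj_eq_iff)

lemma plane_proj_iff: "plane_proj x = plane_proj y \<longleftrightarrow> U x = U y \<and> S x = S y"
proof
  assume "U x = U y \<and> S x = S y"
  then have "x $ 1 = y $ 1" "x $ 2 = y $ 2"
    by (simp_all only: plane_coordinates[of x] plane_coordinates[of y])
  then show "plane_proj x = plane_proj y" by (simp add: plane_proj_eq_iff)
qed (use US_cong in blast)

lemma height: "x $ 3 = g0 t0 $ 3 + U x * f $ 3 + S x * E $ 3 + V x"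
  by (simp add: V_def)

lemma U_add [simp]: "U (x + r *\<^sub>R E) = U x"
  by (simp add: U_def)

lemma S_add [simp]: "S (x + r *\<^sub>R E) = S x + r"
  using transversal_f by (simp add: S_def add_divide_distrib diff_divide_distrib)

lemma V_add [simp]: "V (x + r *\<^sub>R E) = V x"
  by (simp add: V_def algebra_simps)

lemma continuous_on_USV [continuous_intros]:
  "continuous_on A U" "continuous_on A S" "continuous_on A V"
proof -
  have c: "continuous_on A (\<lambda>x. plane_det (x - p) v)" "continuous_on A (\<lambda>x. plane_det v (x - p))" for p v
    unfolding plane_det_def by (intro continuous_intros)+
  show 1: "continuous_on A U" "continuous_on A S"
    unfolding U_def S_def by (intro continuous_on_divide c continuous_on_const; simp add: transversal_f)+
  show "continuous_on A V" unfolding V_def by (intro continuous_intros 1)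
qed

lemma continuous_on_tent [continuous_intros]:
  "continuous_on A h \<Longrightarrow> continuous_on A (\<lambda>x. tent (h x))"
  using \<delta> unfolding tent_def by (intro continuous_intros) auto

lemma continuous_on_bump [continuous_intros]: "continuous_on A bump"
  unfolding bump_def using w(1) by (intro continuous_intros) auto

lemma tent_nonneg: "tent s \<ge> 0"
  using \<delta> by (cases "s \<ge> 0") (auto simp: tent_def le_max_iff_disj divide_nonpos_pos)

lemma tent_of_nonneg: "s \<ge> 0 \<Longrightarrow> tent s = s / (1 + 2 * \<delta>)"
proof -
  assume "s \<ge> 0"
  then have "- s / \<delta> \<le> 0" "s / (1 + 2 * \<delta>) \<ge> 0" using \<delta> by (simp_all add: divide_nonpos_pos)
  then show ?thesis unfolding tent_def by simp
qed

lemma tent_ge: "tent s \<le> r \<Longrightarrow> s \<le> r * (1 + 2 * \<delta>) \<and> - s \<le> r * \<delta>"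
  using \<delta> by (simp add: tent_def divide_simps)

lemma bump_nonneg: "bump x \<ge> 0" by (simp add: bump_def)

text \<open>Along \<open>E\<close> the hat falls with slope at most \<open>1 / (1 + 2 * \<delta>)\<close>, and the factor \<open>1 + \<delta>\<close> is too
  small to make two points change places.\<close>

lemma bump_mono:
  assumes "r > 0" shows "(1 + \<delta>) * bump (x + r *\<^sub>R E) > (1 + \<delta>) * bump x - r"
proof -
  have q: "r / (1 + 2 * \<delta>) > 0" using assms \<delta> by simp
  have "tent (S x + r) \<le> tent (S x) + r / (1 + 2 * \<delta>)"
  proof -
    have "- (S x + r) / \<delta> \<le> - S x / \<delta>" using assms \<delta> by (intro divide_right_mono) auto
    then show ?thesis using q unfolding tent_def by (simp add: add_divide_distrib le_max_iff_disj max_def)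
  qed
  then have "bump (x + r *\<^sub>R E) \<ge> bump x - r / (1 + 2 * \<delta>)"
    unfolding bump_def using q by simp
  then have "(1 + \<delta>) * bump (x + r *\<^sub>R E) \<ge> (1 + \<delta>) * (bump x - r / (1 + 2 * \<delta>))"
    using \<delta> by (intro mult_left_mono) auto
  moreover have "(1 + \<delta>) * (r / (1 + 2 * \<delta>)) < r"
    using \<delta> assms by (simp add: divide_simps)
  ultimately show ?thesis by (simp add: algebra_simps)
qed

lemma bump_support: "\<exists>R. \<forall>x. norm x \<ge> R \<longrightarrow> bump x = 0"
proof (intro exI allI impI)
  let ?R = "norm (g0 t0) + 3 * (w * norm f + (1 + 2 * \<delta>) * norm E + 1) + 1"
  fix x :: "real^3" assume x: "norm x \<ge> ?R"
  show "bump x = 0"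
  proof (rule ccontr)
    assume "bump x \<noteq> 0"
    then have *: "tent (S x) + \<bar>U x\<bar> / w + \<bar>V x\<bar> < 1" unfolding bump_def by (simp split: if_splits add: max_def)
    moreover have "\<bar>U x\<bar> / w \<ge> 0" using w by simp
    ultimately have "\<bar>U x\<bar> / w \<le> 1" "\<bar>V x\<bar> \<le> 1" "tent (S x) \<le> 1" using tent_nonneg[of "S x"] by linarith+
    then have UV: "\<bar>U x\<bar> \<le> w" "\<bar>V x\<bar> \<le> 1" and "S x \<le> 1 + 2 * \<delta>" "- S x \<le> \<delta>"
      using w tent_ge[of "S x" 1] by (auto simp: divide_simps)
    then have SS: "\<bar>S x\<bar> \<le> 1 + 2 * \<delta>" using \<delta> by auto
    have comp: "\<bar>(x - g0 t0) $ i\<bar> \<le> w * norm f + (1 + 2 * \<delta>) * norm E + 1" if "i \<in> {1, 2, 3}" for i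
    proof -
      have "(x - g0 t0) $ i = U x * f $ i + S x * E $ i + (if i = 3 then V x else 0)"
        using that plane_coordinates[of x] height[of x] by auto
      moreover have "\<bar>U x * f $ i\<bar> \<le> w * norm f"
        unfolding abs_mult using UV component_le_norm_cart[of f i] w by (intro mult_mono) auto
      moreover have "\<bar>S x * E $ i\<bar> \<le> (1 + 2 * \<delta>) * norm E"
        unfolding abs_mult using SS component_le_norm_cart[of E i] \<delta> by (intro mult_mono) auto
      ultimately show ?thesis using UV by (auto split: if_splits)
    qed
    have "norm (x - g0 t0) \<le> (\<Sum>i\<in>UNIV. \<bar>(x - g0 t0) $ i\<bar>)" by (rule norm_le_l1_cart)
    also have "\<dots> \<le> 3 * (w * norm f + (1 + 2 * \<delta>) * norm E + 1)"
      using comp[of 1] comp[of 2] comp[of 3] by (simp add: sum_3)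
    finally have "norm x \<le> norm (g0 t0) + 3 * (w * norm f + (1 + 2 * \<delta>) * norm E + 1)"
      using norm_triangle_sub[of x "g0 t0"] by linarith
    then show False using x by linarith
  qed
qed

lemma E_nonzero: "E \<noteq> 0"
  using transversal_f by (auto simp: plane_det_def)

lemma continuous_on_push: "continuous_on A push"
  unfolding push_def by (intro continuous_intros)

lemma bij_push_map: "bij push"
proof -
  obtain R where R: "\<And>x. norm x \<ge> R \<Longrightarrow> bump x = 0" using bump_support by blast
  have "bij (\<lambda>x. x + (1 * ((1 + \<delta>) * bump x)) *\<^sub>R E)"
    by (rule bij_push[where R = R]) (auto intro!: continuous_intros simp: R bump_mono E_nonzero)
  moreover have "push = (\<lambda>x. x + (1 * ((1 + \<delta>) * bump x)) *\<^sub>R E)" by (auto simp: push_def)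
  ultimately show ?thesis by simp
qed

lemma inj_push: "push x = push y \<longleftrightarrow> x = y"
  using bij_push_map by (simp add: bij_is_inj inj_eq)

lemma coordinates_push [simp]:
  "U (push x) = U x" "S (push x) = S x + (1 + \<delta>) * bump x" "V (push x) = V x"
  by (simp_all add: push_def)

lemma push_id: "bump x = 0 \<Longrightarrow> push x = x"
  by (simp add: push_def)

lemma rhombus:
  assumes "g \<in> D" "t \<in> {0..1}" "tent (S (g t)) + \<bar>U (g t)\<bar> / w \<le> 1"
  shows "g = g0 \<and> \<bar>t - t0\<bar> \<le> w \<or> g = k0 \<and> \<bar>t - s0\<bar> \<le> \<epsilon> \<and> V (g t) > 1"
  using isolated[OF assms(1,2)] assms(3) unfolding tent_def U_def S_def V_def by simp

lemma coordinates_g0: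
  assumes "\<bar>t - t0\<bar> \<le> w"
  shows "U (g0 t) = t - t0" "S (g0 t) = 0" "V (g0 t) = 0" "bump (g0 t) = 1 - \<bar>t - t0\<bar> / w"
proof -
  show *: "U (g0 t) = t - t0" "S (g0 t) = 0"
    unfolding lin_g0[OF assms] U_def S_def using transversal_f by simp_all
  show **: "V (g0 t) = 0" unfolding V_def * unfolding lin_g0[OF assms] by simp
  have "\<bar>t - t0\<bar> / w \<le> 1" using assms w by simp
  then show "bump (g0 t) = 1 - \<bar>t - t0\<bar> / w" unfolding bump_def * ** by (simp add: tent_def)
qed

lemma b_nonzero: "b \<noteq> 0"
  using transversal_f transversal_k by (simp add: b_def)

lemma coordinates_k0:
  assumes "\<bar>\<tau> - s0\<bar> \<le> \<epsilon>"
  shows "U (k0 \<tau>) = (\<tau> - s0) * b" "S (k0 \<tau>) = 1 + slope * U (k0 \<tau>)"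
proof -
  have "U (k0 s0) = U (g0 t0 + 1 *\<^sub>R E)" "S (k0 s0) = S (g0 t0 + 1 *\<^sub>R E)"
    using target by (intro US_cong; simp)+
  then have 0: "U (k0 s0) = 0" "S (k0 s0) = 1"
    using coordinates_g0[of t0] w by (simp_all only: U_add S_add)
  have "U (k0 \<tau>) = U (k0 s0) + (\<tau> - s0) * b"
    unfolding lin_k0[OF assms] by (simp add: U_def b_def add_divide_distrib diff_divide_distrib)
  then show *: "U (k0 \<tau>) = (\<tau> - s0) * b" using 0 by simp
  have "S (k0 \<tau>) = S (k0 s0) + (\<tau> - s0) * (plane_det f kd / plane_det f E)"
    unfolding lin_k0[OF assms] by (simp add: S_def add_divide_distrib diff_divide_distrib)
  also have "(\<tau> - s0) * (plane_det f kd / plane_det f E) = slope * U (k0 \<tau>)"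
    unfolding * using transversal_f transversal_k by (simp add: slope_def b_def)
  finally show "S (k0 \<tau>) = 1 + slope * U (k0 \<tau>)" using 0 by simp
qed

lemma slope_w: "\<bar>slope\<bar> * w < 1"
  using thin transversal_k by (simp add: slope_def divide_simps mult.commute)

lemma w_less: "w < \<epsilon> * \<bar>b\<bar>"
  using reach transversal_f by (simp add: b_def divide_simps mult.commute)

lemma slope_small: "\<bar>u\<bar> \<le> w \<Longrightarrow> \<bar>slope * u\<bar> < 1"
proof -
  assume "\<bar>u\<bar> \<le> w"
  then have "\<bar>slope\<bar> * \<bar>u\<bar> \<le> \<bar>slope\<bar> * w" by (intro mult_left_mono) auto
  then show "\<bar>slope * u\<bar> < 1" using slope_w by (simp add: abs_mult)
qed

definition moved :: "(real \<Rightarrow> real^3) \<Rightarrow> real \<Rightarrow> bool" where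
  "moved g t \<longleftrightarrow> g = g0 \<and> \<bar>t - t0\<bar> < w"

lemma bump_pos_rhombus: "bump x > 0 \<Longrightarrow> tent (S x) + \<bar>U x\<bar> / w < 1 \<and> \<bar>V x\<bar> < 1"
proof -
  assume "bump x > 0"
  then have "tent (S x) + \<bar>U x\<bar> / w + \<bar>V x\<bar> < 1" unfolding bump_def by (simp add: max_def split: if_splits)
  moreover have "tent (S x) \<ge> 0" "\<bar>U x\<bar> / w \<ge> 0" using w tent_nonneg by auto
  ultimately show ?thesis by linarith
qed

lemma bump_pos_iff:
  assumes "g \<in> D" "t \<in> {0..1}" shows "bump (g t) > 0 \<longleftrightarrow> moved g t"
proof
  assume *: "bump (g t) > 0"
  from bump_pos_rhombus[OF *] have r: "tent (S (g t)) + \<bar>U (g t)\<bar> / w < 1" "\<bar>V (g t)\<bar> < 1" by auto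
  then have "g = g0 \<and> \<bar>t - t0\<bar> \<le> w" using rhombus[OF assms] by auto
  then show "moved g t" using * coordinates_g0[of t] w by (auto simp: moved_def divide_simps split: if_splits)
next
  assume "moved g t"
  then show "bump (g t) > 0" using coordinates_g0[of t] w by (auto simp: moved_def)
qed

lemma push_unmoved:
  assumes "g \<in> D" "t \<in> {0..1}" "\<not> moved g t" shows "push (g t) = g t" "bump (g t) = 0"
  using bump_pos_iff[OF assms(1,2)] assms(3) bump_nonneg[of "g t"] push_id by force+

lemma push_moved:
  assumes "moved g t"
  shows "push (g t) = g0 t0 + (t - t0) *\<^sub>R f + ((1 + \<delta>) * (1 - \<bar>t - t0\<bar> / w)) *\<^sub>R E"
    and "U (push (g t)) = t - t0" "S (push (g t)) = (1 + \<delta>) * (1 - \<bar>t - t0\<bar> / w)"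
    and "V (push (g t)) = 0" "bump (push (g t)) > 0"
proof -
  have g: "g = g0" and t: "\<bar>t - t0\<bar> \<le> w" "\<bar>t - t0\<bar> / w < 1" using assms w by (auto simp: moved_def)
  note c = coordinates_g0[OF t(1)]
  show "push (g t) = g0 t0 + (t - t0) *\<^sub>R f + ((1 + \<delta>) * (1 - \<bar>t - t0\<bar> / w)) *\<^sub>R E"
    unfolding push_def g c unfolding lin_g0[OF t(1)] by simp
  show p: "U (push (g t)) = t - t0" "S (push (g t)) = (1 + \<delta>) * (1 - \<bar>t - t0\<bar> / w)"
    "V (push (g t)) = 0" by (simp_all add: g c)
  have "tent (S (push (g t))) = (1 + \<delta>) * (1 - \<bar>t - t0\<bar> / w) / (1 + 2 * \<delta>)"
    unfolding p using \<delta> t(2) by (intro tent_of_nonneg) simp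
  also have "\<dots> < 1 - \<bar>t - t0\<bar> / w"
  proof -
    have "(1 + \<delta>) * (1 - \<bar>t - t0\<bar> / w) < (1 + 2 * \<delta>) * (1 - \<bar>t - t0\<bar> / w)"
      using \<delta> t(2) by (intro mult_strict_right_mono) auto
    then show ?thesis using \<delta> by (simp add: divide_less_eq mult.commute)
  qed
  finally show "bump (push (g t)) > 0" unfolding bump_def p by simp
qed

section \<open>The pushed diagram\<close>

text \<open>On its way out, the finger passes below the target strand at the parameter \<open>t0 + x_enter\<close>, and on
  its way back at \<open>t0 + x_exit\<close>.\<close>

definition x_exit :: real where "x_exit = \<delta> * w / (1 + \<delta> + slope * w)"
definition x_enter :: real where "x_enter = - (\<delta> * w / (1 + \<delta> - slope * w))"

definition D' :: "(real \<Rightarrow> real^3) set" where "D' = (\<lambda>g. push \<circ> g) ` D"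

lemma denominators: "1 + \<delta> + slope * w > \<delta>" "1 + \<delta> - slope * w > \<delta>"
  using slope_small[of w] w(1) by auto

lemma x_exit_bounds: "0 < x_exit" "x_exit < w"
proof -
  show "0 < x_exit" using denominators(1) \<delta> w(1) by (simp add: x_exit_def)
  have "w * \<delta> < w * (1 + \<delta> + slope * w)" using denominators(1) w(1) by (intro mult_strict_left_mono) auto
  then show "x_exit < w" using denominators(1) \<delta> by (simp add: x_exit_def divide_less_eq mult.commute)
qed

lemma x_enter_bounds: "- w < x_enter" "x_enter < 0"
proof -
  show "x_enter < 0" using denominators(2) \<delta> w(1) by (simp add: x_enter_def)
  have "w * \<delta> < w * (1 + \<delta> - slope * w)" using denominators(2) w(1) by (intro mult_strict_left_mono) auto
  then have "\<delta> * w / (1 + \<delta> - slope * w) < w" using denominators(2) \<delta> by (simp add: divide_less_eq mult.commute)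
  then show "- w < x_enter" by (simp add: x_enter_def)
qed

lemma x_bounds: "x \<in> {x_exit, x_enter} \<Longrightarrow> \<bar>x\<bar> < w \<and> \<bar>x / b\<bar> < \<epsilon>"
proof -
  assume "x \<in> {x_exit, x_enter}"
  then have 1: "\<bar>x\<bar> < w" using x_exit_bounds x_enter_bounds w(1) by auto
  then have "\<bar>x\<bar> < \<epsilon> * \<bar>b\<bar>" using w_less by linarith
  then have "\<bar>x / b\<bar> < \<epsilon>" using b_nonzero by (simp add: divide_less_eq)
  with 1 show ?thesis by simp
qed

text \<open>How far the finger at the parameter \<open>t0 + x\<close> lies beyond the target strand, in the
  coordinate \<open>S\<close>.\<close>

definition excess :: "real \<Rightarrow> real" where
  "excess x = (1 + \<delta>) * (1 - \<bar>x\<bar> / w) - (1 + slope * x)"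

lemma excess_pos: "x \<ge> 0 \<Longrightarrow> excess x = (x_exit - x) * ((1 + \<delta> + slope * w) / w)"
  using denominators(1) \<delta> w(1) unfolding excess_def x_exit_def
  by (simp add: divide_simps) (simp add: algebra_simps)

lemma excess_neg: "x \<le> 0 \<Longrightarrow> excess x = (x - x_enter) * ((1 + \<delta> - slope * w) / w)"
  using denominators(2) \<delta> w(1) unfolding excess_def x_enter_def
  by (simp add: divide_simps) (simp add: algebra_simps)

lemma excess_sign:
  "excess x = 0 \<longleftrightarrow> x \<in> {x_exit, x_enter}" "excess x > 0 \<longleftrightarrow> x_enter < x \<and> x < x_exit"
proof -
  have p: "(1 + \<delta> + slope * w) / w > 0" "(1 + \<delta> - slope * w) / w > 0"
    using denominators \<delta> w(1) by auto
  show "excess x = 0 \<longleftrightarrow> x \<in> {x_exit, x_enter}"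
  proof (cases "x \<ge> 0")
    case True
    then show ?thesis unfolding excess_pos[OF True] using p x_enter_bounds by auto
  next
    case False
    then show ?thesis using excess_neg[of x] p x_exit_bounds by auto
  qed
  show "excess x > 0 \<longleftrightarrow> x_enter < x \<and> x < x_exit"
  proof (cases "x \<ge> 0")
    case True
    then show ?thesis unfolding excess_pos[OF True] using p x_enter_bounds by (simp add: zero_less_mult_iff del: times_divide_eq_right)
  next
    case False
    then show ?thesis using excess_neg[of x] p x_exit_bounds by (simp add: zero_less_mult_iff del: times_divide_eq_right)
  qed
qed

lemma new_crossing_points:
  assumes x: "x \<in> {x_exit, x_enter}"
  shows "moved g0 (t0 + x)" "\<not> (k0 = g0 \<and> \<bar>s0 + x / b - t0\<bar> \<le> w)" "V (k0 (s0 + x / b)) > 1"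
    "plane_proj (push (k0 (s0 + x / b))) = plane_proj (push (g0 (t0 + x)))"
    "s0 + x / b \<in> {0<..<1}" "t0 + x \<in> {0<..<1}" "push (k0 (s0 + x / b)) = k0 (s0 + x / b)"
proof -
  note xb = x_bounds[OF x]
  show m: "moved g0 (t0 + x)" using xb by (simp add: moved_def)
  let ?\<tau> = "s0 + x / b"
  have \<tau>: "\<bar>?\<tau> - s0\<bar> \<le> \<epsilon>" using xb by simp
  have U: "U (k0 ?\<tau>) = x" using coordinates_k0(1)[OF \<tau>] b_nonzero by simp
  have S: "S (k0 ?\<tau>) = 1 + slope * x" using coordinates_k0(2)[OF \<tau>] U by simp
  have S': "S (k0 ?\<tau>) = (1 + \<delta>) * (1 - \<bar>x\<bar> / w)"
    using excess_sign(1)[of x] x S by (simp add: excess_def)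
  show in01: "?\<tau> \<in> {0<..<1}" using xb \<epsilon> unfolding abs_less_iff greaterThanLessThan_iff by linarith
  show "t0 + x \<in> {0<..<1}" using xb w unfolding abs_less_iff greaterThanLessThan_iff by linarith
  show n: "\<not> (k0 = g0 \<and> \<bar>?\<tau> - t0\<bar> \<le> w)"
  proof
    assume "k0 = g0 \<and> \<bar>?\<tau> - t0\<bar> \<le> w"
    then have "S (k0 ?\<tau>) = 0" using coordinates_g0(2)[of ?\<tau>] by simp
    then show False using S slope_small[of x] xb by (simp add: abs_less_iff)
  qed
  have r: "bump (push (g0 (t0 + x))) > 0" "U (push (g0 (t0 + x))) = x"
      "S (push (g0 (t0 + x))) = (1 + \<delta>) * (1 - \<bar>x\<bar> / w)"
    using push_moved[OF m] by auto
  have "tent (S (k0 ?\<tau>)) + \<bar>U (k0 ?\<tau>)\<bar> / w \<le> 1"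
    using bump_pos_rhombus[OF r(1)] r S' U by simp
  then show v: "V (k0 ?\<tau>) > 1" using rhombus[OF k0, of ?\<tau>] in01 n by auto
  have "\<not> moved k0 ?\<tau>" using n by (auto simp: moved_def)
  then show p: "push (k0 ?\<tau>) = k0 ?\<tau>" using push_unmoved(1)[OF k0] in01 by auto
  show "plane_proj (push (k0 ?\<tau>)) = plane_proj (push (g0 (t0 + x)))"
    unfolding p plane_proj_iff using r U S' by simp
qed

text \<open>The push preserves \<open>U\<close>, so the finger has no crossing with itself. A point of the rest of
  the link with the same projection as a point of the finger lies on the target strand, and there
  \<open>excess\<close> vanishes.\<close>

lemma meets_moved:
  assumes m: "moved k t" and g: "g \<in> D" "s \<in> {0..1}"
    and eq: "plane_proj (push (g s)) = plane_proj (push (k t))"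
  shows "g = g0 \<and> s = t \<or>
    g = k0 \<and> t - t0 \<in> {x_exit, x_enter} \<and> s = s0 + (t - t0) / b \<and> V (g s) > 1"
proof (cases "moved g s")
  case True
  then show ?thesis using US_cong(1)[OF eq] push_moved(2)[OF True] push_moved(2)[OF m]
    by (simp add: moved_def)
next
  case False
  note pm = push_moved[OF m]
  have gs: "push (g s) = g s" by (rule push_unmoved[OF g False])
  have US: "U (g s) = t - t0" "S (g s) = (1 + \<delta>) * (1 - \<bar>t - t0\<bar> / w)"
    using US_cong[OF eq] pm gs by simp_all
  have "tent (S (g s)) + \<bar>U (g s)\<bar> / w \<le> 1"
    using bump_pos_rhombus[OF pm(5)] US_cong[OF eq] gs by simp
  from rhombus[OF g this] consider "g = g0" "\<bar>s - t0\<bar> \<le> w" | "g = k0" "\<bar>s - s0\<bar> \<le> \<epsilon>" "V (g s) > 1" by blast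
  then show ?thesis
  proof cases
    case 1
    then show ?thesis using coordinates_g0(1)[OF 1(2)] US(1) by simp
  next
    case 2
    have "S (g s) = 1 + slope * U (g s)" and u: "U (g s) = (s - s0) * b" using coordinates_k0[OF 2(2)] 2(1) by auto
    then have "excess (t - t0) = 0" using US by (simp add: excess_def)
    then have "t - t0 \<in> {x_exit, x_enter}" using excess_sign(1) by blast
    moreover have "s = s0 + (t - t0) / b" using u US(1) b_nonzero by (simp add: field_simps)
    ultimately show ?thesis using 2 by blast
  qed
qed

text \<open>The base of the finger has no crossings: on it \<open>S = 0\<close>, whereas \<open>S = 1 + slope * U > 0\<close> on the
  target strand, since \<open>thin\<close> bounds the slope.\<close>

lemma near_moved_isolated:
  assumes t: "\<bar>t - t0\<bar> \<le> w" and g: "g \<in> D" "s \<in> {0..1}"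
    and eq: "plane_proj (g s) = plane_proj (g0 t)"
  shows "g s = g0 t"
proof -
  note c = coordinates_g0[OF t]
  have US: "U (g s) = t - t0" "S (g s) = 0" using US_cong[OF eq] c by auto
  have "tent (S (g s)) + \<bar>U (g s)\<bar> / w \<le> 1" using US t w(1) by (simp add: tent_def)
  from rhombus[OF g this] consider "g = g0" "\<bar>s - t0\<bar> \<le> w" | "g = k0" "\<bar>s - s0\<bar> \<le> \<epsilon>" by blast
  then show ?thesis
  proof cases
    case 1
    then show ?thesis using coordinates_g0(1)[OF 1(2)] US(1) by simp
  next
    case 2
    then have "S (g s) = 1 + slope * (t - t0)" using coordinates_k0(2)[OF 2(2)] US(1) by simp
    then show ?thesis using slope_small[OF t] US(2) by (simp add: abs_less_iff)
  qed
qed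

lemma crossing_not_near:
  assumes "crossing D g s k t"
  shows "\<not> (g = g0 \<and> \<bar>s - t0\<bar> \<le> w)" "\<not> (k = g0 \<and> \<bar>t - t0\<bar> \<le> w)" "\<not> moved g s" "\<not> moved k t"
proof -
  note c = crossingD[OF assms]
  show "\<not> (g = g0 \<and> \<bar>s - t0\<bar> \<le> w)"
    using near_moved_isolated[of s k t] c by force
  then show "\<not> moved g s" by (auto simp: moved_def)
  show "\<not> (k = g0 \<and> \<bar>t - t0\<bar> \<le> w)"
    using near_moved_isolated[of t g s] c by force
  then show "\<not> moved k t" by (auto simp: moved_def)
qed

lemma crossing_D'_iff:
  assumes "g \<in> D" "k \<in> D"
  shows "crossing D' (push \<circ> g) s (push \<circ> k) t \<longleftrightarrow>
    crossing D g s k t \<or>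
    g = k0 \<and> k = g0 \<and> t - t0 \<in> {x_exit, x_enter} \<and> s = s0 + (t - t0) / b" (is "?L \<longleftrightarrow> ?R1 \<or> ?R2")
proof
  assume ?L
  then have st: "s \<in> {0..1}" "t \<in> {0..1}" and eq: "plane_proj (push (g s)) = plane_proj (push (k t))"
    and h: "push (g s) $ 3 > push (k t) $ 3"
    using crossingD[OF \<open>?L\<close>] by auto
  have UV: "U (push (g s)) = U (push (k t))" "S (push (g s)) = S (push (k t))" by (rule US_cong[OF eq])+
  then have V: "V (push (g s)) > V (push (k t))" using h height[of "push (g s)"] height[of "push (k t)"] by simp
  show "?R1 \<or> ?R2"
  proof (cases "moved k t")
    case True
    from meets_moved[OF True assms(1) st(1) eq] show ?thesis
      using V True by (auto simp: moved_def)
  next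
    case nk: False
    show ?thesis
    proof (cases "moved g s")
      case True
      from meets_moved[OF True assms(2) st(2) eq[symmetric]] show ?thesis
        using V True push_moved(4)[OF True] by (auto simp: moved_def)
    next
      case False
      then have "crossing D g s k t"
        using push_unmoved(1)[OF assms(1) st(1) False] push_unmoved(1)[OF assms(2) st(2) nk] assms st eq h
        by (simp add: crossing_def)
      then show ?thesis ..
    qed
  qed
next
  have D': "push \<circ> g \<in> D'" "push \<circ> k \<in> D'" using assms by (auto simp: D'_def)
  assume "?R1 \<or> ?R2"
  then show ?L
  proof
    assume c: ?R1
    show ?L using crossingD[OF c] crossing_not_near[OF c] push_unmoved(1) D' assms
      by (simp add: crossing_def)
  next
    assume r: ?R2
    define x where "x = t - t0"
    have x: "x \<in> {x_exit, x_enter}" "t = t0 + x" "s = s0 + x / b" using r by (auto simp: x_def)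
    note n = new_crossing_points[OF x(1)]
    have "V (push (g0 (t0 + x))) = 0" by (rule push_moved(4)[OF n(1)])
    then have "push (k0 (s0 + x / b)) $ 3 > push (g0 (t0 + x)) $ 3"
      using n(3,7) US_cong[OF n(4)] height[of "push (k0 (s0 + x / b))"] height[of "push (g0 (t0 + x))"] by simp
    then show ?L using n D' r x(2,3) by (auto simp: crossing_def)
  qed
qed

lemma crossing_D'_cases:
  assumes "crossing D' G s H t"
  obtains (old) g h where "crossing D g s h t" "G = push \<circ> g" "H = push \<circ> h" "push (h t) = h t"
  | (new) x where "x \<in> {x_exit, x_enter}" "G = push \<circ> k0" "s = s0 + x / b" "H = push \<circ> g0" "t = t0 + x"
proof -
  obtain g h where gh: "g \<in> D" "h \<in> D" "G = push \<circ> g" "H = push \<circ> h"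
    using crossingD(1,2)[OF assms] by (auto simp: D'_def)
  from assms[unfolded gh(3,4) crossing_D'_iff[OF gh(1,2)]] show ?thesis
  proof
    assume c: "crossing D g s h t"
    have "push (h t) = h t" by (rule push_unmoved(1)[OF crossingD(2,4)[OF c] crossing_not_near(4)[OF c]])
    then show ?thesis using old c gh(3,4) by blast
  next
    assume "g = k0 \<and> h = g0 \<and> t - t0 \<in> {x_exit, x_enter} \<and> s = s0 + (t - t0) / b"
    then show ?thesis using new[of "t - t0"] gh(3,4) by simp
  qed
qed

lemma link_space_D': "link_space D' = push ` link_space D"
  by (auto simp: link_space_def D'_def path_image_compose)

lemma link_space_D'E:
  assumes "y \<in> link_space D'" obtains g t where "g \<in> D" "t \<in> {0..1}" "y = push (g t)"
  using assms unfolding link_space_D' link_space_eq[of D] by blast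

lemma two_points_over_moved:
  assumes m: "moved g s" and y: "y \<in> link_space D'" and eq: "plane_proj y = plane_proj (push (g s))"
  shows "y = push (g s) \<or> y = push (k0 (s0 + U (push (g s)) / b))"
proof -
  obtain k t where k: "k \<in> D" "t \<in> {0..1}" "y = push (k t)"
    using y by (rule link_space_D'E)
  from meets_moved[OF m k(1,2)] eq k(3) show ?thesis
    using m push_moved(2)[OF m] by (auto simp: moved_def)
qed

lemma polygonal_push:
  assumes g: "g \<in> D" shows "polygonal (push \<circ> g)"
proof -
  obtain B where B: "finite B" and lin: "\<And>a b u. 0 \<le> a \<Longrightarrow> a < b \<Longrightarrow> b \<le> 1 \<Longrightarrow> {a<..<b} \<inter> B = {} \<Longrightarrow>
      u \<in> {0..1} \<Longrightarrow> g (linepath a b u) = linepath (g a) (g b) u"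
    using link_diagramD(6)[OF diagram g] unfolding polygonal_def by blast
  show ?thesis
  proof (rule polygonal_union)
    show "finite (B \<union> {t0 - w, t0, t0 + w})" using B by simp
    fix a c u :: real
    assume ac: "0 \<le> a" "a < c" "c \<le> 1" and dis: "{a<..<c} \<inter> (B \<union> {t0 - w, t0, t0 + w}) = {}"
      and u: "u \<in> {0..1}"
    define m where "m = linepath a c u"
    have m: "m \<in> {a..c}" using u ac closed_segment_eq_real_ivl[of a c] linepath_in_path[OF u, of a c]
      by (simp add: m_def)
    have glin: "g m = linepath (g a) (g c) u" unfolding m_def using lin[OF ac _ u] dis by auto
    show "(push \<circ> g) (linepath a c u) = linepath ((push \<circ> g) a) ((push \<circ> g) c) u"
    proof (cases "\<exists>t\<in>{a..c}. moved g t")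
      case False
      then have "push (g t) = g t" if "t \<in> {a..c}" for t
        using that ac push_unmoved(1)[OF g, of t] by auto
      then have "push (g m) = g m" "push (g a) = g a" "push (g c) = g c" using m ac by auto
      then have "push (g m) = linepath (push (g a)) (push (g c)) u" using glin by metis
      then show ?thesis by (simp add: m_def)
    next
      case True
      then have gg: "g = g0" by (auto simp: moved_def)
      have out: "t0 - w \<notin> {a<..<c}" "t0 \<notin> {a<..<c}" "t0 + w \<notin> {a<..<c}" using dis by auto
      obtain t where t: "t \<in> {a..c}" "\<bar>t - t0\<bar> < w" using True by (auto simp: moved_def)
      define \<sigma> :: real where "\<sigma> = (if c \<le> t0 then 1 else -1)"
      have side: "\<bar>s - t0\<bar> = \<sigma> * (t0 - s) \<and> \<bar>s - t0\<bar> \<le> w" if "s \<in> {a..c}" for s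
        using that out t ac(2) by (auto simp: \<sigma>_def split: if_splits)
      have form: "push (g s) = g0 t0 + (s - t0) *\<^sub>R f + ((1 + \<delta>) * (1 - \<sigma> * (t0 - s) / w)) *\<^sub>R E"
        if "s \<in> {a..c}" for s
      proof -
        have le: "\<bar>s - t0\<bar> \<le> w" using side[OF that] by simp
        have "push (g s) = g0 t0 + (s - t0) *\<^sub>R f + ((1 + \<delta>) * (1 - \<bar>s - t0\<bar> / w)) *\<^sub>R E"
          unfolding push_def gg coordinates_g0[OF le] unfolding lin_g0[OF le] by simp
        then show ?thesis using side[OF that] by simp
      qed
      have mm: "m = (1 - u) * a + u * c" by (simp add: m_def linepath_def)
      define Q where "Q = f + ((1 + \<delta>) * \<sigma> / w) *\<^sub>R E"
      define P where "P = g0 t0 - t0 *\<^sub>R f + ((1 + \<delta>) * (1 - \<sigma> * t0 / w)) *\<^sub>R E"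
      have affine: "push (g s) = P + s *\<^sub>R Q" if "s \<in> {a..c}" for s
        unfolding form[OF that] vec3_eq_iff by (simp add: P_def Q_def algebra_simps diff_divide_distrib)
      have "a \<in> {a..c}" "c \<in> {a..c}" using ac by auto
      moreover have "push (g m) = P + ((1 - u) * a + u * c) *\<^sub>R Q"
        unfolding mm[symmetric] by (rule affine[OF m])
      ultimately have "push (g m) = (1 - u) *\<^sub>R push (g a) + u *\<^sub>R push (g c)"
        by (simp add: affine algebra_simps)
      then show ?thesis by (simp add: m_def linepath_def)
    qed
  qed
qed

lemma eventually_unmoved:
  assumes "g \<in> D" "s \<in> {0<..<1}" "\<not> (g = g0 \<and> \<bar>s - t0\<bar> \<le> w)"
  shows "\<forall>\<^sub>F r in nhds s. (push \<circ> g) r = g r \<and> bump (g r) = 0"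
proof -
  have "open ({0<..<1} - (if g = g0 then {t0 - w..t0 + w} else {}))" by (simp add: open_Diff)
  moreover have "s \<in> {0<..<1} - (if g = g0 then {t0 - w..t0 + w} else {})"
    using assms by (auto simp: abs_le_iff)
  ultimately have "\<forall>\<^sub>F r in nhds s. r \<in> {0<..<1} - (if g = g0 then {t0 - w..t0 + w} else {})"
    by (rule eventually_nhds_in_open)
  then show ?thesis
  proof eventually_elim
    case (elim r)
    then have "\<not> moved g r" by (auto simp: moved_def abs_less_iff split: if_splits)
    then show ?case using push_unmoved[OF assms(1), of r] elim by auto
  qed
qed

lemma derivative_unmoved:
  assumes "g \<in> D" "s \<in> {0<..<1}" "\<not> (g = g0 \<and> \<bar>s - t0\<bar> \<le> w)"
  shows "vector_derivative (push \<circ> g) (at s) = vector_derivative g (at s)"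
    and "(push \<circ> g) differentiable at s \<longleftrightarrow> g differentiable at s"
proof -
  have e: "\<forall>\<^sub>F r in nhds s. (push \<circ> g) r = g r"
    using eventually_unmoved[OF assms] by eventually_elim blast
  show "vector_derivative (push \<circ> g) (at s) = vector_derivative g (at s)"
    by (rule vector_derivative_cong_eq) (use e in \<open>auto elim: eventually_mono\<close>)
  have e': "\<forall>\<^sub>F r in at s. (push \<circ> g) r = g r" "\<forall>\<^sub>F r in at s. g r = (push \<circ> g) r"
    using e by (auto simp: eventually_at_filter elim: eventually_mono)
  have s: "(push \<circ> g) s = g s" by (rule eventually_nhds_x_imp_x[OF e])
  have 1: "f2 differentiable at s" if "f1 differentiable at s" "\<forall>\<^sub>F r in at s. f1 r = f2 r" "f1 s = f2 s"
    for f1 f2 :: "real \<Rightarrow> real^3"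
    using that unfolding differentiable_def by (metis has_derivative_transform_eventually UNIV_I)
  show "(push \<circ> g) differentiable at s \<longleftrightarrow> g differentiable at s"
    using 1[OF _ e'(1) s] 1[OF _ e'(2) s[symmetric]] by blast
qed

lemma derivative_k0:
  assumes "\<bar>\<tau> - s0\<bar> < \<epsilon>" shows "(k0 has_vector_derivative kd) (at \<tau>)"
proof (rule has_vector_derivative_transform_within_open)
  show "((\<lambda>r. k0 s0 + (r - s0) *\<^sub>R kd) has_vector_derivative kd) (at \<tau>)"
    by (auto intro!: derivative_eq_intros)
  show "open {s0 - \<epsilon><..<s0 + \<epsilon>}" "\<tau> \<in> {s0 - \<epsilon><..<s0 + \<epsilon>}" using assms by (auto simp: abs_less_iff)
  show "k0 s0 + (r - s0) *\<^sub>R kd = k0 r" if "r \<in> {s0 - \<epsilon><..<s0 + \<epsilon>}" for r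
    by (rule lin_k0[symmetric]) (use that in auto)
qed

lemma derivative_moved:
  assumes "\<bar>x\<bar> < w" "x \<noteq> 0"
  shows "((push \<circ> g0) has_vector_derivative (f - (sgn x * (1 + \<delta>) / w) *\<^sub>R E)) (at (t0 + x))"
proof (rule has_vector_derivative_transform_within_open)
  define I where "I = (if x > 0 then {t0<..<t0 + w} else {t0 - w<..<t0})"
  show "((\<lambda>r. g0 t0 + (1 + \<delta>) *\<^sub>R E + (r - t0) *\<^sub>R (f - (sgn x * (1 + \<delta>) / w) *\<^sub>R E))
      has_vector_derivative (f - (sgn x * (1 + \<delta>) / w) *\<^sub>R E)) (at (t0 + x))"
    by (auto intro!: derivative_eq_intros)
  show "open I" "t0 + x \<in> I" using assms by (auto simp: I_def)
  fix r assume r: "r \<in> I"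
  then have m: "moved g0 r" using w(1) by (auto simp: I_def moved_def split: if_splits)
  have abs: "\<bar>r - t0\<bar> = sgn x * (r - t0)" using r assms(2) by (auto simp: I_def sgn_if split: if_splits)
  show "g0 t0 + (1 + \<delta>) *\<^sub>R E + (r - t0) *\<^sub>R (f - (sgn x * (1 + \<delta>) / w) *\<^sub>R E) = (push \<circ> g0) r"
    unfolding o_apply push_moved(1)[OF m] abs vec3_eq_iff using w(1) by (simp add: field_simps)
qed

text \<open>The finger is so thin that its two sides run almost parallel to \<open>E\<close>, in opposite senses. So the
  two new crossings have opposite signs.\<close>

lemma new_crossing_det:
  assumes x: "x \<in> {x_exit, x_enter}"
  shows "crossing_det (push \<circ> k0) (s0 + x / b) (push \<circ> g0) (t0 + x)
      = plane_det kd f - sgn x * ((1 + \<delta>) / w * plane_det kd E)"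
    and "(push \<circ> k0) differentiable at (s0 + x / b)" "(push \<circ> g0) differentiable at (t0 + x)"
    and "sgn (crossing_det (push \<circ> k0) (s0 + x / b) (push \<circ> g0) (t0 + x)) = - sgn x * sgn (plane_det kd E)"
proof -
  note n = new_crossing_points[OF x]
  have x0: "x \<noteq> 0" using x x_exit_bounds x_enter_bounds by auto
  have dk: "(k0 has_vector_derivative kd) (at (s0 + x / b))"
    using x_bounds[OF x] by (intro derivative_k0) simp
  have dg: "((push \<circ> g0) has_vector_derivative (f - (sgn x * (1 + \<delta>) / w) *\<^sub>R E)) (at (t0 + x))"
    using x_bounds[OF x] x0 by (intro derivative_moved) auto
  show det: "crossing_det (push \<circ> k0) (s0 + x / b) (push \<circ> g0) (t0 + x)
      = plane_det kd f - sgn x * ((1 + \<delta>) / w * plane_det kd E)"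
    unfolding crossing_det_eq derivative_unmoved(1)[OF k0 n(5,2)]
      vector_derivative_at[OF dk] vector_derivative_at[OF dg] by simp
  show "(push \<circ> k0) differentiable at (s0 + x / b)"
    unfolding derivative_unmoved(2)[OF k0 n(5,2)] using dk differentiableI_vector by blast
  show "(push \<circ> g0) differentiable at (t0 + x)" using dg differentiableI_vector by blast
  define q where "q = (1 + \<delta>) / w"
  have q: "q > 0" "1 / w \<le> q" using \<delta> w(1) by (simp_all add: q_def divide_right_mono)
  have "\<bar>plane_det kd f\<bar> < 1 / w * \<bar>plane_det kd E\<bar>"
    using thin w(1) plane_det_swap[of kd f] by (simp add: divide_simps mult.commute)
  also have "\<dots> \<le> q * \<bar>plane_det kd E\<bar>" using q(2) by (intro mult_right_mono) auto
  finally have "\<bar>plane_det kd f\<bar> < \<bar>q * plane_det kd E\<bar>" using q(1) by (simp add: abs_mult)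
  moreover have "sgn (q * plane_det kd E) = sgn (plane_det kd E)" using q(1) by (simp add: sgn_mult)
  ultimately have "\<bar>plane_det kd f\<bar> < \<bar>q * plane_det kd E\<bar>" "sgn (q * plane_det kd E) = sgn (plane_det kd E)"
    by blast+
  then show "sgn (crossing_det (push \<circ> k0) (s0 + x / b) (push \<circ> g0) (t0 + x)) = - sgn x * sgn (plane_det kd E)"
    unfolding det q_def[symmetric] using x0 by (auto simp: sgn_if split: if_splits)
qed

lemma link_diagram_D': "link_diagram D'"
  unfolding link_diagram_def oriented_link_in_def
proof (intro conjI ballI allI impI)
  show "finite D'" "D' \<noteq> {}" using link_diagramD(1,2)[OF diagram] by (auto simp: D'_def)
  fix G assume "G \<in> D'"
  then obtain g where g: "g \<in> D" "G = push \<circ> g" by (auto simp: D'_def)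
  show "simple_path G" unfolding g(2)
    by (rule simple_path_continuous_image[OF link_diagramD(3)[OF diagram g(1)] continuous_on_push])
      (auto intro: inj_onI simp: inj_push)
  show "pathfinish G = pathstart G"
    using link_diagramD(4)[OF diagram g(1)] by (simp add: g(2) pathfinish_compose pathstart_compose)
  show "path_image G \<subseteq> UNIV" by simp
  show "polygonal G" unfolding g(2) by (rule polygonal_push[OF g(1)])
next
  show "pairwise (\<lambda>g h. disjnt (path_image g) (path_image h)) D'"
  proof (rule pairwiseI)
    fix G H assume "G \<in> D'" "H \<in> D'" "G \<noteq> H"
    then obtain g h where gh: "g \<in> D" "h \<in> D" "g \<noteq> h" "G = push \<circ> g" "H = push \<circ> h"
      by (auto simp: D'_def)
    have "path_image g \<inter> path_image h = {}" by (rule link_diagramD(5)[OF diagram gh(1-3)])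
    then show "disjnt (path_image G) (path_image H)"
      by (auto simp: gh(4,5) path_image_compose disjnt_def inj_push)
  qed
next
  let ?f = "\<lambda>(g, s, h, t). (push \<circ> g, s, push \<circ> h, t)"
  let ?N = "(\<lambda>x. (push \<circ> k0, s0 + x / b, push \<circ> g0, t0 + x)) ` {x_exit, x_enter}"
  have "(G, s, H, t) \<in> ?f ` {(g, s, h, t). crossing D g s h t} \<union> ?N" if "crossing D' G s H t" for G s H t
    using that
  proof (cases rule: crossing_D'_cases)
    case (old g h)
    then show ?thesis by (intro UnI1 rev_image_eqI[of "(g, s, h, t)"]) auto
  next
    case (new x)
    then show ?thesis by blast
  qed
  then have "{(G, s, H, t). crossing D' G s H t} \<subseteq> ?f ` {(g, s, h, t). crossing D g s h t} \<union> ?N" by blast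
  then show "finite {(G, s, H, t). crossing D' G s H t}"
    by (rule finite_subset) (use link_diagramD(7)[OF diagram] in auto)
next
  fix p q r assume pqr: "p \<in> link_space D'" "q \<in> link_space D'" "r \<in> link_space D'"
    and eq: "plane_proj p = plane_proj q \<and> plane_proj q = plane_proj r"
  obtain g1 s1 where 1: "g1 \<in> D" "s1 \<in> {0..1}" "p = push (g1 s1)" using pqr(1) by (rule link_space_D'E)
  obtain g2 s2 where 2: "g2 \<in> D" "s2 \<in> {0..1}" "q = push (g2 s2)" using pqr(2) by (rule link_space_D'E)
  obtain g3 s3 where 3: "g3 \<in> D" "s3 \<in> {0..1}" "r = push (g3 s3)" using pqr(3) by (rule link_space_D'E)
  show "p = q \<or> q = r \<or> p = r"
  proof (cases "moved g1 s1 \<or> moved g2 s2 \<or> moved g3 s3")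
    case True
    have *: "x = push (g s) \<or> x = push (k0 (s0 + U p / b))"
      if "moved g s" "x \<in> link_space D'" "plane_proj x = plane_proj (push (g s))" "plane_proj x = plane_proj p" for g s x
      using two_points_over_moved[OF that(1-3)] US_cong(1)[of "push (g s)" p] that by simp
    from True show ?thesis using *[of _ _ p] *[of _ _ q] *[of _ _ r] pqr eq 1(3) 2(3) 3(3) by metis
  next
    case False
    then have "p = g1 s1" "q = g2 s2" "r = g3 s3" using 1 2 3 push_unmoved(1) by auto
    then show ?thesis using link_diagramD(8)[OF diagram, of p q r] 1 2 3 eq in_link_space by metis
  qed
next
  fix G s H t assume "crossing D' G s H t"
  then have "s \<in> {0<..<1} \<and> t \<in> {0<..<1} \<and> G differentiable at s \<and> H differentiable at t \<and> crossing_det G s H t \<noteq> 0"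
  proof (cases rule: crossing_D'_cases)
    case (old g h)
    note d = link_diagramD(9)[OF diagram old(1)] and n = crossing_not_near[OF old(1)] and c = crossingD(1,2)[OF old(1)]
    show ?thesis using d unfolding old(2,3) crossing_det_eq
      using derivative_unmoved[OF c(1) _ n(1)] derivative_unmoved[OF c(2) _ n(2)] by simp
  next
    case (new x)
    have "x \<noteq> 0" using new(1) x_exit_bounds x_enter_bounds by auto
    then have "crossing_det G s H t \<noteq> 0"
      using new_crossing_det(4)[OF new(1)] transversal_k unfolding new(2-5) by (auto simp: sgn_0_0)
    then show ?thesis using new_crossing_det(2,3)[OF new(1)] new_crossing_points(5,6)[OF new(1)]
      unfolding new(2-5) by blast
  qed
  then show "s \<in> {0<..<1}" "t \<in> {0<..<1}" "G differentiable at s" "H differentiable at t" "crossing_det G s H t \<noteq> 0"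
    by blast+
qed

lemma diagram_of_D':
  assumes "diagram_of D L" shows "diagram_of D' L"
proof -
  obtain R where R: "\<And>x. norm x \<ge> R \<Longrightarrow> bump x = 0" using bump_support by blast
  have eq: "push = (\<lambda>x. x + ((1 + \<delta>) * bump x) *\<^sub>R E)" by (auto simp: push_def)
  have "diagram_of ((\<lambda>g. (\<lambda>x. x + ((1 + \<delta>) * bump x) *\<^sub>R E) \<circ> g) ` D) L"
    by (rule push_diagram_of[where R = R, OF _ _ _ E_nonzero assms])
      (use link_diagram_D' in \<open>auto intro!: continuous_intros simp: R bump_mono D'_def eq\<close>)
  then show ?thesis unfolding D'_def eq .
qed

section \<open>Coloring the pushed diagram\<close>

text \<open>On the new link, \<open>bump\<close> is positive exactly at the points of the finger. The part of the finger
  beyond the target strand gets the color \<open>z\<close>, the rest keeps the color \<open>q\<close> of its base.\<close>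

definition finger_coloring ::
  "(real^3 \<Rightarrow> nat \<Rightarrow> nat) \<Rightarrow> (nat \<Rightarrow> nat) \<Rightarrow> (nat \<Rightarrow> nat) \<Rightarrow> real^3 \<Rightarrow> nat \<Rightarrow> nat" where
  "finger_coloring c q z x =
     (if bump x > 0 then (if S x > 1 + slope * U x then z else q) else c x)"

lemma finger_coloring_moved:
  assumes "moved g0 t"
  shows "finger_coloring c q z (push (g0 t)) = (if x_enter < t - t0 \<and> t - t0 < x_exit then z else q)"
proof -
  note m = push_moved[OF assms]
  have "S (push (g0 t)) > 1 + slope * U (push (g0 t)) \<longleftrightarrow> excess (t - t0) > 0"
    unfolding m(2,3) excess_def by auto
  then show ?thesis using m(5) excess_sign(2)[of "t - t0"] by (simp add: finger_coloring_def)
qed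

lemma near_moved_in_arc_points:
  assumes t: "\<bar>t - t0\<bar> \<le> w" shows "g0 t \<in> arc_points D"
proof -
  have "g0 t \<noteq> h s'" if c: "crossing D g s h s'" for g s h s'
  proof
    assume eq: "g0 t = h s'"
    then have "g s = g0 t"
      using near_moved_isolated[OF t, of g s] crossingD[OF c] by simp
    then show False using eq crossingD(6)[OF c] by simp
  qed
  then have "g0 t \<notin> under_points D" unfolding under_points_def by blast
  moreover have "t \<in> {0..1}" using t w by (auto simp: abs_le_iff)
  ultimately show ?thesis using in_link_space[OF g0] by (simp add: arc_points_def)
qed

lemma under_points_unmoved:
  assumes "y \<in> under_points D" shows "bump y = 0"
proof -
  obtain g s h t where c: "crossing D g s h t" "y = h t"
    using assms unfolding under_points_def by blast
  show ?thesis unfolding c(2)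
    by (rule push_unmoved(2)[OF crossingD(2,4)[OF c(1)] crossing_not_near(4)[OF c(1)]])
qed

lemma under_points_D':
  "under_points D' = under_points D \<union> {push (g0 (t0 + x_exit)), push (g0 (t0 + x_enter))}" (is "?A = ?B")
proof
  show "?A \<subseteq> ?B"
  proof
    fix y assume "y \<in> ?A"
    then obtain G s H t where c: "crossing D' G s H t" "y = H t" unfolding under_points_def by blast
    from c(1) show "y \<in> ?B"
    proof (cases rule: crossing_D'_cases)
      case (old g h)
      then have "y = h t" using c(2) by simp
      then show ?thesis using old(1) unfolding under_points_def by blast
    next
      case (new x)
      then show ?thesis using c(2) by auto
    qed
  qed
  have "y \<in> ?A" if "y \<in> under_points D" for y
  proof -
    from that obtain g s h t where c: "crossing D g s h t" "y = h t" unfolding under_points_def by blast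
    have "crossing D' (push \<circ> g) s (push \<circ> h) t"
      using c(1) crossing_D'_iff[OF crossingD(1,2)[OF c(1)]] by blast
    moreover have "y = (push \<circ> h) t"
      using push_unmoved(1)[OF crossingD(2)[OF c(1)]] crossing_not_near(4)[OF c(1)] crossingD(4)[OF c(1)] c(2) by simp
    ultimately show ?thesis unfolding under_points_def by blast
  qed
  moreover have "push (g0 (t0 + x)) \<in> ?A" if "x \<in> {x_exit, x_enter}" for x
  proof -
    have "crossing D' (push \<circ> k0) (s0 + x / b) (push \<circ> g0) (t0 + x)"
      using that unfolding crossing_D'_iff[OF k0 g0] by auto
    then have "(push \<circ> g0) (t0 + x) \<in> ?A" unfolding under_points_def by blast
    then show ?thesis by simp
  qed
  ultimately show "?B \<subseteq> ?A" by blast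
qed

lemma arc_points_D'_cases:
  assumes "y \<in> arc_points D'"
  obtains (moved) t where "moved g0 t" "y = push (g0 t)" "t - t0 \<notin> {x_exit, x_enter}" "bump y > 0"
  | (unmoved) g t where "bump y = 0" "y \<in> arc_points D" "g \<in> D" "t \<in> {0..1}" "y = g t" "\<not> moved g t"
proof -
  have y: "y \<in> link_space D'" "y \<notin> under_points D'" using assms by (auto simp: arc_points_def)
  obtain g t where g: "g \<in> D" "t \<in> {0..1}" "y = push (g t)" using y(1) by (rule link_space_D'E)
  show ?thesis
  proof (cases "moved g t")
    case True
    then have gg: "g = g0" by (simp add: moved_def)
    have "t - t0 \<notin> {x_exit, x_enter}"
    proof
      assume "t - t0 \<in> {x_exit, x_enter}"
      then have "t = t0 + x_exit \<or> t = t0 + x_enter" by auto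
      then show False using y(2) g(3) gg unfolding under_points_D' by blast
    qed
    then show ?thesis using moved[of t] True g(3) push_moved(5)[OF True] gg by simp
  next
    case False
    note u = push_unmoved[OF g(1,2) False]
    have "y \<in> arc_points D" using y(2) in_link_space[OF g(1,2)] u g(3)
      unfolding under_points_D' arc_points_def by auto
    then show ?thesis using unmoved[of g t] False g u by simp
  qed
qed

lemma arc_points_D'I_unmoved:
  assumes y: "y \<in> arc_points D" "bump y = 0" shows "y \<in> arc_points D'"
proof -
  have "push y = y" using y(2) by (rule push_id)
  then have "y \<in> link_space D'" using y(1) unfolding link_space_D' arc_points_def by force
  moreover have "push (g0 (t0 + x)) \<noteq> y" if "x \<in> {x_exit, x_enter}" for x
    using push_moved(5)[OF new_crossing_points(1)[OF that]] y(2) by auto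
  ultimately show ?thesis using y(1) unfolding arc_points_def under_points_D' by auto
qed

lemma arc_points_D'I_moved:
  assumes m: "moved g0 t" and t: "t - t0 \<notin> {x_exit, x_enter}" shows "push (g0 t) \<in> arc_points D'"
proof -
  have "t \<in> {0..1}" using m w by (auto simp: moved_def abs_less_iff)
  then have "push (g0 t) \<in> link_space D'" unfolding link_space_D' using in_link_space[OF g0] by blast
  moreover have "push (g0 (t0 + x)) \<noteq> push (g0 t)" if "x \<in> {x_exit, x_enter}" for x
    using push_moved(2)[OF new_crossing_points(1)[OF that]] push_moved(2)[OF m] t that by force
  moreover have "push (g0 t) \<notin> under_points D" using under_points_unmoved push_moved(5)[OF m] by force
  ultimately show ?thesis unfolding arc_points_def under_points_D' by (metis DiffI UnE insertE insertI1 insertI2 singletonD)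
qed

text \<open>Points of the finger and other points of the new link are close to each other only at the two
  ends of the base, and there all of them have the color \<open>q\<close>.\<close>

lemma finger_coloring_locally_constant:
  assumes col: "point_coloring D c" and q: "\<And>t. \<bar>t - t0\<bar> \<le> w \<Longrightarrow> c (g0 t) = q"
    and y: "y \<in> arc_points D'"
  shows "\<forall>\<^sub>F x in at y within arc_points D'. finger_coloring c q z x = finger_coloring c q z y"
  using y
proof (cases rule: arc_points_D'_cases)
  case (moved t)
  note m = push_moved[OF moved(1)]
  have b: "\<forall>\<^sub>F x in nhds y. bump x > 0" using open_positive[OF continuous_on_bump moved(4)] .
  have side: "S y - (1 + slope * U y) = excess (t - t0)" unfolding moved(2) m(2,3) excess_def by simp
  then have "S y - (1 + slope * U y) \<noteq> 0" using excess_sign(1) moved(3) by simp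
  then consider "S y - (1 + slope * U y) > 0" | "1 + slope * U y - S y > 0" by linarith
  then have "\<forall>\<^sub>F x in nhds y. finger_coloring c q z x = finger_coloring c q z y"
  proof cases
    case 1
    have "\<forall>\<^sub>F x in nhds y. S x - (1 + slope * U x) > 0"
      by (rule open_positive[where h = "\<lambda>x. S x - (1 + slope * U x)"]) (intro continuous_intros, rule 1)
    with b show ?thesis by eventually_elim (use 1 moved(4) in \<open>auto simp: finger_coloring_def\<close>)
  next
    case 2
    have "\<forall>\<^sub>F x in nhds y. 1 + slope * U x - S x > 0"
      by (rule open_positive[where h = "\<lambda>x. 1 + slope * U x - S x"]) (intro continuous_intros, rule 2)
    with b show ?thesis by eventually_elim (use 2 moved(4) in \<open>auto simp: finger_coloring_def\<close>)
  qed
  then show ?thesis unfolding eventually_at_filter by eventually_elim simp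
next
  case (unmoved g t)
  have cy: "finger_coloring c q z y = c y" using unmoved(1) by (simp add: finger_coloring_def)
  have "\<forall>\<^sub>F x in at y within arc_points D. c x = c y"
    using col unmoved(2) unfolding point_coloring_def by blast
  then have near: "\<forall>\<^sub>F x in nhds y. x \<in> arc_points D \<longrightarrow> c x = c y"
    unfolding eventually_at_filter by eventually_elim auto
  have *: "\<forall>\<^sub>F x in nhds y. x \<in> arc_points D' \<longrightarrow> bump x > 0 \<longrightarrow> finger_coloring c q z x = c y"
  proof (cases "g = g0 \<and> \<bar>t - t0\<bar> \<le> w")
    case True
    have cq: "c y = q" using q True unmoved(5) by auto
    have pos: "1 + slope * U y - S y > 0"
      using coordinates_g0[of t] slope_small[of "t - t0"] True unmoved(5) by (simp add: abs_less_iff)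
    have "\<forall>\<^sub>F x in nhds y. 1 + slope * U x - S x > 0"
      by (rule open_positive[where h = "\<lambda>x. 1 + slope * U x - S x"]) (intro continuous_intros, rule pos)
    then show ?thesis by eventually_elim (auto simp: finger_coloring_def cq)
  next
    case False
    define K where "K = (\<lambda>t. push (g0 t)) ` {t0 - w..t0 + w}"
    have "continuous_on {t0 - w..t0 + w} g0"
      using link_diagram_continuous[OF diagram g0] by (rule continuous_on_subset) (use w in auto)
    then have "compact K" unfolding K_def
      by (intro compact_continuous_image continuous_on_compose2[OF continuous_on_push[of UNIV]]) auto
    then have "open (- K)" using compact_imp_closed by blast
    moreover have "y \<notin> K"
    proof
      assume "y \<in> K"
      then obtain r where rK: "r \<in> {t0 - w..t0 + w}" "y = push (g0 r)" unfolding K_def by blast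
      then have r: "\<bar>r - t0\<bar> \<le> w" "y = push (g0 r)" by auto
      have "push y = y" using unmoved(1) by (rule push_id)
      then have eq: "g t = g0 r" using r(2) inj_push unmoved(5) by metis
      show False using rhombus[OF unmoved(3,4)] near_moved_isolated[OF r(1) unmoved(3,4)] False
          coordinates_g0[OF r(1)] eq r(1) w(1) by (auto simp: tent_def)
    qed
    ultimately have "\<forall>\<^sub>F x in nhds y. x \<in> - K" by (intro eventually_nhds_in_open) auto
    then show ?thesis
    proof eventually_elim
      case (elim x)
      show ?case
      proof (intro impI)
        assume x: "x \<in> arc_points D'" "bump x > 0"
        from x(1) show "finger_coloring c q z x = c y"
        proof (cases rule: arc_points_D'_cases)
          case (moved r)
          then have "x \<in> K" unfolding K_def by (auto simp: moved_def abs_less_iff)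
          then show ?thesis using elim by simp
        qed (use x(2) in simp)
      qed
    qed
  qed
  have "\<forall>\<^sub>F x in nhds y. x \<in> arc_points D' \<longrightarrow> finger_coloring c q z x = c y"
    using near *
  proof eventually_elim
    case (elim x)
    show ?case
    proof
      assume x: "x \<in> arc_points D'"
      show "finger_coloring c q z x = c y"
      proof (cases "bump x > 0")
        case True
        then show ?thesis using elim x by blast
      next
        case False
        from x have "x \<in> arc_points D" by (cases rule: arc_points_D'_cases) (use False in auto)
        then show ?thesis using False elim by (simp add: finger_coloring_def)
      qed
    qed
  qed
  then show ?thesis unfolding cy eventually_at_filter by eventually_elim auto
qed

text \<open>No old color is lost, because the ends of the base keep the color \<open>q\<close>.\<close>

lemma image_finger_coloring:
  assumes q: "\<And>t. \<bar>t - t0\<bar> \<le> w \<Longrightarrow> c (g0 t) = q"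
  shows "finger_coloring c q z ` arc_points D' = insert z (c ` arc_points D)" (is "?c ` _ = ?R")
proof
  have qc: "q \<in> c ` arc_points D" using q[of t0] near_moved_in_arc_points[of t0] w(1) by force
  show "?c ` arc_points D' \<subseteq> ?R"
  proof (rule image_subsetI)
    fix y assume "y \<in> arc_points D'"
    then show "?c y \<in> ?R"
    proof (cases rule: arc_points_D'_cases)
      case (moved t)
      then show ?thesis using qc by (simp add: finger_coloring_def)
    next
      case (unmoved g t)
      then show ?thesis by (simp add: finger_coloring_def)
    qed
  qed
  have m0: "moved g0 t0" using w(1) by (simp add: moved_def)
  have "push (g0 t0) \<in> arc_points D'" using x_exit_bounds x_enter_bounds by (intro arc_points_D'I_moved[OF m0]) auto
  moreover have "?c (push (g0 t0)) = z" using finger_coloring_moved[OF m0] x_exit_bounds x_enter_bounds by simp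
  ultimately have "z \<in> ?c ` arc_points D'" by force
  moreover have "c y \<in> ?c ` arc_points D'" if y: "y \<in> arc_points D" for y
  proof (cases "bump y = 0")
    case True
    then have "?c y = c y" by (simp add: finger_coloring_def)
    then show ?thesis using arc_points_D'I_unmoved[OF y True] by force
  next
    case False
    then have pos: "bump y > 0" using bump_nonneg[of y] by simp
    obtain g t where g: "g \<in> D" "t \<in> {0..1}" "y = g t" using y unfolding arc_points_def link_space_eq by blast
    then have m: "moved g t" using bump_pos_iff[OF g(1,2)] pos by simp
    then have cy: "c y = q" using q[of t] g(3) by (simp add: moved_def)
    define A where "A = g0 (t0 + w)"
    have e: "\<bar>t0 + w - t0\<bar> \<le> w" using w(1) by simp
    have "bump A = 0" unfolding A_def using coordinates_g0(4)[OF e] w(1) by simp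
    moreover have "A \<in> arc_points D" unfolding A_def by (rule near_moved_in_arc_points[OF e])
    moreover have "c A = q" unfolding A_def by (rule q[OF e])
    ultimately have "A \<in> arc_points D'" "?c A = c y"
      using arc_points_D'I_unmoved cy by (auto simp: finger_coloring_def)
    then show ?thesis by force
  qed
  ultimately show "?R \<subseteq> ?c ` arc_points D'" by blast
qed

lemma finger_coloring_at_new_crossing:
  shows "\<forall>\<^sub>F t in at_left (t0 + x_enter). finger_coloring c q z ((push \<circ> g0) t) = q"
    and "\<forall>\<^sub>F t in at_right (t0 + x_enter). finger_coloring c q z ((push \<circ> g0) t) = z"
    and "\<forall>\<^sub>F t in at_left (t0 + x_exit). finger_coloring c q z ((push \<circ> g0) t) = z"
    and "\<forall>\<^sub>F t in at_right (t0 + x_exit). finger_coloring c q z ((push \<circ> g0) t) = q"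
proof -
  note x = x_exit_bounds x_enter_bounds
  have c: "finger_coloring c q z ((push \<circ> g0) t) = (if x_enter < t - t0 \<and> t - t0 < x_exit then z else q)"
    if "\<bar>t - t0\<bar> < w" for t
    using finger_coloring_moved[of t c q z] that by (simp add: moved_def)
  show "\<forall>\<^sub>F t in at_left (t0 + x_enter). finger_coloring c q z ((push \<circ> g0) t) = q"
    unfolding eventually_at_left_field using x c by (intro exI[of _ "t0 - w"]) auto
  show "\<forall>\<^sub>F t in at_right (t0 + x_enter). finger_coloring c q z ((push \<circ> g0) t) = z"
    unfolding eventually_at_right_field using x c by (intro exI[of _ "t0 + x_exit"]) auto
  show "\<forall>\<^sub>F t in at_left (t0 + x_exit). finger_coloring c q z ((push \<circ> g0) t) = z"
    unfolding eventually_at_left_field using x c by (intro exI[of _ "t0 + x_enter"]) auto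
  show "\<forall>\<^sub>F t in at_right (t0 + x_exit). finger_coloring c q z ((push \<circ> g0) t) = q"
    unfolding eventually_at_right_field using x c by (intro exI[of _ "t0 + w"]) auto
qed

lemma point_coloring_finger_coloring:
  assumes col: "point_coloring D c"
    and q: "\<And>t. \<bar>t - t0\<bar> \<le> w \<Longrightarrow> c (g0 t) = q"
    and p: "\<And>\<tau>. \<bar>\<tau> - s0\<bar> \<le> \<epsilon> \<Longrightarrow> c (k0 \<tau>) = p"
    and z: "z \<in> S3_colors"
    and pos: "plane_det kd E > 0 \<Longrightarrow> p \<star> q = z \<star> p"
    and neg: "plane_det kd E < 0 \<Longrightarrow> p \<star> z = q \<star> p"
  shows "point_coloring D' (finger_coloring c q z)" (is "point_coloring D' ?c")
  unfolding point_coloring_def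
proof (intro conjI ballI allI impI)
  fix y assume y: "y \<in> arc_points D'"
  have "?c y \<in> insert z (c ` arc_points D)" using image_finger_coloring[of c q z, OF q] y by blast
  then show "?c y \<in> S3_colors" using point_coloringD(1)[OF col] z by (metis (no_types, lifting) imageE insertE)
  show "\<forall>\<^sub>F x in at y within arc_points D'. ?c x = ?c y"
    by (rule finger_coloring_locally_constant[OF col q y])
next
  fix G s H t y1 y2
  assume c: "crossing D' G s H t" and y1: "\<forall>\<^sub>F \<tau> in at_left t. ?c (H \<tau>) = y1"
    and y2: "\<forall>\<^sub>F \<tau> in at_right t. ?c (H \<tau>) = y2"
  from c have "wirtinger (crossing_det G s H t) (?c (G s)) y1 y2"
  proof (cases rule: crossing_D'_cases)
    case gh: (old g h)
    note old = gh(1) and D = crossingD(1,2)[OF gh(1)]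
    note d = link_diagramD(9)[OF diagram old] and n = crossing_not_near[OF old]
    have det: "crossing_det G s H t = crossing_det g s h t"
      unfolding gh(2,3) crossing_det_eq
      using derivative_unmoved(1)[OF D(1) _ n(1)] derivative_unmoved(1)[OF D(2) _ n(2)] d by simp
    have s: "?c (G s) = c (g s)"
      using push_unmoved[OF D(1) crossingD(3)[OF old] n(3)] by (simp add: gh(2) finger_coloring_def)
    have "\<forall>\<^sub>F \<tau> in nhds t. H \<tau> = h \<tau> \<and> bump (h \<tau>) = 0"
      unfolding gh(3) using eventually_unmoved[OF D(2) _ n(2)] d by blast
    then have e: "\<forall>\<^sub>F \<tau> in nhds t. ?c (H \<tau>) = c (h \<tau>)"
      by eventually_elim (simp add: finger_coloring_def)
    have at: "\<forall>\<^sub>F \<tau> in at t within A. ?c (H \<tau>) = c (h \<tau>)" for A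
      unfolding eventually_at_filter using e by eventually_elim simp
    have left: "\<forall>\<^sub>F \<tau> in at_left t. c (h \<tau>) = y1" using y1 at[of "{..<t}"] by eventually_elim simp
    have right: "\<forall>\<^sub>F \<tau> in at_right t. c (h \<tau>) = y2" using y2 at[of "{t<..}"] by eventually_elim simp
    show ?thesis unfolding det s by (rule point_coloringD(3)[OF col old left right])
  next
    case (new x)
    note x = new(1)
    note n = new_crossing_points[OF x]
    have "\<not> moved k0 (s0 + x / b)" using n(2) by (auto simp: moved_def)
    then have s: "?c (G s) = p"
      using push_unmoved[OF k0, of "s0 + x / b"] n(5) x_bounds[OF x] p[of "s0 + x / b"]
      by (simp add: new(2,3) finger_coloring_def)
    have det: "sgn (crossing_det G s H t) = - sgn x * sgn (plane_det kd E)"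
      using new_crossing_det(4)[OF x] by (simp add: new(2-5))
    note y = y1[unfolded new(4,5)] y2[unfolded new(4,5)]
    show ?thesis
    proof (cases "x = x_enter")
      case True
      have "y1 = q" "y2 = z"
        using eventually_const_unique[OF y(1)[unfolded True] finger_coloring_at_new_crossing(1)]
          eventually_const_unique[OF y(2)[unfolded True] finger_coloring_at_new_crossing(2)] by simp_all
      moreover have "sgn x = -1" using True x_enter_bounds by simp
      ultimately show ?thesis using det s pos neg by (auto simp: sgn_if split: if_splits)
    next
      case False
      then have x_exit: "x = x_exit" using x by simp
      have "y1 = z" "y2 = q"
        using eventually_const_unique[OF y(1)[unfolded x_exit] finger_coloring_at_new_crossing(3)]
          eventually_const_unique[OF y(2)[unfolded x_exit] finger_coloring_at_new_crossing(4)] by simp_all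
      moreover have "sgn x = 1" using x_exit x_exit_bounds by simp
      ultimately show ?thesis using det s pos neg by (auto simp: sgn_if split: if_splits)
    qed
  qed
  note * = this
  show "?c (G s) \<star> y1 = y2 \<star> ?c (G s)" if "crossing_det G s H t > 0"
    using * that by blast
  show "?c (G s) \<star> y2 = y1 \<star> ?c (G s)" if "crossing_det G s H t < 0"
    using * that by blast
qed

lemma finger_over_point:
  assumes p: "\<And>\<tau>. \<bar>\<tau> - s0\<bar> \<le> \<epsilon> \<Longrightarrow> c (k0 \<tau>) = p"
  shows "\<exists>G s H t. crossing D' G s H t \<and> finger_coloring c q z (G s) = p \<and>
    (\<forall>\<^sub>F \<tau> in at_left t. finger_coloring c q z (H \<tau>) = q)"
proof -
  let ?s = "s0 + x_enter / b"
  note n = new_crossing_points[of x_enter]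
  have "\<not> moved k0 ?s" using n(2) by (auto simp: moved_def)
  then have "finger_coloring c q z ((push \<circ> k0) ?s) = p"
    using push_unmoved[OF k0, of ?s] n(5) x_bounds[of x_enter] p[of ?s] by (simp add: finger_coloring_def)
  moreover have "crossing D' (push \<circ> k0) ?s (push \<circ> g0) (t0 + x_enter)"
    unfolding crossing_D'_iff[OF k0 g0] by simp
  ultimately show ?thesis using finger_coloring_at_new_crossing(1) by blast
qed

end

section \<open>Fingers along clean segments\<close>

lemma small_factor:
  fixes A B :: real
  assumes "B > 0" shows "\<exists>x>0. \<forall>y. 0 < y \<longrightarrow> y \<le> x \<longrightarrow> y * \<bar>A\<bar> < B"
proof (intro exI conjI allI impI)
  show "B / (\<bar>A\<bar> + 1) > 0" using assms by simp
  fix y assume y: "0 < y" "y \<le> B / (\<bar>A\<bar> + 1)"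
  then have "y * (\<bar>A\<bar> + 1) \<le> B" by (simp add: le_divide_eq)
  then show "y * \<bar>A\<bar> < B" using y(1) by (simp add: algebra_simps)
qed

text \<open>By compactness, a nonnegative function that vanishes at no more than two points of the link is
  bounded away from 0 outside neighborhoods of these points.\<close>

lemma link_gap:
  fixes m :: "real^3 \<Rightarrow> real"
  assumes D: "link_diagram D" and m: "continuous_on UNIV m" "\<And>x. m x \<ge> 0"
    and zero: "\<And>g t. g \<in> D \<Longrightarrow> t \<in> {0..1} \<Longrightarrow> m (g t) = 0 \<Longrightarrow> g = g0 \<and> t = t0 \<or> g = k0 \<and> t = s0"
    and r: "r1 > 0" "r2 > 0"
  obtains \<eta> where "\<eta> > 0"
    "\<And>g t. g \<in> D \<Longrightarrow> t \<in> {0..1} \<Longrightarrow> m (g t) < \<eta> \<Longrightarrow> g = g0 \<and> \<bar>t - t0\<bar> < r1 \<or> g = k0 \<and> \<bar>t - s0\<bar> < r2"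
proof -
  define T where "T g = {0..1} - (if g = g0 then {t0 - r1<..<t0 + r1} else {})
      - (if g = k0 then {s0 - r2<..<s0 + r2} else {})" for g
  define K where "K = (\<Union>g\<in>D. g ` T g)"
  have "compact (T g)" for g unfolding T_def by (auto intro!: compact_diff)
  moreover have "T g \<subseteq> {0..1}" for g by (auto simp: T_def)
  ultimately have "compact (g ` T g)" if "g \<in> D" for g
    using link_diagram_continuous[OF D that] by (meson compact_continuous_image continuous_on_subset)
  then have cK: "compact K" unfolding K_def using link_diagramD(1)[OF D] by (intro compact_UN)
  have pos: "m x > 0" if "x \<in> K" for x
  proof -
    from that obtain g t where g: "g \<in> D" "t \<in> T g" "x = g t" unfolding K_def by blast
    have "m x \<noteq> 0" using zero[OF g(1), of t] g(2,3) r by (auto simp: T_def)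
    then show ?thesis using m(2)[of x] by simp
  qed
  obtain \<eta> where \<eta>: "\<eta> > 0" "\<And>x. x \<in> K \<Longrightarrow> \<eta> \<le> m x"
  proof (cases "K = {}")
    case True
    then show ?thesis using that[of 1] by auto
  next
    case False
    then obtain x where "x \<in> K" "\<And>y. y \<in> K \<Longrightarrow> m x \<le> m y"
      using continuous_attains_inf[OF cK False continuous_on_subset[OF m(1)]] by auto
    then show ?thesis using that[of "m x"] pos by auto
  qed
  show ?thesis
  proof (rule that[OF \<eta>(1)])
    fix g t assume g: "g \<in> D" "t \<in> {0..1}" "m (g t) < \<eta>"
    then have "g t \<notin> K" using \<eta>(2)[of "g t"] by auto
    then have "t \<notin> T g" using g(1) unfolding K_def by blast
    then show "g = g0 \<and> \<bar>t - t0\<bar> < r1 \<or> g = k0 \<and> \<bar>t - s0\<bar> < r2"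
      using g(2) unfolding T_def by (auto simp: abs_less_iff split: if_splits)
  qed
qed

lemma color_near:
  assumes D: "link_diagram D" and col: "point_coloring D c" and g: "g \<in> D" and t: "t \<in> {0<..<1}"
    and arc: "g t \<in> arc_points D"
  shows "\<forall>\<^sub>F s in nhds t. g s \<in> arc_points D \<and> c (g s) = c (g t)"
proof -
  obtain e where e: "e > 0" "{t-e<..<t+e} \<subseteq> {0<..<1}"
    "\<And>s. s \<in> {t-e<..<t+e} \<Longrightarrow> s \<noteq> t \<Longrightarrow> g s \<in> arc_points D"
    using no_under_points_near[OF D g t] by blast
  have "\<forall>\<^sub>F s in nhds t. s \<in> {t-e<..<t+e}" using e(1) by (intro eventually_nhds_in_open) auto
  then have 1: "\<forall>\<^sub>F s in nhds t. g s \<in> arc_points D"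
    by eventually_elim (use e(3) arc in blast)
  have "continuous_on {0<..<1} g" using link_diagram_continuous[OF D g] by (rule continuous_on_subset) auto
  then have lim: "filterlim g (nhds (g t)) (nhds t)"
    using t by (simp add: continuous_on_eq_continuous_at isCont_def tendsto_at_iff_tendsto_nhds)
  have "\<forall>\<^sub>F x in nhds (g t). x \<in> arc_points D \<longrightarrow> c x = c (g t)"
    using point_coloringD(2)[OF col arc] unfolding eventually_at_filter by eventually_elim auto
  then have "\<forall>\<^sub>F s in nhds t. g s \<in> arc_points D \<longrightarrow> c (g s) = c (g t)"
    using lim by (rule eventually_compose_filterlim)
  with 1 show ?thesis by eventually_elim blast
qed

lemma eventually_nhds_interval:
  fixes t :: real
  assumes "\<forall>\<^sub>F s in nhds t. P s"
  shows "\<exists>e>0. e \<le> 1 \<and> (\<forall>s. \<bar>s - t\<bar> \<le> e \<longrightarrow> P s)"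
proof -
  obtain d where d: "d > 0" "\<And>s. dist s t < d \<Longrightarrow> P s"
    using assms unfolding eventually_nhds_metric by blast
  show ?thesis
    by (rule exI[of _ "min 1 (d / 2)"]) (use d in \<open>auto simp: dist_real_def\<close>)
qed

text \<open>The segment from \<open>g0 t0\<close> to \<open>k0 s0\<close> in the plane is \<^emph>\<open>clean\<close>: it meets the diagram only at its
  ends, transversally. By compactness a neighborhood of it is clean as well, up to short pieces of
  the two edges, and there is room for a finger. The crossing in the conclusion is the one that
  the finger reaches first; it is the starting point for a second move.\<close>

lemma finger_move:
  fixes g0 k0 :: "real \<Rightarrow> real^3"
  assumes L: "diagram_of D L" and col: "point_coloring D c"
    and g0: "g0 \<in> D" "t0 \<in> {0<..<1}" and k0: "k0 \<in> D" "s0 \<in> {0<..<1}"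
    and lin_g0: "\<forall>\<^sub>F t in nhds t0. g0 t = g0 t0 + (t - t0) *\<^sub>R f"
    and lin_k0: "\<forall>\<^sub>F t in nhds s0. k0 t = k0 s0 + (t - s0) *\<^sub>R v"
    and target: "plane_proj (k0 s0) = plane_proj (g0 t0 + e)"
    and tf: "plane_det f e \<noteq> 0" and tv: "plane_det v e \<noteq> 0"
    and clean: "\<And>g t x. g \<in> D \<Longrightarrow> t \<in> {0..1} \<Longrightarrow> x \<in> {0..1} \<Longrightarrow>
      plane_proj (g t) = plane_proj (g0 t0 + x *\<^sub>R e) \<Longrightarrow> g = g0 \<and> t = t0 \<or> g = k0 \<and> t = s0"
    and z: "z \<in> S3_colors"
    and pos: "plane_det v e > 0 \<Longrightarrow>
      c (k0 s0) \<star> c (g0 t0) = z \<star> c (k0 s0)"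
    and neg: "plane_det v e < 0 \<Longrightarrow>
      c (k0 s0) \<star> z = c (g0 t0) \<star> c (k0 s0)"
  shows "\<exists>D1 c1. diagram_of D1 L \<and> point_coloring D1 c1 \<and>
    c1 ` arc_points D1 = insert z (c ` arc_points D) \<and>
    (\<exists>G s H t. crossing D1 G s H t \<and> c1 (G s) = c (k0 s0) \<and>
       (\<forall>\<^sub>F \<tau> in at_left t. c1 (H \<tau>) = c (g0 t0)))"
proof -
  have D: "link_diagram D" using L by (simp add: diagram_of_def)
  let ?M = "g0 t0"
  have ne: "plane_proj ?M \<noteq> plane_proj (k0 s0)"
  proof
    assume "plane_proj ?M = plane_proj (k0 s0)"
    then have "e $ 1 = 0" "e $ 2 = 0" using target by (auto simp: plane_proj_eq_iff)
    then show False using tf by (simp add: plane_det_def)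
  qed
  have arc: "y \<in> arc_points D" if y: "y = ?M \<or> y = k0 s0" for y
  proof -
    have "y \<noteq> h t" if cr: "crossing D g s h t" for g s h t
    proof
      assume eq: "y = h t"
      note cd = crossingD[OF cr]
      define x :: real where "x = (if y = ?M then 0 else 1)"
      have x: "x \<in> {0..1}" by (simp add: x_def)
      have px: "plane_proj y = plane_proj (?M + x *\<^sub>R e)"
        using y target by (auto simp: x_def)
      have "g = g0 \<and> s = t0 \<or> g = k0 \<and> s = s0" using clean[OF cd(1,3) x] px eq cd(5) by simp
      moreover have "h = g0 \<and> t = t0 \<or> h = k0 \<and> t = s0" using clean[OF cd(2,4) x] px eq by simp
      ultimately have "(g, s) = (h, t)" using cd(5) ne by force
      then show False using cd(6) by simp
    qed
    then have "y \<notin> under_points D" unfolding under_points_def by blast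
    moreover have "y \<in> link_space D"
      using y in_link_space[OF g0(1), of t0] in_link_space[OF k0(1), of s0] g0(2) k0(2) by auto
    ultimately show ?thesis by (simp add: arc_points_def)
  qed
  have in01: "\<forall>\<^sub>F s in nhds t. s \<in> {0<..<1}" if "t \<in> {0<..<1}" for t :: real
    using that by (intro eventually_nhds_in_open) auto
  have "\<forall>\<^sub>F t in nhds t0. g0 t = ?M + (t - t0) *\<^sub>R f \<and> t \<in> {0<..<1} \<and> c (g0 t) = c ?M"
    using lin_g0 in01[OF g0(2)] color_near[OF D col g0 arc[OF disjI1[OF refl]]] by eventually_elim simp
  from eventually_nhds_interval[OF this] obtain w1 where w1: "w1 > 0" "w1 \<le> 1"
    "\<And>t. \<bar>t - t0\<bar> \<le> w1 \<Longrightarrow> g0 t = ?M + (t - t0) *\<^sub>R f \<and> t \<in> {0<..<1} \<and> c (g0 t) = c ?M"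
    by blast
  have "\<forall>\<^sub>F t in nhds s0. k0 t = k0 s0 + (t - s0) *\<^sub>R v \<and> t \<in> {0<..<1} \<and> c (k0 t) = c (k0 s0)"
    using lin_k0 in01[OF k0(2)] color_near[OF D col k0 arc[OF disjI2[OF refl]]] by eventually_elim simp
  from eventually_nhds_interval[OF this] obtain \<epsilon>1 where \<epsilon>1: "\<epsilon>1 > 0" "\<epsilon>1 \<le> 1"
    "\<And>t. \<bar>t - s0\<bar> \<le> \<epsilon>1 \<Longrightarrow> k0 t = k0 s0 + (t - s0) *\<^sub>R v \<and> t \<in> {0<..<1} \<and> c (k0 t) = c (k0 s0)"
    by blast
  obtain \<epsilon>2 where \<epsilon>2: "\<epsilon>2 > 0" "\<And>y. 0 < y \<Longrightarrow> y \<le> \<epsilon>2 \<Longrightarrow> y * \<bar>plane_det f v / plane_det f e\<bar> < 1 / 2"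
    using small_factor[of "1 / 2" "plane_det f v / plane_det f e"] by auto
  define \<epsilon> where "\<epsilon> = min \<epsilon>1 \<epsilon>2"
  have \<epsilon>: "\<epsilon> > 0" "\<epsilon> \<le> 1" using \<epsilon>1 \<epsilon>2(1) by (auto simp: \<epsilon>_def)
  have k0_near: "k0 t = k0 s0 + (t - s0) *\<^sub>R v \<and> t \<in> {0<..<1} \<and> c (k0 t) = c (k0 s0)"
    if "\<bar>t - s0\<bar> \<le> \<epsilon>" for t by (intro \<epsilon>1(3)) (use that in \<open>simp add: \<epsilon>_def\<close>)
  \<comment> \<open>The finger descends steeply, so that it is far below the strand of \<open>k0\<close> when it gets there.\<close>
  define K where "K = 2 * (2 + \<bar>k0 s0 $ 3\<bar> + \<bar>v $ 3\<bar> + \<bar>?M $ 3\<bar> + \<bar>f $ 3\<bar>)"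
  define E :: "real^3" where "E = vector [e $ 1, e $ 2, - K]"
  have E: "E $ 1 = e $ 1" "E $ 2 = e $ 2" "E $ 3 = - K" by (simp_all add: E_def)
  have detE: "plane_det x E = plane_det x e" for x by (simp add: plane_det_def E)
  define SS where "SS x = plane_det f (x - ?M) / plane_det f e" for x
  define UU where "UU x = plane_det (x - ?M) e / plane_det f e" for x
  \<comment> \<open>This function vanishes exactly above the segment.\<close>
  define m where "m x = max (SS x - 1) 0 + max (- SS x) 0 + \<bar>UU x\<bar>" for x
  have comb: "x $ i = (?M + SS x *\<^sub>R e) $ i" if "UU x = 0" "i = 1 \<or> i = 2" for x i
  proof -
    have *: "plane_det (x - ?M) e = 0" using that(1) tf by (simp add: UU_def)
    have "SS x * e $ i = (plane_det f (x - ?M) * e $ i + plane_det (x - ?M) e * f $ i) / plane_det f e"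
      unfolding * by (simp add: SS_def)
    also have "plane_det f (x - ?M) * e $ i + plane_det (x - ?M) e * f $ i = (x $ i - ?M $ i) * plane_det f e"
      using that(2) by (elim disjE) (simp_all add: plane_det_def algebra_simps)
    finally show ?thesis using tf by simp
  qed
  have m_cont: "continuous_on UNIV m"
  proof -
    have "continuous_on UNIV (\<lambda>x. plane_det (x - p) y)" "continuous_on UNIV (\<lambda>x. plane_det y (x - p))" for p y
      unfolding plane_det_def by (intro continuous_intros)+
    then have "continuous_on UNIV UU" "continuous_on UNIV SS"
      unfolding UU_def SS_def by (intro continuous_on_divide continuous_on_const; simp add: tf)+
    then show ?thesis unfolding m_def by (intro continuous_intros)
  qed
  have m_zero: "g = g0 \<and> t = t0 \<or> g = k0 \<and> t = s0" if g: "g \<in> D" "t \<in> {0..1}" "m (g t) = 0" for g t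
  proof -
    have "UU (g t) = 0" "SS (g t) \<in> {0..1}" using g(3) unfolding m_def by (auto simp: max_def split: if_splits)
    then show ?thesis using comb[of "g t" 1] comb[of "g t" 2]
      by (intro clean[OF g(1,2), of "SS (g t)"]) (auto simp: plane_proj_eq_iff)
  qed
  have m_nonneg: "m x \<ge> 0" for x by (simp add: m_def)
  obtain \<eta> where \<eta>: "\<eta> > 0" "\<And>g t. g \<in> D \<Longrightarrow> t \<in> {0..1} \<Longrightarrow> m (g t) < \<eta> \<Longrightarrow>
      g = g0 \<and> \<bar>t - t0\<bar> < w1 \<or> g = k0 \<and> \<bar>t - s0\<bar> < \<epsilon>"
    using link_gap[OF D m_cont m_nonneg m_zero w1(1) \<epsilon>(1)] by blast
  define \<delta> where "\<delta> = \<eta> / 8"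
  have \<delta>: "\<delta> > 0" using \<eta> by (simp add: \<delta>_def)
  obtain w2 where w2: "w2 > 0" "\<And>y. 0 < y \<Longrightarrow> y \<le> w2 \<Longrightarrow> y * \<bar>plane_det f v\<bar> < \<bar>plane_det v e\<bar>"
    using small_factor[of "\<bar>plane_det v e\<bar>" "plane_det f v"] tv by auto
  obtain w3 where w3: "w3 > 0" "\<And>y. 0 < y \<Longrightarrow> y \<le> w3 \<Longrightarrow> y * \<bar>plane_det f e\<bar> < \<epsilon> * \<bar>plane_det v e\<bar>"
    using small_factor[of "\<epsilon> * \<bar>plane_det v e\<bar>" "plane_det f e"] tv \<epsilon>(1) by auto
  define w where "w = min (min w1 (\<eta> / 2)) (min w2 w3)"
  have w: "w > 0" "w \<le> w1" "w \<le> \<eta> / 2" "w \<le> w2" "w \<le> w3"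
    using w1(1) \<eta>(1) w2(1) w3(1) by (auto simp: w_def)
  have g0_near: "g0 t = g0 t0 + (t - t0) *\<^sub>R f \<and> t \<in> {0<..<1} \<and> c (g0 t) = c (g0 t0)"
    if "\<bar>t - t0\<bar> \<le> w" for t by (intro w1(3)) (use that w(2) in simp)
  interpret finger D g0 k0 t0 s0 w \<delta> \<epsilon> f v E
  proof
    show "0 < t0 - w" "t0 + w < 1"
      using w1(3)[of "t0 - w"] w1(3)[of "t0 + w"] w by auto
    show "0 < s0 - \<epsilon>" "s0 + \<epsilon> < 1"
      using k0_near[of "s0 - \<epsilon>"] k0_near[of "s0 + \<epsilon>"] \<epsilon> by auto
    show "g0 t = g0 t0 + (t - t0) *\<^sub>R f" if "\<bar>t - t0\<bar> \<le> w" for t using g0_near[OF that] by blast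
    show "k0 \<tau> = k0 s0 + (\<tau> - s0) *\<^sub>R v" if "\<bar>\<tau> - s0\<bar> \<le> \<epsilon>" for \<tau> using k0_near[OF that] by blast
    show "plane_proj (k0 s0) = plane_proj (g0 t0 + E)" using target by (simp add: plane_proj_eq_iff E)
    show "w * \<bar>plane_det f v\<bar> < \<bar>plane_det v E\<bar>" "w * \<bar>plane_det f E\<bar> < \<epsilon> * \<bar>plane_det v E\<bar>"
      using w2(2)[of w] w3(2)[of w] w by (simp_all add: detE)
    fix g :: "real \<Rightarrow> real^3" and t :: real assume g: "g \<in> D" "t \<in> {0..1}"
    assume "max (plane_det f (g t - g0 t0) / plane_det f E / (1 + 2 * \<delta>))
          (- (plane_det f (g t - g0 t0) / plane_det f E) / \<delta>)
        + \<bar>plane_det (g t - g0 t0) E / plane_det f E\<bar> / w \<le> 1"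
    then have r: "max (SS (g t) / (1 + 2 * \<delta>)) (- SS (g t) / \<delta>) + \<bar>UU (g t)\<bar> / w \<le> 1"
      by (simp add: detE SS_def UU_def)
    have "max (SS (g t) / (1 + 2 * \<delta>)) (- SS (g t) / \<delta>) \<ge> 0"
      using \<delta> by (cases "SS (g t) \<ge> 0") (auto simp: le_max_iff_disj divide_nonpos_pos)
    moreover have "\<bar>UU (g t)\<bar> / w \<ge> 0" using w(1) by simp
    ultimately have "SS (g t) / (1 + 2 * \<delta>) \<le> 1" "- SS (g t) / \<delta> \<le> 1" "\<bar>UU (g t)\<bar> / w \<le> 1"
      using r by linarith+
    then have b: "SS (g t) \<le> 1 + 2 * \<delta>" "- SS (g t) \<le> \<delta>" "\<bar>UU (g t)\<bar> \<le> w"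
      using \<delta> w(1) by (simp_all add: divide_le_eq le_divide_eq)
    have "max (SS (g t) - 1) 0 + max (- SS (g t)) 0 \<le> 2 * \<delta>" using b(1,2) \<delta> by (auto simp: max_def)
    then have "m (g t) < \<eta>" using b(3) w(3) \<eta>(1) unfolding m_def \<delta>_def by linarith
    from \<eta>(2)[OF g this]
    show "g = g0 \<and> \<bar>t - t0\<bar> \<le> w \<or>
      g = k0 \<and> \<bar>t - s0\<bar> \<le> \<epsilon> \<and>
        (g t - g0 t0) $ 3 - plane_det (g t - g0 t0) E / plane_det f E * f $ 3
          - plane_det f (g t - g0 t0) / plane_det f E * E $ 3 > 1"
    proof (elim disjE conjE)
      assume gg: "g = g0" "\<bar>t - t0\<bar> < w1"
      then have "g t = ?M + (t - t0) *\<^sub>R f" using w1(3)[of t] by simp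
      then have "UU (g t) = t - t0" using tf by (simp add: UU_def)
      then show ?thesis using b(3) gg by simp
    next
      assume gk: "g = k0" "\<bar>t - s0\<bar> < \<epsilon>"
      then have kt: "g t = k0 s0 + (t - s0) *\<^sub>R v" using k0_near[of t] by simp
      have target': "k0 s0 $ 1 = ?M $ 1 + e $ 1" "k0 s0 $ 2 = ?M $ 2 + e $ 2"
        using target by (simp_all add: plane_proj_eq_iff)
      have "plane_det f (g t - ?M) = plane_det f e + (t - s0) * plane_det f v"
        unfolding kt by (simp add: plane_det_def target' algebra_simps)
      then have "SS (g t) = 1 + (t - s0) * (plane_det f v / plane_det f e)"
        using tf by (simp add: SS_def add_divide_distrib)
      moreover have "\<bar>(t - s0) * (plane_det f v / plane_det f e)\<bar> \<le> \<epsilon> * \<bar>plane_det f v / plane_det f e\<bar>"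
        unfolding abs_mult using gk(2) by (intro mult_right_mono) auto
      moreover have "\<epsilon> * \<bar>plane_det f v / plane_det f e\<bar> < 1 / 2" using \<epsilon>2(2)[of \<epsilon>] \<epsilon>(1) by (simp add: \<epsilon>_def)
      ultimately have S2: "SS (g t) \<ge> 1 / 2" by linarith
      have "K \<ge> 0" by (simp add: K_def)
      then have SK: "SS (g t) * K \<ge> 1 / 2 * K" using S2 by (intro mult_right_mono)
      have "\<bar>UU (g t) * f $ 3\<bar> \<le> 1 * \<bar>f $ 3\<bar>"
        unfolding abs_mult using b(3) w(2) w1(2) by (intro mult_right_mono) auto
      moreover have "\<bar>(t - s0) * v $ 3\<bar> \<le> 1 * \<bar>v $ 3\<bar>"
        unfolding abs_mult using gk(2) \<epsilon>(2) by (intro mult_right_mono) auto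
      moreover have "(g t - ?M) $ 3 = k0 s0 $ 3 + (t - s0) * v $ 3 - ?M $ 3" unfolding kt by simp
      moreover have "1 / 2 * K = 2 + \<bar>k0 s0 $ 3\<bar> + \<bar>v $ 3\<bar> + \<bar>?M $ 3\<bar> + \<bar>f $ 3\<bar>" by (simp add: K_def)
      moreover have "SS (g t) * (- K) = - (SS (g t) * K)" by simp
      ultimately have "(g t - ?M) $ 3 - UU (g t) * f $ 3 - SS (g t) * (- K) > 1"
        using SK by linarith
      then show ?thesis using gk by (simp add: UU_def SS_def detE E)
    qed
  qed (use D g0 k0 w(1) \<delta> tf tv in \<open>simp_all add: detE\<close>)
  have c_g0: "c (g0 t) = c (g0 t0)" if "\<bar>t - t0\<bar> \<le> w" for t using g0_near[OF that] by blast
  have c_k0: "c (k0 \<tau>) = c (k0 s0)" if "\<bar>\<tau> - s0\<bar> \<le> \<epsilon>" for \<tau> using k0_near[OF that] by blast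
  show ?thesis
  proof (intro exI[of _ D'] exI[of _ "finger_coloring c (c (g0 t0)) z"] conjI)
    show "diagram_of D' L" by (rule diagram_of_D'[OF L])
    show "point_coloring D' (finger_coloring c (c (g0 t0)) z)"
      using pos neg by (intro point_coloring_finger_coloring[OF col _ _ z, where p = "c (k0 s0)"] c_g0 c_k0) (simp_all only: detE)
    show "finger_coloring c (c (g0 t0)) z ` arc_points D' = insert z (c ` arc_points D)"
      by (rule image_finger_coloring) (rule c_g0)
    show "\<exists>G s H t. crossing D' G s H t \<and> finger_coloring c (c (g0 t0)) z (G s) = c (k0 s0) \<and>
       (\<forall>\<^sub>F \<tau> in at_left t. finger_coloring c (c (g0 t0)) z (H \<tau>) = c (g0 t0))"
      by (rule finger_over_point) (rule c_k0)
  qed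
qed

lemma linear_piece:
  fixes g :: "real \<Rightarrow> real^3"
  assumes ab: "a < b" and lin: "\<And>u. u \<in> {0..1} \<Longrightarrow> g (linepath a b u) = linepath (g a) (g b) u"
  obtains v where "\<And>r r'. r \<in> {a..b} \<Longrightarrow> r' \<in> {a..b} \<Longrightarrow> g r = g r' + (r - r') *\<^sub>R v"
proof -
  define v where "v = (1 / (b - a)) *\<^sub>R (g b - g a)"
  have base: "g r = g a + (r - a) *\<^sub>R v" if "r \<in> {a..b}" for r
  proof -
    define u where "u = (r - a) / (b - a)"
    have "u \<in> {0..1}" using that ab by (auto simp: u_def)
    moreover have "u * (b - a) = r - a" using ab by (simp add: u_def)
    then have "linepath a b u = r" by (simp add: linepath_def algebra_simps)
    ultimately have "g r = linepath (g a) (g b) u" using lin by metis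
    also have "\<dots> = g a + u *\<^sub>R (g b - g a)" by (simp add: linepath_def algebra_simps)
    also have "u *\<^sub>R (g b - g a) = (r - a) *\<^sub>R v" by (simp add: u_def v_def)
    finally show ?thesis .
  qed
  show ?thesis
  proof (rule that)
    fix r r' assume r: "r \<in> {a..b}" "r' \<in> {a..b}"
    show "g r = g r' + (r - r') *\<^sub>R v"
      unfolding base[OF r(1)] base[OF r(2)] by (simp add: algebra_simps)
  qed
qed

lemma linear_piece_derivative:
  fixes g :: "real \<Rightarrow> real^3"
  assumes ab: "a < b" and s: "s \<in> {a..b}"
    and lin: "\<And>r r'. r \<in> {a..b} \<Longrightarrow> r' \<in> {a..b} \<Longrightarrow> g r = g r' + (r - r') *\<^sub>R v"
    and der: "(g has_vector_derivative d) (at s)"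
  shows "d = v"
proof (rule vector_derivative_unique_within_closed_interval[OF ab])
  show "s \<in> cbox a b" using s by simp
  show "(g has_vector_derivative d) (at s within cbox a b)"
    using der by (rule has_vector_derivative_at_within)
  have "((\<lambda>r. g s + (r - s) *\<^sub>R v) has_vector_derivative v) (at s within cbox a b)"
    by (auto intro!: derivative_eq_intros)
  then show "(g has_vector_derivative v) (at s within cbox a b)"
  proof (rule has_vector_derivative_transform[rotated 2])
    show "s \<in> cbox a b" using s by simp
    show "g r = g s + (r - s) *\<^sub>R v" if "r \<in> cbox a b" for r
      by (rule lin[OF _ s]) (use that in simp)
  qed
qed

text \<open>The curve is linear on both sides of \<open>s\<close>, and differentiability makes the two velocities agree.\<close>

lemma polygonal_linear_near:
  fixes g :: "real \<Rightarrow> real^3"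
  assumes poly: "polygonal g" and s: "s \<in> {0<..<1}" and diff: "g differentiable at s"
  shows "\<forall>\<^sub>F r in nhds s. g r = g s + (r - s) *\<^sub>R vector_derivative g (at s)"
proof -
  let ?d = "vector_derivative g (at s)"
  have der: "(g has_vector_derivative ?d) (at s)" using diff by (simp add: vector_derivative_works)
  obtain B where B: "finite B" and lin: "\<And>a b u. 0 \<le> a \<Longrightarrow> a < b \<Longrightarrow> b \<le> 1 \<Longrightarrow> {a<..<b} \<inter> B = {} \<Longrightarrow>
      u \<in> {0..1} \<Longrightarrow> g (linepath a b u) = linepath (g a) (g b) u"
    using poly unfolding polygonal_def by blast
  have "open ({0<..<1} - (B - {s}))" using B by (intro open_Diff finite_imp_closed) auto
  moreover have "s \<in> {0<..<1} - (B - {s})" using s by simp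
  ultimately obtain e where e: "e > 0" "ball s e \<subseteq> {0<..<1} - (B - {s})" by (meson openE)
  define e' where "e' = e / 2"
  have e'_pos: "e' > 0" using e(1) by (simp add: e'_def)
  have "{s - e'..s + e'} \<subseteq> ball s e" using e(1) by (auto simp: e'_def dist_real_def)
  with e(2) have e'_sub: "{s - e'..s + e'} \<subseteq> {0<..<1} - (B - {s})" by (rule subset_trans[rotated])
  note e' = e'_pos e'_sub
  have one: "g r = g s + (r - s) *\<^sub>R ?d"
    if ab: "a < b" "{a..b} \<subseteq> {s - e'..s + e'}" "s \<in> {a..b}" "s \<notin> {a<..<b}" "r \<in> {a..b}" for a b r
  proof -
    have sub: "{a..b} \<subseteq> {0<..<1} - (B - {s})" using ab(2) e'(2) by (rule subset_trans)
    then have "a \<in> {0<..<1}" "b \<in> {0<..<1}" using ab(1) by (auto simp: subset_iff)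
    then have "0 \<le> a" "b \<le> 1" by simp_all
    moreover have "{a<..<b} \<inter> B = {}"
    proof -
      have "x \<notin> B" if "x \<in> {a<..<b}" for x
      proof -
        have "x \<in> {a..b}" "x \<noteq> s" using that ab(4) by auto
        then show ?thesis using sub by blast
      qed
      then show ?thesis by blast
    qed
    ultimately have dis: "{a<..<b} \<inter> B = {}" "0 \<le> a" "b \<le> 1" by blast+
    obtain v where v: "\<And>r r'. r \<in> {a..b} \<Longrightarrow> r' \<in> {a..b} \<Longrightarrow> g r = g r' + (r - r') *\<^sub>R v"
      using linear_piece[OF ab(1) lin[OF dis(2) ab(1) dis(3,1)]] by blast
    have "?d = v" by (rule linear_piece_derivative[OF ab(1,3) v der])
    then show ?thesis using v[OF ab(5,3)] by simp
  qed
  have "\<forall>\<^sub>F r in nhds s. r \<in> {s - e'<..<s + e'}" using e'(1) by (intro eventually_nhds_in_open) auto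
  then show ?thesis
  proof eventually_elim
    case (elim r)
    show ?case
    proof (cases "r \<ge> s")
      case True
      then show ?thesis using elim e'(1) by (intro one[of s "s + e'"]) auto
    next
      case False
      then show ?thesis using elim e'(1) by (intro one[of "s - e'" s]) auto
    qed
  qed
qed

text \<open>Next to a crossing, a point of the over strand and a point of the under strand are joined by
  a segment that misses the rest of the diagram. The over strand leaves the crossing on both sides
  of the under strand, so both senses of conjugation can be realized.\<close>

lemma finger_move_at_crossing:
  assumes L: "diagram_of D L" and col: "point_coloring D c" and cr: "crossing D g s h t"
    and left: "\<forall>\<^sub>F \<tau> in at_left t. c (h \<tau>) = r"
    and z: "z \<in> S3_colors"
    and conj: "r \<star> c (g s) = z \<star> r \<or>
      r \<star> z = c (g s) \<star> r"
  shows "\<exists>D1 c1. diagram_of D1 L \<and> point_coloring D1 c1 \<and>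
    c1 ` arc_points D1 = insert z (c ` arc_points D)"
proof -
  have D: "link_diagram D" using L by (simp add: diagram_of_def)
  note cd = crossingD[OF cr] and reg = link_diagramD(9)[OF D cr]
  define v where "v = vector_derivative g (at s)"
  define u where "u = vector_derivative h (at t)"
  have det: "plane_det v u \<noteq> 0" using reg unfolding crossing_det_eq v_def u_def by blast
  then have det': "plane_det u v \<noteq> 0" using plane_det_swap[of u v] by simp
  \<comment> \<open>The side of the under strand from which the finger comes.\<close>
  obtain \<sigma> :: real where \<sigma>: "\<sigma> = 1 \<or> \<sigma> = -1"
    "- \<sigma> * plane_det u v > 0 \<Longrightarrow> r \<star> c (g s) = z \<star> r"
    "- \<sigma> * plane_det u v < 0 \<Longrightarrow> r \<star> z = c (g s) \<star> r"
  proof (cases "r \<star> c (g s) = z \<star> r")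
    case True
    show ?thesis
      by (rule that[of "- sgn (plane_det u v)"]) (use True det' in \<open>auto simp: sgn_if split: if_splits\<close>)
  next
    case False
    then have "r \<star> z = c (g s) \<star> r" using conj by blast
    then show ?thesis
      by (intro that[of "sgn (plane_det u v)"]) (use det' in \<open>auto simp: sgn_if split: if_splits\<close>)
  qed
  have "\<forall>\<^sub>F x in nhds s. g x = g s + (x - s) *\<^sub>R v \<and> (g x \<in> arc_points D \<and> c (g x) = c (g s)) \<and> x \<in> {0<..<1}"
    unfolding v_def using link_diagramD(6)[OF D cd(1)] reg cd(1)
    by (intro eventually_conj polygonal_linear_near color_near[OF D col] over_point_in_arc_points[OF D cr]
          eventually_nhds_in_open) auto
  from eventually_nhds_interval[OF this] obtain e1 where e1: "e1 > 0"
    "\<And>x. \<bar>x - s\<bar> \<le> e1 \<Longrightarrow> g x = g s + (x - s) *\<^sub>R v \<and> (g x \<in> arc_points D \<and> c (g x) = c (g s)) \<and> x \<in> {0<..<1}"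
    by blast
  have "\<forall>\<^sub>F x in nhds t. h x = h t + (x - t) *\<^sub>R u \<and> x \<in> {0<..<1}"
    unfolding u_def using link_diagramD(6)[OF D cd(2)] reg
    by (intro eventually_conj polygonal_linear_near eventually_nhds_in_open) auto
  from eventually_nhds_interval[OF this] obtain e2 where e2: "e2 > 0"
    "\<And>x. \<bar>x - t\<bar> \<le> e2 \<Longrightarrow> h x = h t + (x - t) *\<^sub>R u \<and> x \<in> {0<..<1}"
    by blast
  obtain e3 where e3: "e3 < t" "\<And>x. e3 < x \<Longrightarrow> x < t \<Longrightarrow> c (h x) = r"
    using left unfolding eventually_at_left_field by blast
  define m where "m x = \<bar>x $ 1 - g s $ 1\<bar> + \<bar>x $ 2 - g s $ 2\<bar>" for x :: "real^3"
  have m: "continuous_on UNIV m" "m x \<ge> 0" for x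
    unfolding m_def by (intro continuous_intros) auto
  have only: "k = g \<and> y = s \<or> k = h \<and> y = t" if k: "k \<in> D" "y \<in> {0..1}" "m (k y) = 0" for k y
  proof -
    have pe: "plane_proj (k y) = plane_proj (g s)" using k(3) unfolding m_def plane_proj_eq_iff by auto
    have "k y = g s \<or> g s = h t \<or> k y = h t"
      using pe cd by (intro link_diagramD(8)[OF D] in_link_space k) auto
    moreover have "g s \<noteq> h t" using cd(6) by auto
    ultimately show ?thesis using link_diagram_param_unique[OF D k(1,2)] cd(1,2) reg by blast
  qed
  obtain \<eta> where \<eta>: "\<eta> > 0" "\<And>k y. k \<in> D \<Longrightarrow> y \<in> {0..1} \<Longrightarrow> m (k y) < \<eta> \<Longrightarrow>
      k = g \<and> \<bar>y - s\<bar> < e1 \<or> k = h \<and> \<bar>y - t\<bar> < e2"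
    using link_gap[OF D m only e1(1) e2(1)] by blast
  \<comment> \<open>The two points at parameter distance \<open>\<rho>\<close> from the crossing, and the segment between them,
    have distance at most \<open>\<rho> * N\<close> from it.\<close>
  define N where "N = \<bar>v $ 1\<bar> + \<bar>v $ 2\<bar> + \<bar>u $ 1\<bar> + \<bar>u $ 2\<bar>"
  obtain \<rho>0 where \<rho>0: "\<rho>0 > 0" "\<And>y. 0 < y \<Longrightarrow> y \<le> \<rho>0 \<Longrightarrow> y * \<bar>N\<bar> < \<eta>"
    using small_factor[OF \<eta>(1), of N] by blast
  define \<rho> where "\<rho> = min (min (e1 / 2) (e2 / 2)) (min ((t - e3) / 2) \<rho>0)"
  have \<rho>: "\<rho> > 0" "\<rho> < e1" "\<rho> < e2" "\<rho> < t - e3" "\<rho> \<le> \<rho>0"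
    using e1(1) e2(1) e3(1) \<rho>0(1) by (auto simp: \<rho>_def min_less_iff_disj)
  have \<rho>N: "\<rho> * N < \<eta>" using \<rho>0(2)[OF \<rho>(1,5)] by (simp add: N_def)
  define s1 where "s1 = s + \<sigma> * \<rho>"
  define t1 where "t1 = t - \<rho>"
  have s1: "\<bar>s1 - s\<bar> < e1" using \<rho> \<sigma>(1) by (auto simp: s1_def)
  have t1: "\<bar>t1 - t\<bar> < e2" using \<rho> by (simp add: t1_def)
  define e :: "real^3" where "e = - (\<rho> *\<^sub>R u) - (\<sigma> * \<rho>) *\<^sub>R v"
  have gs1: "g s1 = g s + (\<sigma> * \<rho>) *\<^sub>R v" using e1(2)[of s1] s1 by (simp add: s1_def)
  have ht1: "h t1 = h t - \<rho> *\<^sub>R u" using e2(2)[of t1] t1 by (simp add: t1_def)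
  have ce: "c (g s1) = c (g s)" "c (h t1) = r"
    using e1(2)[of s1] s1 e3(2)[of t1] \<rho> by (auto simp: t1_def)
  have det_v: "plane_det v e = - \<rho> * plane_det v u" by (simp add: e_def)
  define \<kappa> where "\<kappa> = - \<sigma> * plane_det u v"
  have det_u: "plane_det u e = \<rho> * \<kappa>" by (simp add: e_def \<kappa>_def)
  have \<kappa>: "\<kappa> \<noteq> 0" using det' \<sigma>(1) by (auto simp: \<kappa>_def)
  have "\<exists>D1 c1. diagram_of D1 L \<and> point_coloring D1 c1 \<and>
    c1 ` arc_points D1 = insert z (c ` arc_points D) \<and>
    (\<exists>G s H t. crossing D1 G s H t \<and> c1 (G s) = c (h t1) \<and>
       (\<forall>\<^sub>F \<tau> in at_left t. c1 (H \<tau>) = c (g s1)))"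
  proof (rule finger_move[OF L col cd(1) _ cd(2) _ _ _ _ _ _ _ z, where f = v and v = u and e = e])
    show "s1 \<in> {0<..<1}" "t1 \<in> {0<..<1}" using e1(2)[of s1] s1 e2(2)[of t1] t1 by auto
    have "\<forall>\<^sub>F x in nhds s1. x \<in> {s - e1<..<s + e1}"
      using s1 by (intro eventually_nhds_in_open) (auto simp: abs_less_iff)
    then show "\<forall>\<^sub>F x in nhds s1. g x = g s1 + (x - s1) *\<^sub>R v"
    proof eventually_elim
      case (elim x)
      then have "\<bar>x - s\<bar> \<le> e1" by auto
      then have "g x = g s + (x - s) *\<^sub>R v" using e1(2) by blast
      then show ?case unfolding gs1 by (simp add: s1_def algebra_simps)
    qed
    have "\<forall>\<^sub>F x in nhds t1. x \<in> {t - e2<..<t + e2}"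
      using t1 by (intro eventually_nhds_in_open) (auto simp: abs_less_iff)
    then show "\<forall>\<^sub>F x in nhds t1. h x = h t1 + (x - t1) *\<^sub>R u"
    proof eventually_elim
      case (elim x)
      then have "\<bar>x - t\<bar> \<le> e2" by auto
      then have "h x = h t + (x - t) *\<^sub>R u" using e2(2) by blast
      then show ?case unfolding ht1 by (simp add: t1_def algebra_simps)
    qed
    show "plane_proj (h t1) = plane_proj (g s1 + e)"
      using cd(5) unfolding gs1 ht1 plane_proj_eq_iff e_def by simp
    show "plane_det v e \<noteq> 0" "plane_det u e \<noteq> 0" unfolding det_v det_u using det \<kappa> \<rho>(1) by auto
    show "k = g \<and> y = s1 \<or> k = h \<and> y = t1"
      if k: "k \<in> D" "y \<in> {0..1}" "x \<in> {0..1}" "plane_proj (k y) = plane_proj (g s1 + x *\<^sub>R e)" for k y x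
    proof -
      define \<alpha> where "\<alpha> = \<sigma> * \<rho> * (1 - x)"
      define \<beta> where "\<beta> = - (\<rho> * x)"
      have ky: "k y $ i = g s $ i + \<alpha> * v $ i + \<beta> * u $ i" if "i = 1 \<or> i = 2" for i
        using k(4) that unfolding plane_proj_eq_iff gs1 e_def \<alpha>_def \<beta>_def
        by (auto simp: algebra_simps)
      have \<alpha>\<beta>: "\<bar>\<alpha>\<bar> \<le> \<rho>" "\<bar>\<beta>\<bar> \<le> \<rho>"
        using \<sigma>(1) \<rho>(1) k(3) by (auto simp: \<alpha>_def \<beta>_def abs_mult mult_left_le)
      have le: "\<bar>\<alpha> * v $ i\<bar> \<le> \<rho> * \<bar>v $ i\<bar>" "\<bar>\<beta> * u $ i\<bar> \<le> \<rho> * \<bar>u $ i\<bar>" for i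
        unfolding abs_mult using \<alpha>\<beta> by (intro mult_right_mono; simp)+
      have "m (k y) = \<bar>\<alpha> * v $ 1 + \<beta> * u $ 1\<bar> + \<bar>\<alpha> * v $ 2 + \<beta> * u $ 2\<bar>"
        unfolding m_def by (simp add: ky)
      also have "\<dots> \<le> \<rho> * \<bar>v $ 1\<bar> + \<rho> * \<bar>u $ 1\<bar> + (\<rho> * \<bar>v $ 2\<bar> + \<rho> * \<bar>u $ 2\<bar>)"
        by (intro add_mono order_trans[OF abs_triangle_ineq] le)
      also have "\<dots> = \<rho> * N" by (simp add: N_def algebra_simps)
      finally have "m (k y) \<le> \<rho> * N" .
      then have "m (k y) < \<eta>" using \<rho>N by simp
      from \<eta>(2)[OF k(1,2) this] show ?thesis
      proof (elim disjE conjE)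
        assume 1: "k = g" "\<bar>y - s\<bar> < e1"
        then have "k y = g s + (y - s) *\<^sub>R v" using e1(2)[of y] by simp
        then have kc: "k y $ i = g s $ i + (y - s) * v $ i" for i by simp
        have eq: "(y - s - \<alpha>) * v $ i = \<beta> * u $ i" if "i = 1 \<or> i = 2" for i
          using ky[OF that] kc[of i] by (simp add: left_diff_distrib)
        have "(y - s - \<alpha>) * plane_det v u = 0" "\<beta> * plane_det v u = 0"
          using eq[of 1] eq[of 2] unfolding plane_det_def by (simp_all add: right_diff_distrib) algebra+
        then have "y - s = \<alpha>" "\<beta> = 0" using det by auto
        then have "x = 0" "y - s = \<sigma> * \<rho>" using \<rho>(1) by (auto simp: \<beta>_def \<alpha>_def)
        then show ?thesis using 1(1) by (simp add: s1_def)
      next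
        assume 2: "k = h" "\<bar>y - t\<bar> < e2"
        then have "k y = h t + (y - t) *\<^sub>R u" using e2(2)[of y] by simp
        then have kc: "k y $ i = h t $ i + (y - t) * u $ i" for i by simp
        have eq: "(y - t - \<beta>) * u $ i = \<alpha> * v $ i" if "i = 1 \<or> i = 2" for i
        proof -
          have "g s $ i = h t $ i" using cd(5) that by (auto simp: plane_proj_eq_iff)
          then show ?thesis using ky[OF that] kc[of i] by (simp add: left_diff_distrib)
        qed
        have "(y - t - \<beta>) * plane_det v u = 0" "\<alpha> * plane_det v u = 0"
          using eq[of 1] eq[of 2] unfolding plane_det_def by (simp_all add: right_diff_distrib) algebra+
        then have "y - t = \<beta>" "\<alpha> = 0" using det by auto
        then have "x = 1" "y - t = - \<rho>" using \<rho>(1) \<sigma>(1) by (auto simp: \<beta>_def \<alpha>_def)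
        then show ?thesis using 2(1) by (simp add: t1_def)
      qed
    qed
    show "c (h t1) \<star> c (g s1) = z \<star> c (h t1)" if "plane_det u e > 0"
      using that \<sigma>(2) \<rho>(1) unfolding det_u ce \<kappa>_def[symmetric] by (simp add: zero_less_mult_iff)
    show "c (h t1) \<star> z = c (g s1) \<star> c (h t1)" if "plane_det u e < 0"
      using that \<sigma>(3) \<rho>(1) unfolding det_u ce \<kappa>_def[symmetric] by (simp add: mult_less_0_iff)
  qed
  then show ?thesis by blast
qed

section \<open>Generic segments\<close>

abbreviation dir :: "(real \<Rightarrow> real^3) \<Rightarrow> real \<Rightarrow> real^3" where
  "dir g t \<equiv> vector_derivative g (at t)"

lemma has_derivative_of_linear_near:
  fixes g :: "real \<Rightarrow> real^3"
  assumes "a < s" "s < b" "\<And>r r'. r \<in> {a..b} \<Longrightarrow> r' \<in> {a..b} \<Longrightarrow> g r = g r' + (r - r') *\<^sub>R v"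
  shows "dir g s = v"
proof (rule vector_derivative_at, rule has_vector_derivative_transform_within_open)
  show "((\<lambda>r. g s + (r - s) *\<^sub>R v) has_vector_derivative v) (at s)"
    by (auto intro!: derivative_eq_intros)
  show "open {a<..<b}" "s \<in> {a<..<b}" using assms(1,2) by auto
  show "g s + (r - s) *\<^sub>R v = g r" if "r \<in> {a<..<b}" for r
    by (rule assms(3)[symmetric]) (use that assms(1,2) in auto)
qed

text \<open>The finite set \<open>B\<close> cuts the parameter interval into cells, and \<open>B \<inter> {..t}\<close> identifies the cell of
  \<open>t\<close>. On a cell the curve is linear.\<close>

definition cell_division :: "(real \<Rightarrow> real^3) \<Rightarrow> real set \<Rightarrow> bool" where
  "cell_division g B \<longleftrightarrow> finite B \<and> {0, 1} \<subseteq> B \<and>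
    (\<forall>t\<in>{0..1} - B. \<forall>t'\<in>{0..1} - B. B \<inter> {..t} = B \<inter> {..t'} \<longrightarrow>
       g t' = g t + (t' - t) *\<^sub>R dir g t \<and> dir g t' = dir g t)"

lemma polygonal_cell_division:
  fixes g :: "real \<Rightarrow> real^3"
  assumes "polygonal g" and "finite C"
  shows "\<exists>B. cell_division g B \<and> C \<subseteq> B"
proof -
  obtain B0 where B0: "finite B0" and lin: "\<And>a b u. 0 \<le> a \<Longrightarrow> a < b \<Longrightarrow> b \<le> 1 \<Longrightarrow> {a<..<b} \<inter> B0 = {} \<Longrightarrow>
      u \<in> {0..1} \<Longrightarrow> g (linepath a b u) = linepath (g a) (g b) u"
    using assms(1) unfolding polygonal_def by blast
  define B where "B = B0 \<union> {0, 1} \<union> C"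
  have B: "finite B" "0 \<in> B" "1 \<in> B" using B0 assms(2) by (auto simp: B_def)
  have near: "\<exists>e>0. {t - e<..<t + e} \<inter> B = {}" if "t \<notin> B" for t
  proof -
    have "open (- B)" using finite_imp_closed[OF B(1)] by blast
    then obtain e where "e > 0" "ball t e \<subseteq> - B" using \<open>t \<notin> B\<close> by (meson ComplI openE)
    moreover have "{t - e<..<t + e} = ball t e" by (auto simp: dist_real_def)
    ultimately show ?thesis by blast
  qed
  have "g t' = g t + (t' - t) *\<^sub>R dir g t \<and> dir g t' = dir g t"
    if t: "t \<in> {0..1} - B" and t': "t' \<in> {0..1} - B" and cell: "B \<inter> {..t} = B \<inter> {..t'}" for t t'
  proof -
    obtain e1 where e1: "e1 > 0" "{t - e1<..<t + e1} \<inter> B = {}" using near t by blast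
    obtain e2 where e2: "e2 > 0" "{t' - e2<..<t' + e2} \<inter> B = {}" using near t' by blast
    define e where "e = min e1 e2 / 2"
    have e: "e > 0" "e < e1" "e < e2" using e1(1) e2(1) by (auto simp: e_def min_def)
    define a b where "a = min t t' - e" and "b = max t t' + e"
    have out: "x \<notin> B" if "x \<in> {a..b}" for x
    proof
      assume x: "x \<in> B"
      then have "\<not> (t - e1 < x \<and> x < t + e1)" "\<not> (t' - e2 < x \<and> x < t' + e2)" using e1(2) e2(2) by auto
      moreover have "x \<le> t \<longleftrightarrow> x \<le> t'" using cell x by blast
      ultimately show False using that e unfolding a_def b_def by (auto simp: min_def max_def split: if_splits)
    qed
    have ab: "a < b" using e(1) by (simp add: a_def b_def min_def max_def)
    have "a \<le> t" "t \<le> b" "a \<le> t'" "t' \<le> b" using e(1) by (auto simp: a_def b_def)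
    moreover have "0 \<notin> {a..b}" "1 \<notin> {a..b}" using out B by blast+
    ultimately have ab01: "0 \<le> a" "b \<le> 1" using t by auto
    have "{a<..<b} \<inter> B0 = {}" using out by (auto simp: B_def)
    then obtain v where v: "\<And>r r'. r \<in> {a..b} \<Longrightarrow> r' \<in> {a..b} \<Longrightarrow> g r = g r' + (r - r') *\<^sub>R v"
      using linear_piece[OF ab lin[OF ab01(1) ab ab01(2)]] by blast
    have s: "a < t" "t < b" "a < t'" "t' < b" using e(1) by (auto simp: a_def b_def)
    have d: "dir g t = v" "dir g t' = v"
      using has_derivative_of_linear_near[OF s(1,2) v] has_derivative_of_linear_near[OF s(3,4) v] by blast+
    have "g t' = g t + (t' - t) *\<^sub>R v" by (rule v) (use s in auto)
    then show ?thesis unfolding d by blast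
  qed
  moreover have "{0, 1} \<subseteq> B" "C \<subseteq> B" by (auto simp: B_def)
  ultimately show ?thesis unfolding cell_division_def using B(1) by blast
qed

definition cells :: "(real \<Rightarrow> real^3) set \<Rightarrow> ((real \<Rightarrow> real^3) \<Rightarrow> real set) \<Rightarrow> bool" where
  "cells D B \<longleftrightarrow> (\<forall>g\<in>D. cell_division g (B g)) \<and>
   (\<forall>g s h t. crossing D g s h t \<longrightarrow> s \<in> B g \<and> t \<in> B h)"

lemma cells_exist:
  assumes D: "link_diagram D" shows "\<exists>B. cells D B"
proof -
  define C where "C g = {t. \<exists>h s. crossing D g t h s \<or> crossing D h s g t}" for g
  let ?N = "{(g, s, h, t). crossing D g s h t}"
  have "C g \<subseteq> (\<lambda>(g, s, h, t). s) ` ?N \<union> (\<lambda>(g, s, h, t). t) ` ?N" for g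
    unfolding C_def by force
  then have C: "finite (C g)" for g
    using link_diagramD(7)[OF D] by (meson finite_Un finite_imageI finite_subset)
  have "\<forall>g\<in>D. \<exists>B. cell_division g B \<and> C g \<subseteq> B"
    using polygonal_cell_division[OF link_diagramD(6)[OF D] C] by blast
  then obtain B where B: "\<forall>g\<in>D. cell_division g (B g) \<and> C g \<subseteq> B g"
    using bchoice[of D "\<lambda>g B. cell_division g B \<and> C g \<subseteq> B"] by blast
  have "s \<in> B g \<and> t \<in> B h" if "crossing D g s h t" for g s h t
  proof -
    have "s \<in> C g" "t \<in> C h" using that unfolding C_def by blast+
    then show ?thesis using B crossingD(1,2)[OF that] by blast
  qed
  then show ?thesis using B unfolding cells_def by blast
qed

lemma finite_image_factor:
  assumes "finite (F ` A)" "\<And>x y. x \<in> A \<Longrightarrow> y \<in> A \<Longrightarrow> F x = F y \<Longrightarrow> G x = G y"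
  shows "finite (G ` A)"
proof (rule finite_subset)
  show "G ` A \<subseteq> (\<lambda>z. G (inv_into A F z)) ` (F ` A)"
  proof (rule image_subsetI)
    fix x assume x: "x \<in> A"
    have "inv_into A F (F x) \<in> A" "F (inv_into A F (F x)) = F x"
      using x by (auto intro: inv_into_into f_inv_into_f)
    then have "G x = G (inv_into A F (F x))" using assms(2) x by metis
    then show "G x \<in> (\<lambda>z. G (inv_into A F z)) ` (F ` A)" using x by blast
  qed
  show "finite ((\<lambda>z. G (inv_into A F z)) ` (F ` A))" using assms(1) by simp
qed

lemma avoid_affine_roots:
  fixes F :: "(real \<times> real) set"
  assumes "finite F" "\<And>A C. (A, C) \<in> F \<Longrightarrow> A \<noteq> 0 \<or> C \<noteq> 0" "e > 0"
  obtains x where "0 < x" "x < e" "\<And>A C. (A, C) \<in> F \<Longrightarrow> A + x * C \<noteq> 0"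
proof -
  have "infinite ({0<..<e} - (\<lambda>(A, C). - A / C) ` F)"
    using assms(1,3) by (intro Diff_infinite_finite) auto
  then obtain x where x: "x \<in> {0<..<e}" "x \<notin> (\<lambda>(A, C). - A / C) ` F"
    by (metis Diff_iff finite.emptyI all_not_in_conv)
  have "A + x * C \<noteq> 0" if "(A, C) \<in> F" for A C
  proof
    assume 0: "A + x * C = 0"
    then have "C \<noteq> 0" using assms(2)[OF that] by auto
    then have "x = - A / C" using 0 by (simp add: field_simps eq_neg_iff_add_eq_0)
    then show False using x(2) that by force
  qed
  then show ?thesis using that x(1) by auto
qed

lemma plane_det_basis:
  assumes "plane_det a u = 0" "plane_det a v = 0" "plane_det u v \<noteq> 0"
  shows "a $ 1 = 0" "a $ 2 = 0"
proof -
  have "a $ 1 * plane_det u v = plane_det a v * u $ 1 - plane_det a u * v $ 1"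
    "a $ 2 * plane_det u v = plane_det a v * u $ 2 - plane_det a u * v $ 2"
    by (simp_all add: plane_det_def algebra_simps)
  then show "a $ 1 = 0" "a $ 2 = 0" using assms by auto
qed

lemma plane_parallel:
  assumes "plane_det a f = 0" "plane_det b f = 0" "f $ 1 \<noteq> 0 \<or> f $ 2 \<noteq> 0"
  shows "plane_det a b = 0"
proof -
  have "f $ 1 * plane_det a b = b $ 1 * plane_det a f - a $ 1 * plane_det b f"
    "f $ 2 * plane_det a b = b $ 2 * plane_det a f - a $ 2 * plane_det b f"
    by (simp_all add: plane_det_def algebra_simps)
  then show ?thesis using assms by auto
qed

locale celled =
  fixes D :: "(real \<Rightarrow> real^3) set" and B :: "(real \<Rightarrow> real^3) \<Rightarrow> real set"
  assumes diagram: "link_diagram D" and cells: "cells D B"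
begin

text \<open>Regular parameters belong neither to a vertex nor to a crossing.\<close>

definition regular :: "(real \<Rightarrow> real^3) \<Rightarrow> real \<Rightarrow> bool" where
  "regular g t \<longleftrightarrow> g \<in> D \<and> t \<in> {0..1} - B g"

definition singular_points :: "(real^3) set" where
  "singular_points = {g t |g t. g \<in> D \<and> t \<in> B g \<inter> {0..1}}"

definition dirs :: "(real^3) set" where
  "dirs = {dir g t |g t. regular g t}"

lemma cut_points: "g \<in> D \<Longrightarrow> finite (B g)" "g \<in> D \<Longrightarrow> 0 \<in> B g" "g \<in> D \<Longrightarrow> 1 \<in> B g"
  using cells unfolding cells_def cell_division_def by auto

lemma regularD:
  assumes "regular g t" shows "g \<in> D" "t \<in> {0<..<1}" "t \<notin> B g" "t \<in> {0..1}"
proof -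
  show *: "g \<in> D" "t \<notin> B g" "t \<in> {0..1}" using assms by (auto simp: regular_def)
  then have "t \<noteq> 0" "t \<noteq> 1" using cut_points by auto
  with * show "t \<in> {0<..<1}" by auto
qed

lemma same_cell:
  assumes "regular g t" "regular g t'" "B g \<inter> {..t} = B g \<inter> {..t'}"
  shows "g t' = g t + (t' - t) *\<^sub>R dir g t" "dir g t' = dir g t"
proof -
  have "cell_division g (B g)" using cells assms(1) unfolding cells_def regular_def by blast
  then have "g t' = g t + (t' - t) *\<^sub>R dir g t \<and> dir g t' = dir g t"
    using assms unfolding cell_division_def regular_def by blast
  then show "g t' = g t + (t' - t) *\<^sub>R dir g t" "dir g t' = dir g t" by (rule conjunct1, rule conjunct2)
qed

lemma regular_near:
  assumes "regular g t"
  shows "\<forall>\<^sub>F r in nhds t. regular g r \<and> g r = g t + (r - t) *\<^sub>R dir g t"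
proof -
  note g = regularD[OF assms]
  have "open ({0<..<1} - B g)" by (intro open_Diff finite_imp_closed cut_points g) auto
  moreover have "t \<in> {0<..<1} - B g" using g by simp
  ultimately obtain e where e: "e > 0" "ball t e \<subseteq> {0<..<1} - B g" by (meson openE)
  have "\<forall>\<^sub>F r in nhds t. r \<in> ball t e" using e(1) by (intro eventually_nhds_in_open) auto
  then show ?thesis
  proof eventually_elim
    case (elim r)
    then have r: "regular g r" using e(2) g(1) by (force simp: regular_def)
    have "x \<le> t \<longleftrightarrow> x \<le> r" if "x \<in> B g" for x
    proof -
      have "x \<notin> ball t e" using that e(2) by blast
      then show ?thesis using elim by (auto simp: dist_real_def)
    qed
    then have "B g \<inter> {..t} = B g \<inter> {..r}" by auto
    then show ?case using same_cell(1)[OF assms r] r by blast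
  qed
qed

lemma regular_unique:
  assumes regular: "regular g t" and h: "h \<in> D" "s \<in> {0..1}" and eq: "plane_proj (h s) = plane_proj (g t)"
  shows "h = g \<and> s = t"
proof -
  note g = regularD[OF regular]
  have "h s = g t"
  proof (rule ccontr)
    assume "h s \<noteq> g t"
    then have "h s $ 3 \<noteq> g t $ 3" using eq by (auto simp: vec3_eq_iff plane_proj_eq_iff)
    then have "crossing D h s g t \<or> crossing D g t h s"
      using g h eq by (auto simp: crossing_def)
    then have "t \<in> B g" using cells unfolding cells_def by blast
    then show False using g(3) by blast
  qed
  then show ?thesis using link_diagram_param_unique[OF diagram h g(1,2)] by blast
qed

lemma regular_arc_point:
  assumes "regular g t" shows "g t \<in> arc_points D"
proof -
  note g = regularD[OF assms]
  have "g t \<noteq> h s" if "crossing D k r h s" for k r h s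
  proof
    assume "g t = h s"
    then have "h = g \<and> s = t" using crossingD[OF that] by (intro regular_unique[OF assms]) auto
    then show False using that cells g(3) unfolding cells_def by blast
  qed
  then have "g t \<notin> under_points D" unfolding under_points_def by blast
  then show ?thesis using in_link_space[OF g(1,4)] by (simp add: arc_points_def)
qed

lemma dir_nonzero:
  assumes "regular g t" shows "dir g t $ 1 \<noteq> 0 \<or> dir g t $ 2 \<noteq> 0"
proof (rule ccontr)
  assume 0: "\<not> ?thesis"
  obtain e where e: "e > 0" "\<And>r. \<bar>r - t\<bar> \<le> e \<Longrightarrow> regular g r \<and> g r = g t + (r - t) *\<^sub>R dir g t"
    using eventually_nhds_interval[OF regular_near[OF assms]] by blast
  have *: "regular g (t + e) \<and> g (t + e) = g t + (t + e - t) *\<^sub>R dir g t" using e(1) by (intro e(2)) simp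
  then have "plane_proj (g (t + e)) = plane_proj (g t)" using 0 by (auto simp: plane_proj_eq_iff)
  then have "t + e = t" using regular_unique[OF assms] regularD[of g "t + e"] * by blast
  then show False using e(1) by simp
qed

lemma finite_singular_points: "finite singular_points"
proof -
  have "singular_points = (\<Union>g\<in>D. g ` (B g \<inter> {0..1}))" unfolding singular_points_def by blast
  then show ?thesis using link_diagramD(1)[OF diagram] cut_points(1) by simp
qed

lemma finite_dirs: "finite dirs"
proof -
  have fin: "finite (dir g ` ({0..1} - B g))" if g: "g \<in> D" for g
  proof (rule finite_image_factor[where F = "\<lambda>t. B g \<inter> {..t}"])
    show "finite ((\<lambda>t. B g \<inter> {..t}) ` ({0..1} - B g))"
      by (rule finite_subset[of _ "Pow (B g)"]) (use cut_points(1)[OF g] in auto)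
    show "dir g x = dir g y" if "x \<in> {0..1} - B g" "y \<in> {0..1} - B g" "B g \<inter> {..x} = B g \<inter> {..y}" for x y
      using same_cell(2)[of g x y] that g by (simp add: regular_def)
  qed
  have "dirs = (\<Union>g\<in>D. dir g ` ({0..1} - B g))" unfolding dirs_def regular_def by blast
  then show ?thesis using link_diagramD(1)[OF diagram] fin by simp
qed

text \<open>The line through \<open>x\<close> and \<open>y\<close> avoids all vertices and crossings, and it is parallel to no edge.\<close>

definition generic :: "real^3 \<Rightarrow> real^3 \<Rightarrow> bool" where
  "generic x y \<longleftrightarrow> (\<forall>p\<in>singular_points. plane_det (p - x) (y - x) \<noteq> 0) \<and> (\<forall>d\<in>dirs. plane_det d (y - x) \<noteq> 0)"

text \<open>One end stays fixed while the other one moves along its edge, whose line does not contain the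
  fixed end. Each of the finitely many conditions of genericity says that an affine function of the
  moving parameter does not vanish; the function is not identically 0, so it has at most one zero.\<close>

lemma generic_segment_near:
  assumes 1: "regular g1 t1" and 2: "regular g2 t2" and nc: "plane_det (g1 t1 - g2 t2) (dir g2 t2) \<noteq> 0"
    and ev: "\<forall>\<^sub>F t in nhds t2. P t"
  obtains t where "regular g2 t" "P t" "generic (g1 t1) (g2 t)"
proof -
  let ?x = "g1 t1" and ?y = "g2 t2" and ?f = "dir g2 t2"
  have "\<forall>\<^sub>F r in nhds t2. P r \<and> regular g2 r \<and> g2 r = ?y + (r - t2) *\<^sub>R ?f"
    using ev regular_near[OF 2] by eventually_elim simp
  from eventually_nhds_interval[OF this] obtain e where e: "e > 0"
    "\<And>r. \<bar>r - t2\<bar> \<le> e \<Longrightarrow> P r \<and> regular g2 r \<and> g2 r = ?y + (r - t2) *\<^sub>R ?f" by blast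
  let ?F = "(\<lambda>p. (plane_det (p - ?x) (?y - ?x), plane_det (p - ?x) ?f)) ` singular_points
    \<union> (\<lambda>d. (plane_det d (?y - ?x), plane_det d ?f)) ` dirs"
  have ind: "plane_det (?y - ?x) ?f \<noteq> 0" using nc by (auto simp: algebra_simps)
  have ne: "A \<noteq> 0 \<or> C \<noteq> 0" if AC: "(A, C) \<in> ?F" for A C
  proof (rule ccontr)
    assume "\<not> ?thesis"
    then have 0: "A = 0" "C = 0" by auto
    from AC show False
    proof
      assume "(A, C) \<in> (\<lambda>p. (plane_det (p - ?x) (?y - ?x), plane_det (p - ?x) ?f)) ` singular_points"
      then obtain p where p: "p \<in> singular_points" "plane_det (p - ?x) (?y - ?x) = 0" "plane_det (p - ?x) ?f = 0"
        using 0 by blast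
      obtain g t where g: "g \<in> D" "t \<in> B g" "t \<in> {0..1}" "p = g t" using p(1) unfolding singular_points_def by blast
      have "plane_proj (g t) = plane_proj ?x"
        using plane_det_basis[OF p(2,3) ind] g(4) by (simp add: plane_proj_eq_iff)
      then have "g = g1 \<and> t = t1" by (rule regular_unique[OF 1 g(1,3)])
      then show False using g(2) regularD(3)[OF 1] by blast
    next
      assume "(A, C) \<in> (\<lambda>d. (plane_det d (?y - ?x), plane_det d ?f)) ` dirs"
      then obtain d where d: "d \<in> dirs" "plane_det d (?y - ?x) = 0" "plane_det d ?f = 0"
        using 0 by blast
      then show False using plane_det_basis[OF d(2,3) ind] dir_nonzero unfolding dirs_def by blast
    qed
  qed
  have fin: "finite ?F" using finite_singular_points finite_dirs by simp
  obtain r where r: "0 < r" "r < e" "\<And>A C. (A, C) \<in> ?F \<Longrightarrow> A + r * C \<noteq> 0"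
    using avoid_affine_roots[OF fin ne e(1)] by blast
  have t: "P (t2 + r) \<and> regular g2 (t2 + r) \<and> g2 (t2 + r) = ?y + (t2 + r - t2) *\<^sub>R ?f"
    by (rule e(2)) (use r in simp)
  have diff: "plane_det w (g2 (t2 + r) - ?x) = plane_det w (?y - ?x) + r * plane_det w ?f" for w
    using t by simp
  have "generic ?x (g2 (t2 + r))" unfolding generic_def diff
  proof (intro conjI ballI)
    show "plane_det (p - ?x) (?y - ?x) + r * plane_det (p - ?x) ?f \<noteq> 0" if "p \<in> singular_points" for p
      by (rule r(3)) (use that in blast)
    show "plane_det d (?y - ?x) + r * plane_det d ?f \<noteq> 0" if "d \<in> dirs" for d
      by (rule r(3)) (use that in blast)
  qed
  then show ?thesis using that t by blast
qed

definition clean_segment :: "(real \<Rightarrow> real^3) \<Rightarrow> real \<Rightarrow> (real \<Rightarrow> real^3) \<Rightarrow> real \<Rightarrow> bool" where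
  "clean_segment g t h s \<longleftrightarrow> regular g t \<and> regular h s \<and>
     plane_det (dir g t) (h s - g t) \<noteq> 0 \<and> plane_det (dir h s) (h s - g t) \<noteq> 0 \<and>
     (\<forall>k\<in>D. \<forall>u\<in>{0..1}. \<forall>x\<in>{0..1}. plane_proj (k u) = plane_proj (g t + x *\<^sub>R (h s - g t)) \<longrightarrow>
        k = g \<and> u = t \<or> k = h \<and> u = s)"

text \<open>A generic segment meets the diagram in finitely many points. Between two consecutive ones with
  different values of \<open>\<phi>\<close> it is clean.\<close>

lemma clean_part_of_generic_segment:
  assumes 1: "regular g1 t1" and 2: "regular g2 t2" and gen: "generic (g1 t1) (g2 t2)"
    and \<phi>: "\<phi> (g1 t1) \<noteq> \<phi> (g2 t2)"
  obtains g t h s where "clean_segment g t h s" "\<phi> (g t)" "\<not> \<phi> (h s)"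
proof -
  let ?x = "g1 t1"
  define e where "e = g2 t2 - ?x"
  have singular: "p \<in> singular_points \<Longrightarrow> plane_det (p - ?x) e \<noteq> 0" and tr: "regular k u \<Longrightarrow> plane_det (dir k u) e \<noteq> 0" for p k u
    using gen unfolding generic_def e_def dirs_def by blast+
  have e0: "e $ 1 \<noteq> 0 \<or> e $ 2 \<noteq> 0" using tr[OF 1] by (auto simp: plane_det_def)
  have r_eq: "r = r'" if "plane_proj (?x + r *\<^sub>R e) = plane_proj (?x + r' *\<^sub>R e)" for r r'
    using that e0 by (auto simp: plane_proj_eq_iff)
  define X where "X = {r\<in>{0..1}. \<exists>k u. k \<in> D \<and> u \<in> {0..1} \<and> plane_proj (k u) = plane_proj (?x + r *\<^sub>R e)}"
  have regular_on: "regular k u" if "k \<in> D" "u \<in> {0..1}" "plane_proj (k u) = plane_proj (?x + r *\<^sub>R e)" for k u r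
  proof (rule ccontr)
    assume "\<not> regular k u"
    then have "k u \<in> singular_points" using that unfolding regular_def singular_points_def by blast
    moreover have "plane_det (k u - ?x) e = 0"
      using that(3) by (simp add: plane_det_def plane_proj_eq_iff algebra_simps)
    ultimately show False using singular by blast
  qed
  have "\<forall>r\<in>X. \<exists>ku. fst ku \<in> D \<and> snd ku \<in> {0..1} \<and> plane_proj (fst ku (snd ku)) = plane_proj (?x + r *\<^sub>R e)"
    unfolding X_def by force
  then obtain KU where KU: "\<And>r. r \<in> X \<Longrightarrow> fst (KU r) \<in> D \<and> snd (KU r) \<in> {0..1} \<and>
      plane_proj (fst (KU r) (snd (KU r))) = plane_proj (?x + r *\<^sub>R e)"
    using bchoice[of X] by meson
  define k u where "k r = fst (KU r)" and "u r = snd (KU r)" for r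
  have ku: "k r \<in> D" "u r \<in> {0..1}" "plane_proj (k r (u r)) = plane_proj (?x + r *\<^sub>R e)" if "r \<in> X" for r
    using KU[OF that] unfolding k_def u_def by blast+
  have kregular: "regular (k r) (u r)" if "r \<in> X" for r using regular_on ku[OF that] by blast
  have uniq: "h = k r \<and> s = u r" if "r \<in> X" "h \<in> D" "s \<in> {0..1}" "plane_proj (h s) = plane_proj (?x + r *\<^sub>R e)" for r h s
    using regular_unique[OF kregular[OF that(1)] that(2,3)] that(4) ku(3)[OF that(1)] by simp
  have "finite X"
  proof (rule inj_on_finite[where f = "\<lambda>r. (k r, B (k r) \<inter> {..u r})"])
    show "finite (SIGMA g:D. Pow (B g))" using link_diagramD(1)[OF diagram] cut_points(1) by simp
    show "(\<lambda>r. (k r, B (k r) \<inter> {..u r})) ` X \<subseteq> (SIGMA g:D. Pow (B g))"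
      by (intro image_subsetI SigmaI ku(1)) auto
    show "inj_on (\<lambda>r. (k r, B (k r) \<inter> {..u r})) X"
    proof (rule inj_onI)
      fix r r' assume r: "r \<in> X" "r' \<in> X" and eq: "(k r, B (k r) \<inter> {..u r}) = (k r', B (k r') \<inter> {..u r'})"
      have kk: "k r' = k r" and cell': "B (k r) \<inter> {..u r} = B (k r') \<inter> {..u r'}"
        using eq by (metis prod.inject)+
      note cell = cell'[unfolded kk]
      have "k r (u r') = k r (u r) + (u r' - u r) *\<^sub>R dir (k r) (u r)"
        by (rule same_cell(1)[OF kregular[OF r(1)] kregular[OF r(2), unfolded kk] cell])
      then have "plane_det (k r (u r') - k r (u r)) e = (u r' - u r) * plane_det (dir (k r) (u r)) e"
        by simp
      moreover have "plane_det (k r (u r') - k r (u r)) e = 0"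
        using ku(3)[OF r(1)] ku(3)[OF r(2)] kk by (simp add: plane_det_def plane_proj_eq_iff algebra_simps)
      ultimately have "u r' = u r" using tr[OF kregular[OF r(1)]] by simp
      then show "r = r'" using ku(3)[OF r(1)] ku(3)[OF r(2)] kk by (intro r_eq) simp
    qed
  qed
  have XI: "r \<in> X" if "r \<in> {0..1}" "h \<in> D" "s \<in> {0..1}" "plane_proj (h s) = plane_proj (?x + r *\<^sub>R e)" for r h s
    using that unfolding X_def by blast
  have 0: "0 \<in> X" by (rule XI[OF _ regularD(1,4)[OF 1]]) simp_all
  have e1: "?x + 1 *\<^sub>R e = g2 t2" by (simp add: e_def)
  have "1 \<in> X" by (rule XI[OF _ regularD(1,4)[OF 2]]) (simp_all only: e1, simp)
  define \<psi> where "\<psi> r = \<phi> (k r (u r))" for r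
  have "g1 = k 0 \<and> t1 = u 0" using regularD[OF 1] by (intro uniq[OF 0]) auto
  then have \<psi>0: "\<psi> 0 = \<phi> (g1 t1)" by (simp add: \<psi>_def)
  have "g2 = k 1 \<and> t2 = u 1" using regularD[OF 2] e1 by (intro uniq[OF \<open>1 \<in> X\<close>]) auto
  then have \<psi>1: "\<psi> 1 = \<phi> (g2 t2)" by (simp add: \<psi>_def)
  define Y where "Y = {r\<in>X. \<psi> r \<noteq> \<psi> 0}"
  have Y: "finite Y" "Y \<noteq> {}" using \<open>finite X\<close> \<open>1 \<in> X\<close> \<phi> \<psi>0 \<psi>1 by (auto simp: Y_def)
  define b where "b = Min Y"
  have b: "b \<in> Y" "\<And>r. r \<in> Y \<Longrightarrow> b \<le> r" using Y by (auto simp: b_def)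
  have bX: "b \<in> X" "\<psi> b \<noteq> \<psi> 0" using b(1) by (auto simp: Y_def)
  then have "b \<noteq> 0" by auto
  then have "0 < b" using bX(1) by (auto simp: X_def)
  define Z where "Z = {r\<in>X. r < b}"
  have Z: "finite Z" "Z \<noteq> {}" using \<open>finite X\<close> 0 \<open>0 < b\<close> by (auto simp: Z_def)
  define a where "a = Max Z"
  have a: "a \<in> Z" "\<And>r. r \<in> Z \<Longrightarrow> r \<le> a" using Z by (auto simp: a_def)
  have aX: "a \<in> X" "a < b" using a(1) by (auto simp: Z_def)
  have "\<psi> a = \<psi> 0" using b(2)[of a] aX by (auto simp: Y_def)
  then have ab: "\<psi> a \<noteq> \<psi> b" using bX(2) by simp
  have between: "r = a \<or> r = b" if "r \<in> X" "a \<le> r" "r \<le> b" for r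
    using a(2)[of r] that by (auto simp: Z_def)
  have clean: "clean_segment (k p) (u p) (k q) (u q)" if pq: "p = a \<and> q = b \<or> p = b \<and> q = a" for p q
    unfolding clean_segment_def
  proof (intro conjI ballI impI)
    have X: "p \<in> X" "q \<in> X" using pq aX bX by auto
    have ne: "q - p \<noteq> 0" using pq aX(2) by auto
    show "regular (k p) (u p)" "regular (k q) (u q)" using kregular X by auto
    have diff: "(k q (u q) - k p (u p)) $ i = (q - p) * e $ i" if "i = 1 \<or> i = 2" for i
      using ku(3)[OF X(1)] ku(3)[OF X(2)] that by (auto simp: plane_proj_eq_iff algebra_simps)
    have det: "plane_det d (k q (u q) - k p (u p)) = (q - p) * plane_det d e" for d
      unfolding plane_det_def diff[of 1, OF disjI1[OF refl]] diff[of 2, OF disjI2[OF refl]] by (simp add: algebra_simps)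
    show "plane_det (dir (k p) (u p)) (k q (u q) - k p (u p)) \<noteq> 0"
      "plane_det (dir (k q) (u q)) (k q (u q) - k p (u p)) \<noteq> 0"
      unfolding det using ne tr kregular X by auto
    fix h s x assume h: "h \<in> D" "s \<in> {0..1::real}" and x: "x \<in> {0..1::real}"
      and eq: "plane_proj (h s) = plane_proj (k p (u p) + x *\<^sub>R (k q (u q) - k p (u p)))"
    define r where "r = p + x * (q - p)"
    have comp: "(k p (u p) + x *\<^sub>R (k q (u q) - k p (u p))) $ i = (?x + r *\<^sub>R e) $ i" if "i = 1 \<or> i = 2" for i
    proof -
      have "k p (u p) $ i = ?x $ i + p * e $ i" using ku(3)[OF X(1)] that by (auto simp: plane_proj_eq_iff)
      then show ?thesis using diff[OF that] by (simp add: r_def algebra_simps)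
    qed
    have eq': "plane_proj (h s) = plane_proj (?x + r *\<^sub>R e)"
      using eq comp[of 1] comp[of 2] by (simp add: plane_proj_eq_iff)
    have rb: "a \<le> r \<and> r \<le> b"
    proof -
      have "0 \<le> x * (b - a)" "x * (b - a) \<le> b - a" using x aX(2) by (auto simp: mult_left_le_one_le)
      then show ?thesis using pq by (auto simp: r_def algebra_simps)
    qed
    then have "r \<in> {0..1}" using aX(1) bX(1) by (auto simp: X_def)
    then have "r \<in> X" using XI h eq' by blast
    then have "r = p \<or> r = q" using between rb pq by blast
    then show "h = k p \<and> s = u p \<or> h = k q \<and> s = u q" using uniq[OF _ h eq'] X by blast
  qed
  show ?thesis
  proof (cases "\<psi> a")
    case True
    then show ?thesis using that[OF clean[of a b]] ab by (simp add: \<psi>_def)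
  next
    case False
    then show ?thesis using that[OF clean[of b a]] ab by (simp add: \<psi>_def)
  qed
qed

lemma regular_in_interval:
  assumes "g \<in> D" "a < b" "{a<..<b} \<subseteq> {0..1}"
  obtains t where "regular g t" "t \<in> {a<..<b}"
proof -
  have "infinite ({a<..<b} - B g)" using assms cut_points(1) by (intro Diff_infinite_finite) auto
  then obtain t where "t \<in> {a<..<b} - B g" by (metis finite.emptyI ex_in_conv)
  then show ?thesis using that[of t] assms by (auto simp: regular_def)
qed

lemma regular_of_same_color:
  assumes col: "point_coloring D c" and p: "p \<in> arc_points D"
  obtains g t where "regular g t" "c (g t) = c p"
proof -
  note found = that
  obtain g s where g: "g \<in> D" "s \<in> {0..1}" "p = g s"
    using p unfolding arc_points_def link_space_eq by blast
  have "\<forall>\<^sub>F x in nhds p. x \<in> arc_points D \<longrightarrow> c x = c p"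
    using point_coloringD(2)[OF col p] unfolding eventually_at_filter by eventually_elim auto
  moreover have "(g \<longlongrightarrow> g s) (at s within {0..1})"
    using link_diagram_continuous[OF diagram g(1)] g(2) by (simp add: continuous_on_def)
  ultimately have "\<forall>\<^sub>F r in at s within {0..1}. g r \<in> arc_points D \<longrightarrow> c (g r) = c p"
    unfolding g(3) by (rule eventually_compose_filterlim)
  then obtain d where d: "d > 0" "\<And>r. r \<in> {0..1} \<Longrightarrow> r \<noteq> s \<Longrightarrow> dist r s < d \<Longrightarrow>
      g r \<in> arc_points D \<longrightarrow> c (g r) = c p"
    unfolding eventually_at by blast
  have near: thesis if ab: "a < b" "{a<..<b} \<subseteq> {0..1}" "\<And>r. r \<in> {a<..<b} \<Longrightarrow> r \<noteq> s \<and> dist r s < d" for a b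
  proof -
    obtain t where t: "regular g t" "t \<in> {a<..<b}" using regular_in_interval[OF g(1) ab(1,2)] by blast
    have "c (g t) = c p" using d(2)[of t] ab(3)[OF t(2)] regularD(4)[OF t(1)] regular_arc_point[OF t(1)] by blast
    then show thesis using found t(1) by blast
  qed
  show thesis
  proof (cases "s < 1")
    case True
    show thesis
      by (rule near[of s "min 1 (s + d)"]) (use True d(1) g(2) in \<open>auto simp: dist_real_def\<close>)
  next
    case False
    show thesis
      by (rule near[of "max 0 (s - d)" s]) (use False d(1) g(2) in \<open>auto simp: dist_real_def\<close>)
  qed
qed

text \<open>A closed curve whose projection lies on a line would run over almost every point of its
  image at least twice, on the way there and on the way back.\<close>

lemma component_not_on_line:
  assumes g: "g \<in> D" and u: "u $ 1 \<noteq> 0 \<or> u $ 2 \<noteq> 0"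
  obtains t where "regular g t" "plane_det (g t - x) u \<noteq> 0"
proof (rule ccontr)
  note found = that
  assume "\<not> thesis"
  then have line: "plane_det (g t - x) u = 0" if "regular g t" for t using found[OF that] by blast
  define F0 where "F0 t = u $ 1 * g t $ 1 + u $ 2 * g t $ 2" for t
  have inj: "t = t'" if tt: "regular g t" "regular g t'" "F0 t = F0 t'" for t t'
  proof -
    let ?w = "g t - g t'"
    have 1: "plane_det ?w u = 0" using line[OF tt(1)] line[OF tt(2)] by simp
    have 2: "u $ 1 * ?w $ 1 + u $ 2 * ?w $ 2 = 0" using tt(3) by (simp add: F0_def algebra_simps)
    have "((u $ 1)\<^sup>2 + (u $ 2)\<^sup>2) * ?w $ 1 = u $ 1 * (u $ 1 * ?w $ 1 + u $ 2 * ?w $ 2) + u $ 2 * plane_det ?w u"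
      "((u $ 1)\<^sup>2 + (u $ 2)\<^sup>2) * ?w $ 2 = u $ 2 * (u $ 1 * ?w $ 1 + u $ 2 * ?w $ 2) - u $ 1 * plane_det ?w u"
      by (simp_all add: plane_det_def power2_eq_square algebra_simps)
    moreover have "(u $ 1)\<^sup>2 + (u $ 2)\<^sup>2 \<noteq> 0" using u by (auto simp: sum_power2_eq_zero_iff)
    ultimately have "?w $ 1 = 0" "?w $ 2 = 0" unfolding 1 2 by auto
    then have "plane_proj (g t) = plane_proj (g t')" by (simp add: plane_proj_eq_iff)
    then show "t = t'" using regular_unique[OF tt(2) g regularD(4)[OF tt(1)]] by blast
  qed
  have cont0: "continuous_on {0..1} F0"
    unfolding F0_def using link_diagram_continuous[OF diagram g] by (intro continuous_intros)
  have closed: "F0 0 = F0 1"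
    using link_diagramD(4)[OF diagram g] by (simp add: F0_def pathfinish_def pathstart_def)
  obtain s where s: "regular g s" "F0 s \<noteq> F0 0"
  proof -
    obtain t1 where t1: "regular g t1" "t1 \<in> {0<..<1/2}" using regular_in_interval[OF g, of 0 "1/2"] by force
    obtain t2 where t2: "regular g t2" "t2 \<in> {1/2<..<1}" using regular_in_interval[OF g, of "1/2" 1] by force
    have "F0 t1 \<noteq> F0 t2" using inj[OF t1(1) t2(1)] t1(2) t2(2) by auto
    then have "F0 t1 \<noteq> F0 0 \<or> F0 t2 \<noteq> F0 0" by auto
    then show ?thesis using that t1(1) t2(1) by blast
  qed
  define F where "F t = (if F0 s > F0 0 then F0 t else - F0 t)" for t
  have cont: "continuous_on {0..1} F"
    unfolding F_def using cont0 by (cases "F0 s > F0 0") (simp_all add: continuous_on_minus)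
  have F: "F 0 < F s" "F 1 = F 0" using s(2) closed by (auto simp: F_def)
  have "infinite ({F 0<..<F s} - F ` (B g))" using F(1) cut_points(1)[OF g] by (intro Diff_infinite_finite) auto
  then obtain y where y: "F 0 < y" "y < F s" "y \<notin> F ` (B g)" by (metis Diff_iff finite.emptyI ex_in_conv greaterThanLessThan_iff)
  note s01 = regularD(2)[OF s(1)]
  obtain r1 where r1: "0 \<le> r1" "r1 \<le> s" "F r1 = y"
    using IVT'[of F 0 y s] y(1,2) s01 continuous_on_subset[OF cont, of "{0..s}"] by auto
  obtain r2 where r2: "s \<le> r2" "r2 \<le> 1" "F r2 = y"
    using IVT2'[of F 1 y s] y(1,2) F(2) s01 continuous_on_subset[OF cont, of "{s..1}"] by auto
  have "r1 \<notin> B g" "r2 \<notin> B g" using y(3) r1(3) r2(3) by (metis imageI)+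
  then have "regular g r1" "regular g r2" using r1 r2 s01 g by (auto simp: regular_def)
  moreover have "F0 r1 = F0 r2" using r1(3) r2(3) by (auto simp: F_def split: if_splits)
  ultimately have "r1 = r2" by (rule inj)
  then have "r1 = s" using r1(2) r2(1) by simp
  then show False using r1(3) y(2) by simp
qed

text \<open>A generic segment exists unless the edges at the two given points lie on one line. In that case
  a point of the diagram off this line replaces one of the two, depending on its value of \<open>\<phi>\<close>.\<close>

lemma clean_mixed_segment:
  assumes 1: "regular g1 t1" "\<phi> (g1 t1)" and 2: "regular g2 t2" "\<not> \<phi> (g2 t2)"
    and loc: "\<And>g t. regular g t \<Longrightarrow> \<forall>\<^sub>F r in nhds t. \<phi> (g r) = \<phi> (g t)"
  obtains g t h s where "clean_segment g t h s" "\<phi> (g t)" "\<not> \<phi> (h s)"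
proof -
  note found = that
  have core: thesis if a: "regular a r" and b: "regular b s" and ne: "\<phi> (a r) \<noteq> \<phi> (b s)"
    and nc: "plane_det (a r - b s) (dir b s) \<noteq> 0" for a r b s
  proof -
    obtain t where t: "regular b t" "\<phi> (b t) = \<phi> (b s)" "generic (a r) (b t)"
      using generic_segment_near[OF a b nc loc[OF b]] by blast
    have ne': "\<phi> (a r) \<noteq> \<phi> (b t)" using ne t(2) by simp
    show thesis by (rule clean_part_of_generic_segment[where \<phi> = \<phi>, OF a t(1,3) ne']) (rule found)
  qed
  let ?x = "g1 t1" and ?y = "g2 t2"
  show thesis
  proof (cases "plane_det (?x - ?y) (dir g2 t2) = 0 \<and> plane_det (?y - ?x) (dir g1 t1) = 0")
    case False
    then show thesis using core[OF 1(1) 2(1)] core[OF 2(1) 1(1)] 1(2) 2(2) by blast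
  next
    case True
    define u where "u = ?y - ?x"
    have u: "u $ 1 \<noteq> 0 \<or> u $ 2 \<noteq> 0"
    proof (rule ccontr)
      assume "\<not> ?thesis"
      then have "plane_proj ?x = plane_proj ?y" by (simp add: u_def plane_proj_eq_iff)
      then have "g1 = g2 \<and> t1 = t2" using regular_unique[OF 2(1) regularD(1,4)[OF 1(1)]] by blast
      then show False using 1(2) 2(2) by simp
    qed
    obtain r where r: "regular g1 r" "plane_det (g1 r - ?x) u \<noteq> 0"
      using component_not_on_line[OF regularD(1)[OF 1(1)] u] by blast
    let ?o = "g1 r"
    have ou: "plane_det (?o - ?y) u \<noteq> 0"
      using r(2) plane_det_swap[of ?y ?x] by (simp add: u_def algebra_simps)
    have nx: "plane_det (?o - ?x) (dir g1 t1) \<noteq> 0"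
      using plane_parallel[of "?o - ?x" "dir g1 t1" u] dir_nonzero[OF 1(1)] True r(2) unfolding u_def by blast
    have "plane_det u (dir g2 t2) = 0" using True by (simp add: u_def)
    then have ny: "plane_det (?o - ?y) (dir g2 t2) \<noteq> 0"
      using plane_parallel[of "?o - ?y" "dir g2 t2" u] dir_nonzero[OF 2(1)] ou by blast
    show thesis
    proof (cases "\<phi> ?o")
      case True
      then show thesis using core[OF r(1) 2(1) _ ny] 2(2) by blast
    next
      case False
      then show thesis using core[OF r(1) 1(1) _ nx] 1(2) by blast
    qed
  qed
qed

end

section \<open>The symmetric group of degree 3\<close>

text \<open>One-line notation.\<close>

definition perm3 :: "nat \<Rightarrow> nat \<Rightarrow> nat \<Rightarrow> nat \<Rightarrow> nat" where
  "perm3 i j k n = (if n = 1 then i else if n = 2 then j else if n = 3 then k else n)"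

definition S3_transpositions :: "(nat \<Rightarrow> nat) set" where
  "S3_transpositions = {perm3 2 1 3, perm3 3 2 1, perm3 1 3 2}"

definition S3_cycles :: "(nat \<Rightarrow> nat) set" where
  "S3_cycles = {perm3 2 3 1, perm3 3 1 2}"

lemma perm3_eq_iff [simp]: "perm3 i j k = perm3 i' j' k' \<longleftrightarrow> i = i' \<and> j = j' \<and> k = k'"
proof
  assume eq: "perm3 i j k = perm3 i' j' k'"
  show "i = i' \<and> j = j' \<and> k = k'"
    using fun_cong[OF eq, of 1] fun_cong[OF eq, of 2] fun_cong[OF eq, of 3] by (simp add: perm3_def)
qed simp

lemma perm3_comp:
  assumes "i \<in> {1, 2, 3}" "j \<in> {1, 2, 3}" "k \<in> {1, 2, 3}"
  shows "perm3 a b c \<circ> perm3 i j k = perm3 (perm3 a b c i) (perm3 a b c j) (perm3 a b c k)"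
  by (rule ext) (simp add: perm3_def)

lemma perm3_cases:
  assumes "i \<in> {1, 2, 3}" "j \<in> {1, 2, 3}" "k \<in> {1, 2, 3}" "i \<noteq> j" "i \<noteq> k" "j \<noteq> k"
  shows "perm3 i j k \<in> S3_transpositions \<union> S3_cycles \<union> {perm3 1 2 3}"
  using assms unfolding S3_transpositions_def S3_cycles_def by auto

lemma nontrivial_S3:
  "S3_colors = S3_transpositions \<union> S3_cycles"
proof -
  have id: "id = perm3 1 2 3" by (rule ext) (simp add: perm3_def)
  have set3: "{1..3::nat} = {1, 2, 3}" by auto
  have "p \<in> S3_transpositions \<union> S3_cycles \<union> {id}" if p: "p permutes {1..3}" for p
  proof -
    have p_eq: "p = perm3 (p 1) (p 2) (p 3)"
      using p unfolding permutes_def set3 by (intro ext) (auto simp: perm3_def)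
    have "p 1 \<in> {1, 2, 3}" "p 2 \<in> {1, 2, 3}" "p 3 \<in> {1, 2, 3}"
      using permutes_in_image[OF p] unfolding set3 by blast+
    moreover have "p 1 \<noteq> p 2" "p 1 \<noteq> p 3" "p 2 \<noteq> p 3"
      using permutes_inj[OF p] by (simp_all add: inj_eq)
    ultimately have "perm3 (p 1) (p 2) (p 3) \<in> S3_transpositions \<union> S3_cycles \<union> {id}"
      unfolding id by (rule perm3_cases)
    then show ?thesis unfolding p_eq[symmetric] .
  qed
  moreover have "p permutes {1..3}" if p: "p \<in> S3_transpositions \<union> S3_cycles" for p
  proof (rule bij_imp_permutes)
    show "bij_betw p {1..3} {1..3}"
      unfolding set3 bij_betw_def inj_on_def
      using p by (auto simp: S3_transpositions_def S3_cycles_def perm3_def)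
    show "\<And>x. x \<notin> {1..3} \<Longrightarrow> p x = x"
      using p by (auto simp: S3_transpositions_def S3_cycles_def perm3_def set3)
  qed
  moreover have "id \<notin> S3_transpositions \<union> S3_cycles"
    by (simp add: id S3_transpositions_def S3_cycles_def)
  ultimately show ?thesis
    unfolding sym_group_def by auto
qed

lemma card_S3_transpositions: "card S3_transpositions = 3" and card_S3_cycles: "card S3_cycles = 2"
  and S3_transpositions_cycles_disjoint: "S3_transpositions \<inter> S3_cycles = {}"
  by (simp_all add: S3_transpositions_def S3_cycles_def)

lemma conjugate_three_cycle:
  assumes "a \<in> S3_transpositions" "r \<in> S3_cycles"
  shows "\<exists>z\<in>S3_cycles. S3_cycles = {r, z} \<and>
    a \<star> r = z \<star> a \<and> a \<star> z = r \<star> a"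
  using assms unfolding sym_group_mult S3_transpositions_def S3_cycles_def
  by (auto simp: perm3_comp) (auto simp: perm3_def)

text \<open>Conjugation by \<open>r\<close> permutes the three transpositions cyclically, so \<open>w\<close> is the conjugate of \<open>a\<close> by
  \<open>r\<close> or by its inverse.\<close>

lemma conjugate_transposition:
  assumes "a \<in> S3_transpositions" "r \<in> S3_cycles" "w \<in> S3_transpositions" "w \<noteq> a"
  shows "r \<star> a = w \<star> r \<or> r \<star> w = a \<star> r"
  using assms unfolding sym_group_mult S3_transpositions_def S3_cycles_def
  by (auto simp: perm3_comp) (auto simp: perm3_def)

section \<open>Four colors give five\<close>

theorem proposition1p1:
  fixes L :: "(real \<Rightarrow> (real^3) \<times> real) set"
  assumes "oriented_link_in S3 L"
    and "S3_n_colorable 4 L"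
  shows "S3_n_colorable 5 L"
proof -
  obtain D c where D: "diagram_of D L" and col: "point_coloring D c" and card4: "card (c ` arc_points D) = 4"
    using assms(2) unfolding S3_n_colorable_iff_point_coloring by blast
  have diag: "link_diagram D" using D by (simp add: diagram_of_def)
  let ?X = "c ` arc_points D" and ?N = "S3_transpositions \<union> S3_cycles"
  have XN: "?X \<subseteq> ?N" using point_coloringD(1)[OF col] unfolding nontrivial_S3 by blast
  have finN: "finite ?N" by (simp add: S3_transpositions_def S3_cycles_def)
  have finX: "finite ?X" using card4 by (metis card.infinite zero_neq_numeral)
  have "card ?N = 5"
    using card_Un_disjoint[of S3_transpositions S3_cycles] card_S3_transpositions card_S3_cycles
      S3_transpositions_cycles_disjoint finN by simp
  then obtain w where w: "w \<in> ?N" "w \<notin> ?X"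
    using card_mono[OF finX, of ?N] card4 by fastforce
  have five: "S3_n_colorable 5 L"
    if "diagram_of D1 L" "point_coloring D1 c1" "c1 ` arc_points D1 = insert y ?X" "y \<notin> ?X" for D1 c1 y
    unfolding S3_n_colorable_iff_point_coloring
    using that finX card4 by (intro exI[of _ D1] exI[of _ c1]) simp
  have "\<not> ?X \<subseteq> S3_transpositions" "\<not> ?X \<subseteq> S3_cycles"
    using card_mono[of S3_transpositions ?X] card_mono[of S3_cycles ?X] finN card4
      card_S3_transpositions card_S3_cycles by auto
  then obtain p1 p2 where p: "p1 \<in> arc_points D" "c p1 \<in> S3_cycles" "p2 \<in> arc_points D" "c p2 \<notin> S3_cycles"
    using XN by blast
  obtain B where B: "cells D B" using cells_exist[OF diag] by blast
  interpret celled D B using diag B by unfold_locales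
  obtain g1 t1 where 1: "regular g1 t1" "c (g1 t1) = c p1" using regular_of_same_color[OF col p(1)] .
  obtain g2 t2 where 2: "regular g2 t2" "c (g2 t2) = c p2" using regular_of_same_color[OF col p(3)] .
  have loc: "\<forall>\<^sub>F r in nhds t. (c (g r) \<in> S3_cycles) = (c (g t) \<in> S3_cycles)" if "regular g t" for g t
    using color_near[OF diag col regularD(1,2)[OF that] regular_arc_point[OF that]] by eventually_elim simp
  have ends: "c (g1 t1) \<in> S3_cycles" "\<not> c (g2 t2) \<in> S3_cycles" using 1(2) 2(2) p by simp_all
  obtain g t h s where seg: "clean_segment g t h s" and r: "c (g t) \<in> S3_cycles" and a: "c (h s) \<notin> S3_cycles"
    using clean_mixed_segment[where \<phi> = "\<lambda>x. c x \<in> S3_cycles", OF 1(1) ends(1) 2(1) ends(2) loc] by blast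
  \<comment> \<open>A finger of the strand with the three-cycle \<open>?r\<close> under the strand with the transposition \<open>?a\<close>
    brings in the other three-cycle \<open>z\<close>.\<close>
  let ?r = "c (g t)" and ?a = "c (h s)"
  have regular: "regular g t" "regular h s" using seg by (simp_all add: clean_segment_def)
  have a': "?a \<in> S3_transpositions" using regular_arc_point[OF regular(2)] XN a by blast
  obtain z where z: "z \<in> S3_cycles" "S3_cycles = {?r, z}"
    "?a \<star> ?r = z \<star> ?a" "?a \<star> z = ?r \<star> ?a"
    using conjugate_three_cycle[OF a' r] by blast
  have zN: "z \<in> S3_colors" using z(1) unfolding nontrivial_S3 by blast
  have lin: "\<forall>\<^sub>F r in nhds t. g r = g t + (r - t) *\<^sub>R dir g t" if "regular g t" for g t
    using regular_near[OF that] by eventually_elim blast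
  have "\<exists>D1 c1. diagram_of D1 L \<and> point_coloring D1 c1 \<and> c1 ` arc_points D1 = insert z ?X \<and>
    (\<exists>G s' H t'. crossing D1 G s' H t' \<and> c1 (G s') = ?a \<and> (\<forall>\<^sub>F \<tau> in at_left t'. c1 (H \<tau>) = ?r))" (is "\<exists>D1 c1. ?P D1 c1")
  proof (rule finger_move[OF D col regularD(1,2)[OF regular(1)] regularD(1,2)[OF regular(2)] lin[OF regular(1)] lin[OF regular(2)],
        where e = "h s - g t"])
    show "plane_proj (h s) = plane_proj (g t + (h s - g t))" by simp
    show "plane_det (dir g t) (h s - g t) \<noteq> 0" "plane_det (dir h s) (h s - g t) \<noteq> 0"
      using seg unfolding clean_segment_def by blast+
    show "k = g \<and> y = t \<or> k = h \<and> y = s"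
      if "k \<in> D" "y \<in> {0..1}" "x \<in> {0..1}" "plane_proj (k y) = plane_proj (g t + x *\<^sub>R (h s - g t))" for k y x
      using seg that unfolding clean_segment_def by blast
  qed (rule zN, rule z(3), rule z(4))
  then obtain D1 c1 where D1c1: "?P D1 c1" by (elim exE)
  note D1 = D1c1[THEN conjunct1] and col1 = D1c1[THEN conjunct2, THEN conjunct1]
    and X1 = D1c1[THEN conjunct2, THEN conjunct2, THEN conjunct1]
  from D1c1[THEN conjunct2, THEN conjunct2, THEN conjunct2] obtain G s' H t' where cr: "crossing D1 G s' H t'" "c1 (G s') = ?a"
      "\<forall>\<^sub>F \<tau> in at_left t'. c1 (H \<tau>) = ?r" by (elim exE conjE)
  show ?thesis
  proof (cases "z \<in> ?X")
    case False
    then show ?thesis using five[OF D1 col1 X1] by blast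
  next
    \<comment> \<open>Both three-cycles are present, so \<open>w\<close> is a transposition. At the new crossing, the over strand
      with the color \<open>?a\<close> is pushed under the strand with the color \<open>?r\<close>.\<close>
    case True
    have "?r \<in> ?X" "?a \<in> ?X" using regular_arc_point[OF regular(1)] regular_arc_point[OF regular(2)] by blast+
    then have "w \<noteq> ?r" "w \<noteq> z" "w \<noteq> ?a" using w(2) True by auto
    then have w': "w \<in> S3_transpositions" "w \<noteq> ?a" using w(1) z(2) by auto
    have "?r \<star> c1 (G s') = w \<star> ?r \<or> ?r \<star> w = c1 (G s') \<star> ?r"
      unfolding cr(2) by (intro conjugate_transposition[OF a' r w'])
    moreover have "w \<in> S3_colors" using w(1) unfolding nontrivial_S3 .
    ultimately obtain D2 c2 where D2: "diagram_of D2 L" "point_coloring D2 c2" "c2 ` arc_points D2 = insert w (c1 ` arc_points D1)"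
      using finger_move_at_crossing[OF D1 col1 cr(1,3)] by blast
    have "c2 ` arc_points D2 = insert w ?X" using D2(3) X1 True by (simp add: insert_absorb)
    then show ?thesis using five[OF D2(1,2)] w(2) by blast
  qed
qed

end
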